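(* For every integer $n\ge 1$ and every $\delta\in(0,\pi)$, the connectivity of $\check{C}(S^n;\pi-\delta)$ satisfies \[\tfrac{1}{2}\operatorname{numCover}_{S^n}(\delta)-2\ \le\ \operatorname{conn}(\check{C}(S^n;\pi-\delta))\ \le\ \operatorname{numCover}_{S^n}\!\left(\tfrac{\delta}{2}\right)-2.\]
   Context: $S^n=\{x\in\mathbb{R}^{n+1} : \|x\|=1\}$ is equipped with the geodesic metric $d(x,y)=\arccos(x\cdot y)\in[0,\pi]$, so it has diameter $\pi$. For a metric space $(X,d)$, write $B(x,r)=\{y\in X : d(y,x)<r\}$ and $B[x,r]=\{y\in X : d(y,x)\le r\}$ for the open and closed balls. Čech complex: for $r>0$, $\check{C}(X;r)$ is the (intrinsic) nerve of the family of open balls $\{B(x,r)\}_{x\in X}$, i.e. the (possibly infinite) simplicial complex with vertex set $X$ in which a finite nonempty subset $\sigma\subseteq X$ is a simplex if and only if $\bigcap_{x\in\sigma}B(x,r)\neq\emptyset$. Simplicial complexes are identified with their geometric realizations. Connectivity: for a nonempty topological space $Y$, $\operatorname{conn}(Y)$ is the maximal $k$ such that $\pi_i(Y)$ is trivial for all $i\le k$ (so $\operatorname{conn}(Y)=-1$ if $Y$ is nonempty and not path-connected, and $\operatorname{conn}(Y)=\infty$ if all homotopy groups are trivial). Covering number: for $\delta>0$, $\operatorname{numCover}_X(\delta)$ is the smallest integer $m\ge 1$ such that there exist $x_1,\dots,x_m\in X$ with $\bigcup_{i=1}^m B[x_i,\delta]=X$. *)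

theory Defs
  imports "HOL-Analysis.Analysis"
begin

section \<open>The sphere with its geodesic metric\<close>

text \<open>
  The points of the library's \<^const>\<open>nsphere\<close> in dimension \<open>n\<close> are functions \<^typ>\<open>nat \<Rightarrow> real\<close> with
  coordinates \<open>0, \<dots>, n\<close> that vanish at every index above \<open>n\<close>.
\<close>

abbreviation sphere_pts :: "nat \<Rightarrow> (nat \<Rightarrow> real) set" where
  "sphere_pts n \<equiv> topspace (nsphere n)"

text \<open>
  The value off the sphere is irrelevant; it is set to \<open>0\<close> because \<^locale>\<open>Metric_space\<close> asks for
  symmetry and nonnegativity on the whole type.
\<close>

definition geodesic_dist :: "nat \<Rightarrow> (nat \<Rightarrow> real) \<Rightarrow> (nat \<Rightarrow> real) \<Rightarrow> real" where
  "geodesic_dist n x y =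
     (if x \<in> sphere_pts n \<and> y \<in> sphere_pts n then arccos (\<Sum>i\<le>n. x i * y i) else 0)"

lemma sphere_pts_eq: "sphere_pts n = {x. (\<Sum>i\<le>n. (x i)\<^sup>2) = 1 \<and> (\<forall>i>n. x i = 0)}"
  by (simp add: nsphere)

lemma sphere_inner_le_1:
  assumes "x \<in> sphere_pts n" "y \<in> sphere_pts n"
  shows "\<bar>\<Sum>i\<le>n. x i * y i\<bar> \<le> 1"
proof -
  have "(\<Sum>i\<le>n. x i * y i)\<^sup>2 \<le> (\<Sum>i\<le>n. (x i)\<^sup>2) * (\<Sum>i\<le>n. (y i)\<^sup>2)"
    by (rule Cauchy_Schwarz_ineq_sum)
  then show ?thesis
    using assms by (simp add: sphere_pts_eq abs_square_le_1)
qed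

lemma Metric_space_sphere: "Metric_space (sphere_pts n) (geodesic_dist n)"
proof
  fix x y
  show "geodesic_dist n x y = geodesic_dist n y x"
    by (simp add: geodesic_dist_def mult.commute)
  show "0 \<le> geodesic_dist n x y"
    using sphere_inner_le_1 [of x n y] by (simp add: geodesic_dist_def arccos_lbound abs_le_iff)
next
  fix x y
  assume xy: "x \<in> sphere_pts n" "y \<in> sphere_pts n"
  let ?a = "\<Sum>i\<le>n. x i * y i"
  have "(\<Sum>i\<le>n. (x i - y i)\<^sup>2) = (\<Sum>i\<le>n. (x i)\<^sup>2) + (\<Sum>i\<le>n. (y i)\<^sup>2) - 2 * ?a"
    by (simp only: power2_diff sum.distrib sum_subtractf sum_distrib_left mult.assoc)
  then have *: "(\<Sum>i\<le>n. (x i - y i)\<^sup>2) = 2 - 2 * ?a"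
    using xy by (simp add: sphere_pts_eq)
  have "x = y \<longleftrightarrow> (\<forall>i\<le>n. x i = y i)"
  proof (intro iffI ext allI impI)
    fix i
    assume "\<forall>i\<le>n. x i = y i"
    moreover have "i > n \<Longrightarrow> x i = 0" "i > n \<Longrightarrow> y i = 0"
      using xy by (simp_all add: sphere_pts_eq)
    ultimately show "x i = y i"
      by (cases "i \<le> n") (blast, simp)
  qed simp
  also have "\<dots> \<longleftrightarrow> (\<Sum>i\<le>n. (x i - y i)\<^sup>2) = 0"
    by (subst sum_nonneg_eq_0_iff) auto
  also have "\<dots> \<longleftrightarrow> ?a = 1"
    using * by auto
  also have "\<dots> \<longleftrightarrow> geodesic_dist n x y = 0"
  proof -
    have "?a = 1 \<longleftrightarrow> arccos ?a = 0"
      using sphere_inner_le_1 [OF xy] by (metis arccos_1 cos_arccos_abs cos_zero)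
    then show ?thesis
      using xy by (simp add: geodesic_dist_def)
  qed
  finally show "geodesic_dist n x y = 0 \<longleftrightarrow> x = y" by simp
next
  fix x y z
  assume x: "x \<in> sphere_pts n" and y: "y \<in> sphere_pts n" and z: "z \<in> sphere_pts n"
  define a where "a = (\<Sum>i\<le>n. x i * y i)"
  define b where "b = (\<Sum>i\<le>n. y i * z i)"
  define c where "c = (\<Sum>i\<le>n. x i * z i)"
  have ab: "\<bar>a\<bar> \<le> 1" "\<bar>b\<bar> \<le> 1" "\<bar>c\<bar> \<le> 1"
    using sphere_inner_le_1 x y z by (auto simp: a_def b_def c_def)
  have sq: "(\<Sum>i\<le>n. (x i)\<^sup>2) = 1" "(\<Sum>i\<le>n. (y i)\<^sup>2) = 1" "(\<Sum>i\<le>n. (z i)\<^sup>2) = 1"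
    using x y z by (auto simp: sphere_pts_eq)
  have expand: "(\<Sum>i\<le>n. (u i - r * y i) * (v i - s * y i))
      = (\<Sum>i\<le>n. u i * v i) - s * (\<Sum>i\<le>n. u i * y i) - r * (\<Sum>i\<le>n. y i * v i) + r * s"
    for u v r s
  proof -
    have "(\<Sum>i\<le>n. (u i - r * y i) * (v i - s * y i))
        = (\<Sum>i\<le>n. u i * v i - s * (u i * y i) - r * (y i * v i) + r * s * (y i)\<^sup>2)"
      by (rule sum.cong) (simp_all add: algebra_simps power2_eq_square)
    also have "\<dots> = (\<Sum>i\<le>n. u i * v i) - s * (\<Sum>i\<le>n. u i * y i) - r * (\<Sum>i\<le>n. y i * v i)
        + r * s * (\<Sum>i\<le>n. (y i)\<^sup>2)"
      by (simp only: sum.distrib sum_subtractf sum_distrib_left)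
    finally show ?thesis
      using sq by simp
  qed
  have sym: "(\<Sum>i\<le>n. y i * x i) = a" "(\<Sum>i\<le>n. z i * y i) = b"
    by (simp_all add: a_def b_def mult.commute)
  have 1: "(\<Sum>i\<le>n. (x i - a * y i) * (z i - b * y i)) = c - a * b"
    using expand [of x a z b] by (simp flip: a_def b_def c_def)
  have 2: "(\<Sum>i\<le>n. (x i - a * y i)\<^sup>2) = 1 - a\<^sup>2"
    using expand [of x a x a] sq sym by (simp add: power2_eq_square flip: a_def)
  have 3: "(\<Sum>i\<le>n. (z i - b * y i)\<^sup>2) = 1 - b\<^sup>2"
    using expand [of z b z b] sq sym by (simp add: power2_eq_square flip: b_def)
  have "(c - a * b)\<^sup>2 \<le> (1 - a\<^sup>2) * (1 - b\<^sup>2)"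
    using Cauchy_Schwarz_ineq_sum [of "\<lambda>i. x i - a * y i" "\<lambda>i. z i - b * y i" "{..n}"]
    by (simp add: 1 2 3)
  then have "\<bar>c - a * b\<bar> \<le> sqrt (1 - a\<^sup>2) * sqrt (1 - b\<^sup>2)"
    by (metis real_sqrt_abs real_sqrt_le_iff real_sqrt_mult)
  then have "cos (arccos a + arccos b) \<le> c"
    using ab by (simp add: cos_add sin_arccos_abs abs_le_iff)
  moreover have "0 \<le> arccos a" "0 \<le> arccos b" "0 \<le> arccos c" "arccos c \<le> pi" "cos (arccos c) = c"
    using ab by (auto simp: arccos_lbound arccos_ubound abs_le_iff)
  ultimately have "arccos c \<le> arccos a + arccos b"
    by (smt (verit) cos_monotone_0_pi)
  then show "geodesic_dist n x z \<le> geodesic_dist n x y + geodesic_dist n y z"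
    using x y z by (simp add: geodesic_dist_def a_def b_def c_def)
qed


section \<open>Covering numbers and Cech complexes\<close>

context Metric_space
begin

definition num_cover :: "real \<Rightarrow> nat" where
  "num_cover \<delta> =
     (LEAST m. m \<ge> 1 \<and> (\<exists>x :: nat \<Rightarrow> 'a. (\<forall>i\<in>{1..m}. x i \<in> M) \<and> (\<Union>i\<in>{1..m}. mcball (x i) \<delta>) = M))"

definition cech_complex :: "real \<Rightarrow> 'a set set" where
  "cech_complex r = {\<sigma>. finite \<sigma> \<and> \<sigma> \<noteq> {} \<and> \<sigma> \<subseteq> M \<and> (\<Inter>x\<in>\<sigma>. mball x r) \<noteq> {}}"

end


section \<open>Geometric realization\<close>

text \<open>
  An abstract simplicial complex is given by its set \<open>K\<close> of finite nonempty simplices. Points of the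
  realization are barycentric coordinate functions, and the topology is the weak (coherent) one:
  a set is open iff its trace on every closed simplex is open in that simplex. On a single
  simplex the product topology is the Euclidean one.
\<close>

definition closed_simplex :: "'a set \<Rightarrow> ('a \<Rightarrow> real) set" where
  "closed_simplex \<sigma> = {p. (\<forall>v. 0 \<le> p v) \<and> (\<forall>v. v \<notin> \<sigma> \<longrightarrow> p v = 0) \<and> (\<Sum>v\<in>\<sigma>. p v) = 1}"

definition geometric_realization :: "'a set set \<Rightarrow> ('a \<Rightarrow> real) topology" where
  "geometric_realization K = topology (\<lambda>U. U \<subseteq> (\<Union>\<sigma>\<in>K. closed_simplex \<sigma>) \<and>
     (\<forall>\<sigma>\<in>K. openin (subtopology (powertop_real UNIV) (closed_simplex \<sigma>)) (U \<inter> closed_simplex \<sigma>)))"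

lemma openin_geometric_realization:
  "openin (geometric_realization K) U \<longleftrightarrow> U \<subseteq> (\<Union>\<sigma>\<in>K. closed_simplex \<sigma>) \<and>
     (\<forall>\<sigma>\<in>K. openin (subtopology (powertop_real UNIV) (closed_simplex \<sigma>)) (U \<inter> closed_simplex \<sigma>))"
proof -
  have "istopology (\<lambda>U. U \<subseteq> (\<Union>\<sigma>\<in>K. closed_simplex \<sigma>) \<and>
     (\<forall>\<sigma>\<in>K. openin (subtopology (powertop_real UNIV) (closed_simplex \<sigma>)) (U \<inter> closed_simplex \<sigma>)))"
    (is "istopology ?P")
    unfolding istopology_def
  proof (rule conjI; intro allI impI)
    fix S T assume S: "?P S" and T: "?P T"
    have "openin (subtopology (powertop_real UNIV) (closed_simplex \<sigma>)) (S \<inter> T \<inter> closed_simplex \<sigma>)"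
      if "\<sigma> \<in> K" for \<sigma>
    proof -
      have "S \<inter> T \<inter> closed_simplex \<sigma> = (S \<inter> closed_simplex \<sigma>) \<inter> (T \<inter> closed_simplex \<sigma>)"
        by blast
      then show ?thesis using S T that by (metis openin_Int)
    qed
    then show "?P (S \<inter> T)" using S by blast
  next
    fix \<K> assume \<K>: "\<forall>S\<in>\<K>. ?P S"
    have "openin (subtopology (powertop_real UNIV) (closed_simplex \<sigma>)) (\<Union>\<K> \<inter> closed_simplex \<sigma>)"
      if "\<sigma> \<in> K" for \<sigma>
    proof -
      have "openin (subtopology (powertop_real UNIV) (closed_simplex \<sigma>)) (\<Union>S\<in>\<K>. S \<inter> closed_simplex \<sigma>)"
        using \<K> that by (intro openin_Union) blast
      then show ?thesis by (simp only: Int_Union2)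
    qed
    then show "?P (\<Union>\<K>)" using \<K> by blast
  qed
  then show ?thesis
    by (simp add: geometric_realization_def)
qed

lemma topspace_geometric_realization:
  "topspace (geometric_realization K) = (\<Union>\<sigma>\<in>K. closed_simplex \<sigma>)"
proof (rule subset_antisym)
  show "topspace (geometric_realization K) \<subseteq> (\<Union>\<sigma>\<in>K. closed_simplex \<sigma>)"
    using openin_geometric_realization by blast
  have "openin (subtopology (powertop_real UNIV) (closed_simplex \<sigma>))
          ((\<Union>\<sigma>\<in>K. closed_simplex \<sigma>) \<inter> closed_simplex \<sigma>)" if "\<sigma> \<in> K" for \<sigma>
  proof -
    have "(\<Union>\<sigma>\<in>K. closed_simplex \<sigma>) \<inter> closed_simplex \<sigma>
        = topspace (subtopology (powertop_real UNIV) (closed_simplex \<sigma>))"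
      using that by auto
    then show ?thesis by (metis openin_topspace)
  qed
  then show "(\<Union>\<sigma>\<in>K. closed_simplex \<sigma>) \<subseteq> topspace (geometric_realization K)"
    by (intro openin_subset) (simp add: openin_geometric_realization)
qed


section \<open>Homotopy groups and connectivity\<close>

definition nsphere_base :: "nat \<Rightarrow> real" where
  "nsphere_base = (\<lambda>j. if j = 0 then 1 else 0)"

text \<open>
  The underlying set of the \<open>i\<close>-th homotopy group of \<open>Y\<close> at \<open>y\<close>: based homotopy classes of based maps
  from the \<open>i\<close>-sphere to \<open>Y\<close>. For \<open>i = 0\<close> this is the set of path components. The group structure
  plays no role in whether it is trivial.
\<close>

definition homotopy_group_set :: "nat \<Rightarrow> 'b topology \<Rightarrow> 'b \<Rightarrow> ((nat \<Rightarrow> real) \<Rightarrow> 'b) set set" where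
  "homotopy_group_set i Y y =
     {f. continuous_map (nsphere i) Y f \<and> f nsphere_base = y} //
     {(f, g). homotopic_with (\<lambda>h. h nsphere_base = y) (nsphere i) Y f g}"

definition trivial_homotopy_group :: "nat \<Rightarrow> 'b topology \<Rightarrow> bool" where
  "trivial_homotopy_group i Y \<longleftrightarrow> (\<forall>y\<in>topspace Y. is_singleton (homotopy_group_set i Y y))"

text \<open>
  Meaningful for nonempty \<open>Y\<close> only. The supremum, taken over integers \<open>k\<close>, is a maximum unless all
  homotopy groups are trivial, in which case it is \<open>\<infinity>\<close>; since \<open>k = -1\<close> imposes no condition,
  it is at least \<open>-1\<close>.
\<close>

definition conn :: "'b topology \<Rightarrow> ereal" where
  "conn Y = Sup {ereal (real_of_int k) | k. \<forall>i. int i \<le> k \<longrightarrow> trivial_homotopy_group i Y}"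

end

theory Submission
  imports Defs "HOL-Library.Poly_Mapping" "HOL-Library.Z2"
begin

text \<open>
  Call two points of the sphere adjacent if their distance exceeds \<open>\<delta>\<close>. The balls of radius
  \<open>pi - \<delta>\<close> around the points of a finite set meet in \<open>z\<close> iff the antipode of \<open>z\<close> is adjacent to all of them.
  So the Cech complex is the neighbourhood complex of this graph, the Borsuk graph, and its
  connectivity can be estimated from both sides by the combinatorics of the graph.

  For the lower bound, let \<open>N\<close> be the covering number for \<open>\<delta>\<close>. A set of fewer than \<open>N\<close> points does not cover
  with its balls of radius \<open>\<delta>\<close> and therefore is a simplex (\<open>small_sets_in_cech\<close>). The complex contains the
  full skeleton of dimension \<open>N - 2\<close> of the simplex on all points. A map from a sphere of dimension
  \<open>i \<le> N - 3\<close> can be deformed into the \<open>i\<close>-skeleton and then be coned off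
  (\<open>homotopy_trivial_if_full_skeleton\<close>). This gives connectivity at least \<open>N - 3\<close>, and
  \<open>N - 3 \<ge> N / 2 - 2\<close> because one closed ball of radius \<open>\<delta> < pi\<close> is not the whole sphere.

  For the upper bound, let \<open>M\<close> be the covering number for \<open>\<delta> / 2\<close>. Points in a common ball of radius
  \<open>\<delta> / 2\<close> are not adjacent, so a cover by \<open>M\<close> such balls is a proper colouring of the graph with \<open>M\<close> colours.
  By Lovasz's theorem, the neighbourhood complex of a graph with chromatic number at most \<open>M\<close> has connectivity at
  most \<open>M - 3\<close>. The proof given here is homological, with coefficients modulo two:

  \<^item> If the homotopy groups of a complex vanish up to some dimension, its simplicial cycles of these dimensions are
    boundaries. This half of Hurewicz's theorem is proved by extending the identity over missing
    simplices, subdividing barycentrically, and reading off a simplicial approximation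
    (\<open>acyclic_if_homotopy_trivial\<close>).

  \<^item> If the neighbourhood complex is acyclic up to dimension \<open>M - 2\<close>, then the box complex, consisting of pairs of completely
    joined vertex sets, is acyclic up to dimension \<open>M - 1\<close> (\<open>box_cycle_bounds\<close>). Exchange of the
    two sets is an involution of the box complex, and successive fillings yield chains
    \<open>w 0, \<dots>, w M\<close> in which \<open>w (i + 1)\<close> has as boundary \<open>w i\<close> and its mirror image: the hemispheres of an
    antipodally symmetric sphere of dimension \<open>M\<close>.

  \<^item> Counting simplices whose signs alternate in the order of the colours shows, as in Ky Fan's proof of the
    Borsuk-Ulam theorem, that \<open>w M\<close> contains a simplex with \<open>M + 1\<close> different colours
    (\<open>fan_obstruction\<close>), which is absurd.
\<close>

section \<open>Chains modulo two\<close>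

text \<open>
  Over the field with two elements a chain is a finite set of simplices, and boundaries need neither
  orientations nor signs. This class collects the possible targets of linear maps on such chains.
\<close>

class two_torsion = ab_group_add +
  assumes add_self [simp]: "x + x = 0"
begin

lemma add_self_left [simp]: "x + (x + y) = y"
  by (simp flip: add.assoc)

end

instance bit :: two_torsion
proof
  show "x + x = 0" for x :: bit by (cases x) auto
qed

instance poly_mapping :: (type, two_torsion) two_torsion
  by standard (simp add: poly_mapping_eq_iff lookup_add fun_eq_iff)

type_synonym 's chain = "'s \<Rightarrow>\<^sub>0 bit"

abbreviation keys :: "'s chain \<Rightarrow> 's set" where
  "keys \<equiv> Poly_Mapping.keys"

abbreviation lookup :: "'s chain \<Rightarrow> 's \<Rightarrow> bit" where
  "lookup \<equiv> Poly_Mapping.lookup"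

abbreviation basis :: "'s \<Rightarrow> 's chain" where
  "basis s \<equiv> Poly_Mapping.single s 1"

text \<open>
  The linear extension of \<open>f\<close>. A coefficient at a key can only be \<open>1\<close>, so no scalar
  multiplication is involved.
\<close>

definition lin :: "('s \<Rightarrow> 'b::two_torsion) \<Rightarrow> 's chain \<Rightarrow> 'b" where
  "lin f c = (\<Sum>s\<in>keys c. f s)"

lemma lin_superset:
  assumes "finite S" "keys c \<subseteq> S"
  shows "lin f c = (\<Sum>s\<in>S. if lookup c s = 1 then f s else 0)"
proof -
  have "lin f c = (\<Sum>s\<in>keys c. if lookup c s = 1 then f s else 0)"
    unfolding lin_def by (rule sum.cong) (auto simp: in_keys_iff)
  also have "\<dots> = (\<Sum>s\<in>S. if lookup c s = 1 then f s else 0)"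
    using assms by (intro sum.mono_neutral_left) (auto simp: in_keys_iff)
  finally show ?thesis .
qed

lemma lin_0 [simp]: "lin f 0 = 0"
  by (simp add: lin_def)

lemma lin_basis [simp]: "lin f (basis s) = f s"
  by (simp add: lin_def)

lemma lin_add [simp]: "lin f (c + d) = lin f c + lin f d"
proof -
  let ?S = "keys c \<union> keys d"
  have sub: "keys (c + d) \<subseteq> ?S"
    by (rule Poly_Mapping.keys_add)
  have bits: "x = 0 \<or> x = 1" for x :: bit
    by (cases x) auto
  have "lin f (c + d) = (\<Sum>s\<in>?S. (if lookup c s = 1 then f s else 0)
      + (if lookup d s = 1 then f s else 0))"
    unfolding lin_superset [OF _ sub, simplified]
  proof (rule sum.cong)
    fix s
    show "(if lookup (c + d) s = 1 then f s else 0)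
      = (if lookup c s = 1 then f s else 0) + (if lookup d s = 1 then f s else 0)"
      using bits [of "lookup c s"] bits [of "lookup d s"]
      by (auto simp: lookup_add)
  qed simp
  then show ?thesis
    by (simp add: sum.distrib lin_superset [of ?S c] lin_superset [of ?S d])
qed

lemma lin_sum: "lin f (\<Sum>i\<in>I. c i) = (\<Sum>i\<in>I. lin f (c i))"
  by (induction I rule: infinite_finite_induct) auto

lemma lin_lin: "lin f (lin g c) = lin (\<lambda>s. lin f (g s)) c"
  unfolding lin_def [of g] lin_def [of "\<lambda>s. lin f (g s)"] by (rule lin_sum)

lemma lin_cong: "(\<And>s. s \<in> keys c \<Longrightarrow> f s = g s) \<Longrightarrow> lin f c = lin g c"
  unfolding lin_def by (rule sum.cong) auto

lemma lin_plus: "lin (\<lambda>s. f s + g s) c = lin f c + lin g c"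
  by (simp add: lin_def sum.distrib)

lemma lin_zero_fun [simp]: "lin (\<lambda>s. 0) c = 0"
  by (simp add: lin_def)

lemma chain_eq_sum_basis: "(\<Sum>s\<in>keys c. basis s) = (c :: 's chain)"
proof (rule poly_mapping_eqI)
  fix t
  have "lookup (\<Sum>s\<in>keys c. basis s) t
      = (\<Sum>s\<in>keys c. if s = t then 1 else 0)"
    by (simp add: lookup_sum lookup_single when_def)
  then show "lookup (\<Sum>s\<in>keys c. basis s) t = lookup c t"
    by (simp add: in_keys_iff)
qed

lemma lin_basis_id: "lin basis c = c"
  by (simp add: lin_def chain_eq_sum_basis)

lemma keys_sum_subset: "keys (\<Sum>i\<in>I. c i) \<subseteq> (\<Union>i\<in>I. keys (c i))"
proof (induction I rule: infinite_finite_induct)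
  case (insert x F)
  then show ?case
    using Poly_Mapping.keys_add [of "c x" "\<Sum>i\<in>F. c i"] by auto
qed auto

lemma keys_lin_subset: "keys (lin f c) \<subseteq> (\<Union>s\<in>keys c. keys (f s))"
  unfolding lin_def by (rule keys_sum_subset)

lemma in_keys_linE:
  assumes "t \<in> keys (lin f c)"
  obtains s where "s \<in> keys c" "t \<in> keys (f s)"
  using assms keys_lin_subset by fastforce

lemma in_keys_sumE:
  assumes "t \<in> keys (\<Sum>i\<in>I. c i)"
  obtains i where "i \<in> I" "t \<in> keys (c i)"
  using assms keys_sum_subset by fastforce

lemma in_keys_addE:
  assumes "t \<in> keys (c + d)"
  obtains "t \<in> keys c" | "t \<in> keys d"
  using assms Poly_Mapping.keys_add by fastforce


section \<open>Simplicial chains on finite sets\<close>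

text \<open>
  The boundary is augmented: a vertex has boundary \<^term>\<open>basis {}\<close>. Hence the cycles in each
  degree, including the lowest one, are those of reduced homology.
\<close>

definition bd :: "'a set \<Rightarrow> 'a set chain" where
  "bd s = (\<Sum>v\<in>s. basis (s - {v}))"

text \<open>
  The cone over a simplex that already contains the apex degenerates to \<open>0\<close>, and so does the
  image of a simplex under a map that is not injective on it. With this convention the formulas for the
  boundary of a cone and of an image hold without any general position.
\<close>

definition cone_at :: "'a \<Rightarrow> 'a set \<Rightarrow> 'a set chain" where
  "cone_at z s = (if z \<in> s then 0 else basis (insert z s))"

definition push :: "('a \<Rightarrow> 'b) \<Rightarrow> 'a set \<Rightarrow> 'b set chain" where
  "push f s = (if inj_on f s then basis (f ` s) else 0)"

definition fin_chain :: "'a set chain \<Rightarrow> bool" where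
  "fin_chain c \<longleftrightarrow> (\<forall>s\<in>keys c. finite s)"

lemma in_keys_bdE:
  assumes "t \<in> keys (bd s)"
  obtains v where "v \<in> s" "t = s - {v}"
  using assms unfolding bd_def by (auto elim!: in_keys_sumE)

lemma bd_empty [simp]: "bd {} = 0"
  by (simp add: bd_def)

lemma bd_singleton [simp]: "bd {x} = basis {}"
  by (simp add: bd_def)

text \<open>
  If \<open>z\<close> is already a vertex of \<open>s\<close>, the only face of \<open>s\<close> with a
  nondegenerate cone is the one opposite \<open>z\<close>, and its cone is \<open>s\<close> again: both sides
  vanish.
\<close>

lemma bd_cone_basis:
  assumes "finite s"
  shows "lin bd (cone_at z s) = basis s + lin (cone_at z) (bd s)"
proof (cases "z \<in> s")
  case True
  have "lin (cone_at z) (bd s) = (\<Sum>v\<in>s. cone_at z (s - {v}))"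
    by (simp add: bd_def lin_sum)
  also have "\<dots> = (\<Sum>v\<in>s. if v = z then basis s else 0)"
    using True by (intro sum.cong) (auto simp: cone_at_def insert_absorb)
  also have "\<dots> = basis s"
    using True assms by simp
  finally show ?thesis
    using True by (simp add: cone_at_def)
next
  case False
  have "lin bd (cone_at z s) = basis (insert z s - {z}) + (\<Sum>v\<in>s. basis (insert z s - {v}))"
    using False assms by (simp add: cone_at_def bd_def)
  also have "(\<Sum>v\<in>s. basis (insert z s - {v})) = (\<Sum>v\<in>s. cone_at z (s - {v}))"
    using False by (intro sum.cong) (auto simp: cone_at_def insert_Diff_if)
  also have "\<dots> = lin (cone_at z) (bd s)"
    by (simp add: bd_def lin_sum)
  finally show ?thesis
    using False by simp
qed

lemma bd_cone:
  assumes "fin_chain c"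
  shows "lin bd (lin (cone_at z) c) = c + lin (cone_at z) (lin bd c)"
proof -
  have "lin bd (lin (cone_at z) c) = lin (\<lambda>s. basis s + lin (cone_at z) (bd s)) c"
    unfolding lin_lin using assms by (intro lin_cong) (simp add: bd_cone_basis fin_chain_def)
  then show ?thesis
    by (simp add: lin_plus lin_basis_id lin_lin)
qed

lemma fin_chain_bd_basis: "finite s \<Longrightarrow> fin_chain (bd s)"
  by (auto simp: fin_chain_def elim!: in_keys_bdE)

lemma bd_bd_basis: "finite s \<Longrightarrow> lin bd (bd s) = 0"
proof (induction rule: finite_induct)
  case (insert z s)
  have "bd (insert z s) = basis s + lin (cone_at z) (bd s)"
    using bd_cone_basis [OF insert.hyps(1), of z] insert.hyps by (simp add: cone_at_def)
  then have "lin bd (bd (insert z s)) = bd s + (bd s + lin (cone_at z) (lin bd (bd s)))"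
    using insert.hyps by (simp add: bd_cone fin_chain_bd_basis)
  then show ?case
    using insert.IH by simp
qed simp

lemma bd_bd:
  assumes "fin_chain c"
  shows "lin bd (lin bd c) = 0"
proof -
  have "lin bd (lin bd c) = lin (\<lambda>_. 0) c"
    unfolding lin_lin using assms by (intro lin_cong) (simp add: bd_bd_basis fin_chain_def)
  then show ?thesis by simp
qed

lemma bd_nonzero:
  assumes "finite s" "s \<noteq> {}"
  shows "bd s \<noteq> 0"
proof
  assume "bd s = 0"
  obtain z where "z \<in> s" using assms by blast
  moreover have "lin bd (cone_at z s) = basis s + lin (cone_at z) (bd s)"
    using assms by (simp add: bd_cone_basis)
  ultimately have "basis s = (0::'a set chain)"
    using \<open>bd s = 0\<close> by (simp add: cone_at_def)
  then show False
    by (metis Poly_Mapping.keys_single keys_zero insert_not_empty zero_neq_one)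
qed

text \<open>
  If \<open>f\<close> identifies two vertices \<open>a\<close> and \<open>b\<close>, every face that contains
  both degenerates, while the faces opposite \<open>a\<close> and opposite \<open>b\<close> have the same
  image and cancel.
\<close>

lemma bd_push_basis:
  assumes "finite s"
  shows "lin bd (push f s) = lin (push f) (bd s)"
proof (cases "inj_on f s")
  case True
  have "lin bd (push f s) = (\<Sum>v\<in>f ` s. basis (f ` s - {v}))"
    using True by (simp add: push_def bd_def)
  also have "\<dots> = (\<Sum>v\<in>s. basis (f ` s - {f v}))"
    using True by (simp add: sum.reindex)
  also have "\<dots> = (\<Sum>v\<in>s. push f (s - {v}))"
  proof (rule sum.cong)
    fix v assume v: "v \<in> s"
    have "f ` (s - {v}) = f ` s - {f v}"
      using True v by (simp add: inj_on_image_set_diff [of f s s "{v}"])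
    then show "basis (f ` s - {f v}) = push f (s - {v})"
      using True by (simp add: push_def inj_on_diff)
  qed simp
  finally show ?thesis
    by (simp add: bd_def lin_sum)
next
  case False
  then obtain a b where ab: "a \<in> s" "b \<in> s" "a \<noteq> b" "f a = f b"
    by (auto simp: inj_on_def)
  have im: "f ` (s - {a}) = f ` (s - {b})"
    using ab by (metis Diff_iff imageI image_insert insertI1 insert_Diff insert_absorb insert_iff singletonD)
  have card: "card (s - {a}) = card (s - {b})"
    using ab assms by simp
  have "inj_on f (s - {a}) \<longleftrightarrow> inj_on f (s - {b})"
    using im card assms by (metis eq_card_imp_inj_on card_image finite_Diff)
  then have eq: "push f (s - {a}) = push f (s - {b})"
    by (simp add: push_def im)
  have "lin (push f) (bd s) = (\<Sum>v\<in>s. push f (s - {v}))"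
    by (simp add: bd_def lin_sum)
  also have "\<dots> = (\<Sum>v\<in>{a,b}. push f (s - {v}))"
  proof (rule sum.mono_neutral_right)
    show "\<forall>v\<in>s - {a, b}. push f (s - {v}) = 0"
    proof
      fix v assume "v \<in> s - {a, b}"
      then have "\<not> inj_on f (s - {v})"
        using ab by (auto simp: inj_on_def)
      then show "push f (s - {v}) = 0"
        by (simp add: push_def)
    qed
  qed (use assms ab in auto)
  also have "\<dots> = 0"
    using eq ab by simp
  finally show ?thesis
    using False by (simp add: push_def)
qed

lemma bd_push:
  assumes "fin_chain c"
  shows "lin bd (lin (push f) c) = lin (push f) (lin bd c)"
  unfolding lin_lin using assms by (intro lin_cong) (simp add: bd_push_basis fin_chain_def)

lemma in_keys_pushE:
  assumes "t \<in> keys (push f s)"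
  obtains "inj_on f s" "t = f ` s"
  using assms by (auto simp: push_def split: if_splits)

lemma in_keys_coneE:
  assumes "t \<in> keys (cone_at z s)"
  obtains "z \<notin> s" "t = insert z s"
  using assms by (auto simp: cone_at_def split: if_splits)

lemma push_push:
  assumes "finite s"
  shows "lin (push g) (push f s) = push (g \<circ> f) s"
  using assms by (auto simp: push_def comp_inj_on_iff image_comp dest: inj_on_imageI2)

lemma lin_push_push:
  assumes "fin_chain c"
  shows "lin (push g) (lin (push f) c) = lin (push (g \<circ> f)) c"
  unfolding lin_lin using assms by (intro lin_cong) (simp add: push_push fin_chain_def)

lemma fin_chain_push: "fin_chain c \<Longrightarrow> fin_chain (lin (push f) c)"
  by (auto simp: fin_chain_def elim!: in_keys_linE in_keys_pushE)

lemma fin_chain_cone: "fin_chain c \<Longrightarrow> fin_chain (lin (cone_at z) c)"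
  by (auto simp: fin_chain_def elim!: in_keys_linE in_keys_coneE)

lemma fin_chain_add: "fin_chain c \<Longrightarrow> fin_chain d \<Longrightarrow> fin_chain (c + d)"
  by (auto simp: fin_chain_def elim!: in_keys_addE)

lemma fin_chain_basis [simp]: "fin_chain (basis s) \<longleftrightarrow> finite s"
  by (simp add: fin_chain_def)


section \<open>Alternating simplices\<close>

text \<open>
  A position \<open>x\<close> is counted if \<open>e\<close> holds everywhere before it and nowhere after it.
  When \<open>e\<close> holds on an initial segment only, both the last position inside the segment and the
  first one behind it are counted, so the number is even unless one of the two is missing. When
  \<open>e\<close> is not of this shape, no position is counted.
\<close>

lemma odd_switch_positions:
  fixes S :: "'a::linorder set"
  assumes "finite S" "S \<noteq> {}"
  shows "odd (card {x\<in>S. (\<forall>y\<in>S. y < x \<longrightarrow> e y) \<and> (\<forall>y\<in>S. x < y \<longrightarrow> \<not> e y)})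
    \<longleftrightarrow> (\<forall>y\<in>S. e y) \<noteq> (\<forall>y\<in>S. \<not> e y)"
  using assms
proof (induction S rule: finite_linorder_max_induct)
  case (insert b A)
  let ?P = "\<lambda>S. {x\<in>S. (\<forall>y\<in>S. y < x \<longrightarrow> e y) \<and> (\<forall>y\<in>S. x < y \<longrightarrow> \<not> e y)}"
  have bA: "b \<notin> A" "\<And>y. y \<in> A \<Longrightarrow> y < b" "\<And>y. y \<in> A \<Longrightarrow> \<not> b < y"
    using insert.hyps by (auto simp: less_imp_not_less)
  have fin: "finite (?P A)"
    using insert.hyps by simp
  have P: "?P (insert b A) = (if e b then {} else ?P A) \<union> (if \<forall>y\<in>A. e y then {b} else {})"
    using bA by (auto split: if_splits)
  have "odd (card (?P (insert b A)))
      \<longleftrightarrow> odd (card (if e b then {} else ?P A)) \<noteq> (\<forall>y\<in>A. e y)"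
  proof -
    have "(if e b then {} else ?P A) \<inter> (if \<forall>y\<in>A. e y then {b} else {}) = {}"
      using bA by auto
    then show ?thesis
      unfolding P using fin by (subst card_Un_disjoint) auto
  qed
  also have "\<dots> \<longleftrightarrow> (\<forall>y\<in>insert b A. e y) \<noteq> (\<forall>y\<in>insert b A. \<not> e y)"
  proof (cases "A = {}")
    case False
    then show ?thesis using insert.IH by auto
  qed auto
  finally show ?case .
qed simp

definition rank_in :: "('c::linorder \<times> bool) set \<Rightarrow> 'c \<Rightarrow> nat" where
  "rank_in s c = card {y \<in> s. fst y < c}"

text \<open>
  The indicator of the sets in which the signs alternate when the elements are listed by increasing first
  component, the first sign being \<open>b\<close>: the sign of an element is then determined by the parity of
  its rank.
\<close>

definition alt_from :: "bool \<Rightarrow> ('c::linorder \<times> bool) set \<Rightarrow> bit" where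
  "alt_from b s = of_bool (\<forall>x\<in>s. snd x = (even (rank_in s (fst x)) = b))"

lemma of_bool_xor: "of_bool P + of_bool Q = (of_bool (P \<noteq> Q) :: bit)"
  by auto

lemma sum_of_bool_bit: "finite S \<Longrightarrow> (\<Sum>x\<in>S. of_bool (P x)) = (of_bool (odd (card {x\<in>S. P x})) :: bit)"
proof (induction rule: finite_induct)
  case (insert x F)
  have "{y. (y = x \<or> y \<in> F) \<and> P y} = (if P x then insert x {y\<in>F. P y} else {y\<in>F. P y})"
    by auto
  then show ?case
    using insert by (auto simp: of_bool_xor)
qed simp

text \<open>
  Deleting \<open>x\<close> lowers the ranks above \<open>x\<close> by one and leaves those below unchanged.
  The face opposite \<open>x\<close> therefore alternates, starting with \<open>True\<close>, iff the signs
  agree with the parity of the rank below \<open>x\<close> and disagree with it above \<open>x\<close>, and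
  such positions were counted in the lemma \<open>odd_switch_positions\<close>.
\<close>

lemma alt_from_bd:
  fixes s :: "('c::linorder \<times> bool) set"
  assumes fin: "finite s" and inj: "inj_on fst s" and ne: "s \<noteq> {}"
  shows "lin (alt_from True) (bd s) = alt_from True s + alt_from False s"
proof -
  define sg where "sg c = snd (the_inv_into s fst c)" for c
  have sg: "sg (fst x) = snd x" if "x \<in> s" for x
    using the_inv_into_f_f [OF inj that] by (simp add: sg_def)
  let ?C = "fst ` s"
  define e where "e c \<longleftrightarrow> sg c = even (rank_in s c)" for c
  have rank: "rank_in (s - {x}) (fst y) = (if fst x < fst y then rank_in s (fst y) - 1 else rank_in s (fst y))"
    if "x \<in> s" for x y
  proof -
    have "{z \<in> s - {x}. fst z < fst y} = {z \<in> s. fst z < fst y} - {x}"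
      by auto
    then show ?thesis
      using that by (auto simp: rank_in_def)
  qed
  have pos: "rank_in s (fst y) > 0" if "x \<in> s" "fst x < fst y" for x y
  proof -
    have "x \<in> {z \<in> s. fst z < fst y}"
      using that by simp
    then have "{z \<in> s. fst z < fst y} \<noteq> {}"
      by blast
    then show ?thesis
      using fin finite_subset [of "{z \<in> s. fst z < fst y}" s] by (simp add: rank_in_def card_gt_0_iff)
  qed
  have face: "alt_from True (s - {x}) = of_bool ((\<forall>c\<in>?C. c < fst x \<longrightarrow> e c) \<and> (\<forall>c\<in>?C. fst x < c \<longrightarrow> \<not> e c))"
    if x: "x \<in> s" for x
  proof -
    have "snd y = (even (rank_in (s - {x}) (fst y)) = True)
        \<longleftrightarrow> (fst y < fst x \<longrightarrow> e (fst y)) \<and> (fst x < fst y \<longrightarrow> \<not> e (fst y))"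
      if y: "y \<in> s - {x}" for y
    proof -
      have "fst y \<noteq> fst x"
        using inj x y by (auto simp: inj_on_def)
      then consider "fst y < fst x" | "fst x < fst y" by force
      then show ?thesis
        using pos [OF x, of y] y by cases (auto simp: rank [OF x] e_def sg)
    qed
    then show ?thesis
      unfolding alt_from_def by auto
  qed
  have "lin (alt_from True) (bd s) = (\<Sum>x\<in>s. alt_from True (s - {x}))"
    by (simp add: bd_def lin_sum)
  also have "\<dots> = (\<Sum>c\<in>?C. of_bool ((\<forall>d\<in>?C. d < c \<longrightarrow> e d) \<and> (\<forall>d\<in>?C. c < d \<longrightarrow> \<not> e d)))"
    using face by (simp add: sum.reindex [OF inj])
  also have "\<dots> = of_bool ((\<forall>c\<in>?C. e c) \<noteq> (\<forall>c\<in>?C. \<not> e c))"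
    using fin ne by (subst sum_of_bool_bit) (simp_all only: finite_imageI odd_switch_positions image_is_empty not_False_eq_True)
  also have "\<dots> = of_bool (\<forall>c\<in>?C. e c) + of_bool (\<forall>c\<in>?C. \<not> e c)"
    by (simp only: of_bool_xor)
  also have "\<dots> = alt_from True s + alt_from False s"
    unfolding alt_from_def e_def by (auto simp: sg)
  finally show ?thesis .
qed

abbreviation swap_sign :: "'a \<times> bool \<Rightarrow> 'a \<times> bool" where
  "swap_sign \<equiv> map_prod (\<lambda>x. x) Not"

lemma inj_flip: "inj swap_sign"
  by (auto simp: inj_def)

lemma push_flip: "push swap_sign s = basis (swap_sign ` s)"
  by (simp add: push_def inj_on_subset [OF inj_flip])

lemma alt_from_flip: "alt_from b (swap_sign ` s) = alt_from (\<not> b) s"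
proof -
  have "rank_in (swap_sign ` s) c = rank_in s c" for c
  proof -
    have "{y \<in> swap_sign ` s. fst y < c} = swap_sign ` {y \<in> s. fst y < c}"
      by auto
    then show ?thesis
      by (simp add: rank_in_def card_image inj_on_subset [OF inj_flip])
  qed
  then show ?thesis
    by (auto simp: alt_from_def)
qed

text \<open>
  Ky Fan's parity argument, in place of the Borsuk-Ulam theorem. The chains \<open>w 0, \<dots>, w m\<close>
  are the images of one hemisphere in each dimension of an \<open>m\<close>-sphere under an antipodal map. By
  \<open>alt_from_bd\<close> the number of alternating simplices, with either first sign, has the same parity
  in \<open>w (Suc i)\<close> as in \<open>w i\<close>, and in \<open>w 0\<close> it is one.
\<close>

theorem fan_obstruction:
  fixes w :: "nat \<Rightarrow> ('c::linorder \<times> bool) set chain"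
  assumes w0: "w 0 = basis {(c, True)}"
    and bdw: "\<And>i. i < m \<Longrightarrow> lin bd (w (Suc i)) = w i + lin (push swap_sign) (w i)"
    and simplex: "\<And>i s. i \<le> m \<Longrightarrow> s \<in> keys (w i) \<Longrightarrow> finite s \<and> s \<noteq> {} \<and> inj_on fst s"
  shows "w m \<noteq> 0"
proof -
  have "lin (alt_from True) (w i) + lin (alt_from False) (w i) = 1" if "i \<le> m" for i
    using that
  proof (induction i)
    case 0
    then show ?case
      by (simp add: w0 alt_from_def rank_in_def)
  next
    case (Suc i)
    have "lin (alt_from True) (w (Suc i)) + lin (alt_from False) (w (Suc i))
        = lin (\<lambda>s. lin (alt_from True) (bd s)) (w (Suc i))"
      unfolding lin_plus [symmetric] using simplex [OF Suc.prems] by (intro lin_cong) (simp add: alt_from_bd)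
    also have "\<dots> = lin (alt_from True) (lin bd (w (Suc i)))"
      by (simp add: lin_lin)
    also have "\<dots> = lin (alt_from True) (w i) + lin (alt_from False) (w i)"
      using Suc.prems by (simp add: bdw lin_lin push_flip alt_from_flip)
    finally show ?case
      using Suc by simp
  qed
  from this [of m] show ?thesis by auto
qed


section \<open>Neighbourhood complexes and colourings\<close>

text \<open>
  Lovasz's neighbourhood complex of the graph with vertex set \<open>V\<close> and adjacency \<open>E\<close>.
\<close>

definition nbhd_complex :: "'a set \<Rightarrow> ('a \<Rightarrow> 'a \<Rightarrow> bool) \<Rightarrow> 'a set set" where
  "nbhd_complex V E = {\<sigma>. finite \<sigma> \<and> \<sigma> \<noteq> {} \<and> \<sigma> \<subseteq> V \<and> (\<exists>z\<in>V. \<forall>x\<in>\<sigma>. E z x)}"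

text \<open>
  Vanishing of the reduced homology modulo two in dimension \<open>j - 1\<close>. Indexing by cardinality
  keeps the degree a natural number: \<open>j = 0\<close> says that \<open>K\<close> has a vertex.
\<close>

definition acyclic_at :: "'a set set \<Rightarrow> nat \<Rightarrow> bool" where
  "acyclic_at K j \<longleftrightarrow>
     (\<forall>z. (\<forall>s\<in>keys z. s \<in> insert {} K \<and> card s = j) \<and> lin bd z = 0 \<longrightarrow>
        (\<exists>u. (\<forall>s\<in>keys u. s \<in> K \<and> card s = Suc j) \<and> lin bd u = z))"

text \<open>
  A set of signed vertices belongs to the box complex if its positive and its negative part span a complete
  bipartite graph. When one part is empty the other may be any finite set of vertices. In this version the box
  complex has the homology of the suspension of the neighbourhood complex, so acyclicity carries over with a
  shift of one dimension.
\<close>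

definition box_complex :: "'a set \<Rightarrow> ('a \<Rightarrow> 'a \<Rightarrow> bool) \<Rightarrow> ('a \<times> bool) set set" where
  "box_complex V E = {s. finite s \<and> fst ` s \<subseteq> V \<and> (\<forall>x y. (x, True) \<in> s \<and> (y, False) \<in> s \<longrightarrow> E x y)}"

definition pos_part :: "('a \<times> bool) set \<Rightarrow> 'a set" where
  "pos_part s = {x. (x, True) \<in> s}"

definition neg_part :: "('a \<times> bool) set \<Rightarrow> 'a set" where
  "neg_part s = {x. (x, False) \<in> s}"

definition restr :: "('s \<Rightarrow> bool) \<Rightarrow> 's chain \<Rightarrow> 's chain" where
  "restr P = lin (\<lambda>s. if P s then basis s else 0)"

lemma restr_0 [simp]: "restr P 0 = 0"
  by (simp add: restr_def)

lemma restr_add: "restr P (c + d) = restr P c + restr P d"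
  by (simp add: restr_def)

lemma in_keys_restrD:
  assumes "s \<in> keys (restr P c)"
  shows "s \<in> keys c" "P s"
  using assms unfolding restr_def by (auto elim!: in_keys_linE split: if_splits)

lemma restr_compl: "c + restr P c = restr (\<lambda>s. \<not> P s) c"
proof -
  have "c + restr P c = lin (\<lambda>s. basis s + (if P s then basis s else 0)) c"
    by (simp add: restr_def lin_plus lin_basis_id)
  also have "\<dots> = restr (\<lambda>s. \<not> P s) c"
    unfolding restr_def by (intro lin_cong) auto
  finally show ?thesis .
qed

lemma restr_lin:
  "lin f (restr P c) = lin (\<lambda>s. if P s then f s else 0) c"
  by (simp add: restr_def lin_lin if_distrib cong: if_cong)

lemma restr_of_lin: "restr P (lin f c) = lin (\<lambda>s. restr P (f s)) c"
  by (simp add: restr_def lin_lin)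

lemma restr_id: "(\<And>s. s \<in> keys c \<Longrightarrow> P s) \<Longrightarrow> restr P c = c"
  unfolding restr_def by (subst (2) lin_basis_id [symmetric], intro lin_cong) auto

lemma restr_eq_0: "(\<And>s. s \<in> keys c \<Longrightarrow> \<not> P s) \<Longrightarrow> restr P c = 0"
  unfolding restr_def lin_def by (intro sum.neutral) auto

lemma finite_neg_part: "finite s \<Longrightarrow> finite (neg_part s)"
  by (rule finite_subset [of _ "fst ` s"]) (force simp: neg_part_def)+

context
  fixes V :: "'a set" and E :: "'a \<Rightarrow> 'a \<Rightarrow> bool"
begin

definition nb :: "'a set \<Rightarrow> 'a" where
  "nb B = (SOME z. z \<in> V \<and> (\<forall>y\<in>B. E z y))"

text \<open>
  The apex is joined positively and is adjacent to all of the negative part, so the cone stays in the box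
  complex.
\<close>

definition nbcone :: "('a \<times> bool) set \<Rightarrow> ('a \<times> bool) set chain" where
  "nbcone s = cone_at (nb (neg_part s), True) s"

lemma nb:
  assumes "z \<in> V" "\<And>y. y \<in> B \<Longrightarrow> E z y"
  shows "nb B \<in> V" "\<And>y. y \<in> B \<Longrightarrow> E (nb B) y"
proof -
  have "nb B \<in> V \<and> (\<forall>y\<in>B. E (nb B) y)"
    unfolding nb_def by (rule someI [of _ z]) (use assms in auto)
  then show "nb B \<in> V" "\<And>y. y \<in> B \<Longrightarrow> E (nb B) y"
    by auto
qed

lemma nb_box:
  assumes "s \<in> box_complex V E" "pos_part s \<noteq> {}"
  shows "nb (neg_part s) \<in> V" "\<And>y. (y, False) \<in> s \<Longrightarrow> E (nb (neg_part s)) y"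
proof -
  obtain a where a: "(a, True) \<in> s"
    using assms by (auto simp: pos_part_def)
  then have "a \<in> V"
    using assms(1) by (force simp: box_complex_def)
  moreover have "E a y" if "y \<in> neg_part s" for y
    using assms(1) a that by (auto simp: box_complex_def neg_part_def)
  ultimately show "nb (neg_part s) \<in> V" "\<And>y. (y, False) \<in> s \<Longrightarrow> E (nb (neg_part s)) y"
    using nb [of a "neg_part s"] by (auto simp: neg_part_def)
qed

lemma box_complex_subset: "s \<in> box_complex V E \<Longrightarrow> t \<subseteq> s \<Longrightarrow> t \<in> box_complex V E"
  unfolding box_complex_def using finite_subset by (simp, blast)

lemma insert_nb_box:
  assumes "s \<in> box_complex V E" "pos_part s \<noteq> {}" "t \<subseteq> s"
  shows "insert (nb (neg_part s), True) t \<in> box_complex V E"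
  using nb_box [OF assms(1,2)] box_complex_subset [OF assms(1,3)] assms(3)
  unfolding box_complex_def by auto

text \<open>
  The positive parts that go with a fixed negative part \<open>B\<close> are the finite sets of common
  neighbours of \<open>B\<close>, which form a full simplex. In a cycle, the terms whose negative part has the
  maximal size are cycles in these simplices. Subtracting the boundary of their cones, with a common neighbour
  of \<open>B\<close> as apex, leaves terms with smaller negative parts only, and induction on this size
  applies.
\<close>

lemma box_cycle_bounds_pos:
  assumes "\<And>s. s \<in> keys w \<Longrightarrow>
      s \<in> box_complex V E \<and> card s = Suc j \<and> pos_part s \<noteq> {} \<and> card (neg_part s) < q"
    and "lin bd w = 0"
  shows "\<exists>u. (\<forall>s\<in>keys u. s \<in> box_complex V E \<and> card s = Suc (Suc j)) \<and> lin bd u = w"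
  using assms
proof (induction q arbitrary: w)
  case 0
  then have "s \<notin> keys w" for s
    by blast
  then have "w = 0"
    by (metis ex_in_conv keys_eq_empty)
  then show ?case
    by (intro exI [of _ 0]) simp
next
  case (Suc q)
  note key = Suc.prems(1)
  define bdp where "bdp s = (\<Sum>v\<in>{v\<in>s. snd v}. basis (s - {v}))" for s :: "('a \<times> bool) set"
  define bdm where "bdm s = (\<Sum>v\<in>{v\<in>s. \<not> snd v}. basis (s - {v}))" for s :: "('a \<times> bool) set"
  define wq where "wq = restr (\<lambda>s. card (neg_part s) = q) w"
  define u where "u = lin nbcone wq"
  define R where "R = lin (\<lambda>s. lin (cone_at (nb (neg_part s), True)) (bdm s)) wq"
  have fin: "finite s" if "s \<in> keys w" for s
    using key [OF that] by (simp add: box_complex_def)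
  have wqD: "s \<in> keys w" "card (neg_part s) = q" if "s \<in> keys wq" for s
    using in_keys_restrD [of s _ w] that by (auto simp: wq_def)
  have split: "bd s = bdp s + bdm s" if "finite s" for s
  proof -
    have "bd s = (\<Sum>v\<in>{v\<in>s. snd v} \<union> {v\<in>s. \<not> snd v}. basis (s - {v}))"
      unfolding bd_def by (rule sum.cong) auto
    also have "\<dots> = bdp s + bdm s"
      unfolding bdp_def bdm_def by (rule sum.union_disjoint) (use that in auto)
    finally show ?thesis .
  qed
  have bdpE: "\<exists>x. (x, True) \<in> s \<and> t = s - {(x, True)} \<and> neg_part t = neg_part s"
    if "t \<in> keys (bdp s)" for s t
    using that unfolding bdp_def by (fastforce elim!: in_keys_sumE simp: neg_part_def)
  have bdmE: "\<exists>y. (y, False) \<in> s \<and> t = s - {(y, False)} \<and> neg_part t = neg_part s - {y}"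
    if "t \<in> keys (bdm s)" for s t
    using that unfolding bdm_def by (fastforce elim!: in_keys_sumE simp: neg_part_def)
  have bdm_card: "card (neg_part t) < card (neg_part s)" if t: "t \<in> keys (bdm s)" and s: "finite s" for s t
  proof -
    obtain y where y: "(y, False) \<in> s" "neg_part t = neg_part s - {y}"
      using bdmE [OF t] by blast
    then have "y \<in> neg_part s" by (simp add: neg_part_def)
    then show ?thesis
      using y finite_neg_part [OF s] by (simp add: card_Diff1_less del: card_Diff_insert)
  qed
  \<comment> \<open>Faces lacking a negative vertex have a smaller negative part and do not interfere
    here.\<close>
  have "lin bdp wq = restr (\<lambda>s. card (neg_part s) = q) (lin bd w)"
  proof -
    have "(if card (neg_part s) = q then bdp s else 0) = restr (\<lambda>s. card (neg_part s) = q) (bd s)"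
      if s: "s \<in> keys w" for s
    proof -
      have "restr (\<lambda>s. card (neg_part s) = q) (bdm s) = 0"
        using bdm_card [OF _ fin [OF s]] key [OF s] by (intro restr_eq_0) fastforce
      moreover have "restr (\<lambda>s. card (neg_part s) = q) (bdp s) = (if card (neg_part s) = q then bdp s else 0)"
        using bdpE [of _ s] by (auto intro!: restr_id restr_eq_0) (metis)+
      ultimately show ?thesis
        by (simp add: split [OF fin [OF s]] restr_add)
    qed
    then show ?thesis
      unfolding wq_def restr_lin restr_of_lin by (intro lin_cong)
  qed
  then have bdp0: "lin bdp wq = 0"
    by (simp add: Suc.prems(2))
  have bdu: "lin bd u = wq + R"
  proof -
    have "lin bd (nbcone s) = basis s + (lin nbcone (bdp s) + lin (cone_at (nb (neg_part s), True)) (bdm s))"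
      if s: "s \<in> keys wq" for s
    proof -
      have "lin (cone_at (nb (neg_part s), True)) (bdp s) = lin nbcone (bdp s)"
        using bdpE [of _ s] unfolding nbcone_def by (intro lin_cong) metis
      then show ?thesis
        using fin [OF wqD(1) [OF s]] unfolding nbcone_def by (simp add: bd_cone_basis split)
    qed
    then have "lin bd u = lin (\<lambda>s. basis s + (lin nbcone (bdp s) + lin (cone_at (nb (neg_part s), True)) (bdm s))) wq"
      unfolding u_def lin_lin by (intro lin_cong)
    also have "\<dots> = wq + (lin nbcone (lin bdp wq) + R)"
      by (simp add: lin_plus lin_basis_id R_def lin_lin)
    finally show ?thesis
      by (simp add: bdp0)
  qed
  have ukeys: "s \<in> box_complex V E \<and> card s = Suc (Suc j)" if s: "s \<in> keys u" for s
  proof -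
    obtain t where t: "t \<in> keys wq" "s \<in> keys (nbcone t)"
      using s unfolding u_def by (rule in_keys_linE)
    then have "(nb (neg_part t), True) \<notin> t" "s = insert (nb (neg_part t), True) t"
      by (auto simp: nbcone_def elim!: in_keys_coneE)
    then show ?thesis
      using key [OF wqD(1) [OF t(1)]] insert_nb_box [of t t] fin [OF wqD(1) [OF t(1)]] by auto
  qed
  have Rkeys: "s \<in> box_complex V E \<and> card s = Suc j \<and> pos_part s \<noteq> {} \<and> card (neg_part s) < q"
    if s: "s \<in> keys R" for s
  proof -
    obtain t where t: "t \<in> keys wq"
      and s: "s \<in> keys (lin (cone_at (nb (neg_part t), True)) (bdm t))"
      using s unfolding R_def by (rule in_keys_linE)
    obtain t' where t': "t' \<in> keys (bdm t)"
      and "s \<in> keys (cone_at (nb (neg_part t), True) t')"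
      using s by (rule in_keys_linE)
    then have s: "(nb (neg_part t), True) \<notin> t'" "s = insert (nb (neg_part t), True) t'"
      by (auto elim!: in_keys_coneE)
    obtain y where y: "(y, False) \<in> t" "t' = t - {(y, False)}"
      using bdmE [OF t'] by blast
    note tk = key [OF wqD(1) [OF t]] and tf = fin [OF wqD(1) [OF t]]
    have "card t' = j"
      using y tk tf by simp
    then have "card s = Suc j"
      using s y tf by simp
    moreover have "neg_part s = neg_part t'"
      using s by (auto simp: neg_part_def)
    then have "card (neg_part s) < q"
      using bdm_card [OF t' tf] wqD(2) [OF t] by simp
    moreover have "s \<in> box_complex V E"
      using insert_nb_box [of t t'] tk s y by auto
    ultimately show ?thesis
      using s by (auto simp: pos_part_def)
  qed
  define w' where "w' = w + lin bd u"
  have w': "w' = restr (\<lambda>s. card (neg_part s) \<noteq> q) w + R"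
    unfolding w'_def bdu using restr_compl [of w "\<lambda>s. card (neg_part s) = q"]
    by (simp add: wq_def flip: add.assoc)
  have "s \<in> box_complex V E \<and> card s = Suc j \<and> pos_part s \<noteq> {} \<and> card (neg_part s) < q"
    if "s \<in> keys w'" for s
    using that unfolding w'
  proof (rule in_keys_addE)
    assume "s \<in> keys (restr (\<lambda>s. card (neg_part s) \<noteq> q) w)"
    then show ?thesis
      using in_keys_restrD [of s _ w] key [of s] by force
  qed (rule Rkeys)
  moreover have "lin bd w' = 0"
  proof -
    have "fin_chain u"
      using ukeys by (auto simp: fin_chain_def box_complex_def)
    then show ?thesis
      unfolding w'_def using Suc.prems(2) by (simp add: bd_bd)
  qed
  ultimately obtain u' where u': "\<And>s. s \<in> keys u' \<Longrightarrow> s \<in> box_complex V E \<and> card s = Suc (Suc j)"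
    "lin bd u' = w'"
    using Suc.IH [of w'] by blast
  have "lin bd (u' + u) = w"
    using u'(2) by (simp add: w'_def add.assoc)
  moreover have "\<forall>s\<in>keys (u' + u). s \<in> box_complex V E \<and> card s = Suc (Suc j)"
    using u'(1) ukeys by (auto elim!: in_keys_addE)
  ultimately show ?case by blast
qed

text \<open>
  It remains to remove the terms without positive part. Their boundary has to cancel against terms with a
  single positive vertex, which is a common neighbour of the other vertices. So it is a cycle of the
  neighbourhood complex and bounds a chain \<open>k\<close> there by assumption. The purely negative terms
  together with \<open>k\<close> are the boundary of a cone in the full simplex on \<open>V\<close>. Joining a
  common neighbour to each simplex of \<open>k\<close> then trades \<open>k\<close> for terms with a positive
  part.
\<close>

lemma box_cycle_bounds:
  assumes acyc: "acyclic_at (nbhd_complex V E) j"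
    and key: "\<And>s. s \<in> keys w \<Longrightarrow> s \<in> box_complex V E \<and> card s = Suc j"
    and cyc: "lin bd w = 0"
  shows "\<exists>u. (\<forall>s\<in>keys u. s \<in> box_complex V E \<and> card s = Suc (Suc j)) \<and> lin bd u = w"
proof -
  let ?neg = "\<lambda>y::'a. (y, False)"
  define v where "v = restr (\<lambda>s. pos_part s = {}) w"
  define v' where "v' = lin (push fst) v"
  have vD: "s \<in> box_complex V E" "card s = Suc j" "pos_part s = {}" "s = ?neg ` fst ` s" "finite s" "inj_on fst s"
    if "s \<in> keys v" for s
  proof -
    show 1: "s \<in> box_complex V E" "card s = Suc j" "pos_part s = {}"
      using in_keys_restrD [of s _ w] that key by (auto simp: v_def)
    have "snd x = False" if "x \<in> s" for x
      using 1(3) that by (cases x; cases "snd x") (auto simp: pos_part_def)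
    then have *: "x = (fst x, False)" if "x \<in> s" for x
      using that by (simp add: prod_eq_iff)
    then show "s = ?neg ` fst ` s"
      by (force simp: image_iff)
    show "finite s" using 1 by (simp add: box_complex_def)
    show "inj_on fst s"
      using * by (metis inj_onI)
  qed
  have finv: "fin_chain v"
    using vD by (auto simp: fin_chain_def)
  have v_back: "lin (push ?neg) v' = v"
  proof -
    have "lin (push ?neg) v' = lin (push (?neg \<circ> fst)) v"
      unfolding v'_def by (rule lin_push_push [OF finv])
    also have "\<dots> = lin basis v"
    proof (rule lin_cong)
      fix s assume s: "s \<in> keys v"
      have "inj_on (?neg \<circ> fst) s"
        using vD(6) [OF s] by (intro comp_inj_on) (auto simp: inj_on_def)
      then show "push (?neg \<circ> fst) s = basis s"
        using vD(4) [OF s] by (simp add: push_def image_comp)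
    qed
    finally show ?thesis by (simp add: lin_basis_id)
  qed
  have v'D: "t \<subseteq> V" "finite t" "card t = Suc j" if "t \<in> keys v'" for t
  proof -
    obtain s where "s \<in> keys v" "inj_on fst s" "t = fst ` s"
      using \<open>t \<in> _\<close> unfolding v'_def by (auto elim!: in_keys_linE in_keys_pushE)
    then show "t \<subseteq> V" "finite t" "card t = Suc j"
      using vD [of s] by (auto simp: box_complex_def card_image)
  qed
  have finv': "fin_chain v'"
    using v'D by (simp add: fin_chain_def)
  have "t \<in> insert {} (nbhd_complex V E) \<and> card t = j" if "t \<in> keys (lin bd v')" for t
  proof -
    have "lin bd v' = lin (push fst) (lin bd v)"
      unfolding v'_def using finv by (rule bd_push)
    then have "t \<in> keys (lin (push fst) (lin bd v))"
      using \<open>t \<in> _\<close> by simp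
    then obtain t' where t': "t' \<in> keys (lin bd v)" "t \<in> keys (push fst t')"
      by (rule in_keys_linE)
    from t'(2) have "t = fst ` t'"
      by (rule in_keys_pushE)
    note t' = t'(1) this
    then obtain s p where s: "s \<in> keys v" "p \<in> s" "t' = s - {p}"
      by (auto elim!: in_keys_linE in_keys_bdE)
    \<comment> \<open>The face \<open>t'\<close> also belongs to a simplex \<open>s'\<close> with positive
      part, since \<open>w\<close> is a cycle.\<close>
    have "lin bd (w + v) = lin bd v"
      using cyc by simp
    then have "t' \<in> keys (lin bd (restr (\<lambda>s. pos_part s \<noteq> {}) w))"
      using t' restr_compl [of w "\<lambda>s. pos_part s = {}"] by (simp add: v_def)
    then obtain s' p' where s': "s' \<in> keys (restr (\<lambda>s. pos_part s \<noteq> {}) w)" "p' \<in> s'" "t' = s' - {p'}"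
      by (auto elim!: in_keys_linE in_keys_bdE)
    then have s'box: "s' \<in> box_complex V E" "pos_part s' \<noteq> {}" "card s' = Suc j"
      using in_keys_restrD [of s' _ w] key by blast+
    have "pos_part t' = {}"
      using vD(3) [OF s(1)] s(3) by (auto simp: pos_part_def)
    then obtain a where a: "(a, True) \<in> s'"
      using s'box by (auto simp: pos_part_def)
    have "p' = (a, True)"
      using a s'(3) \<open>pos_part t' = {}\<close> by (auto simp: pos_part_def)
    have neg: "t = {y. (y, False) \<in> t'}"
    proof -
      have "t' \<subseteq> s" using s by auto
      then have img: "t' \<subseteq> ?neg ` fst ` s"
        using vD(4) [OF s(1)] by simp
      have "x = (fst x, False)" if "x \<in> t'" for x
        using subsetD [OF img that] by auto
      then show ?thesis
        unfolding t'(2) by (force simp: image_iff)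
    qed
    have "t' \<subseteq> s'"
      using s'(3) by blast
    have s'D: "finite s'" "fst ` s' \<subseteq> V" "\<And>y. (y, False) \<in> s' \<Longrightarrow> E a y"
      using s'box(1) a by (auto simp: box_complex_def)
    have "t \<subseteq> V" "finite t"
      unfolding t'(2) using \<open>t' \<subseteq> s'\<close> s'D(1,2) finite_subset by blast+
    have "a \<in> V"
      using s'D(2) a by (metis fst_conv image_subset_iff)
    have Ea: "E a y" if "y \<in> t" for y
      using that \<open>t' \<subseteq> s'\<close> s'D(3) unfolding neg by blast
    have "t \<in> insert {} (nbhd_complex V E)"
      using \<open>t \<subseteq> V\<close> \<open>finite t\<close> \<open>a \<in> V\<close> Ea by (auto simp: nbhd_complex_def)
    moreover have "card t = j"
    proof -
      have "inj_on fst t'"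
        using vD(6) [OF s(1)] s(3) by (simp add: inj_on_diff)
      then show ?thesis
        using vD(2,5) [OF s(1)] s t'(2) by (simp add: card_image)
    qed
    ultimately show ?thesis by simp
  qed
  moreover have "lin bd (lin bd v') = 0"
    using finv' by (rule bd_bd)
  ultimately obtain k where k: "\<And>s. s \<in> keys k \<Longrightarrow> s \<in> nbhd_complex V E \<and> card s = Suc j"
    "lin bd k = lin bd v'"
    using acyc unfolding acyclic_at_def by meson
  have kD: "s \<subseteq> V" "finite s" "nb s \<in> V" "\<And>y. y \<in> s \<Longrightarrow> E (nb s) y" "card s = Suc j" if "s \<in> keys k" for s
    using k(1) [OF that] nb [of _ s] unfolding nbhd_complex_def by blast+
  have fink: "fin_chain k"
    using kD by (simp add: fin_chain_def)
  \<comment> \<open>Without vertices all chains in question vanish; otherwise any vertex serves as an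
    apex.\<close>
  obtain T where T: "lin bd T = v' + k" "\<And>s. s \<in> keys T \<Longrightarrow> s \<subseteq> V \<and> finite s \<and> card s = Suc (Suc j)"
  proof (cases "V = {}")
    case True
    then have "keys (v' + k) = {}"
      using v'D(1,3) kD(1,5) by (fastforce elim!: in_keys_addE)
    then have "v' + k = 0" by simp
    then show ?thesis
      using that [of 0] by simp
  next
    case False
    then obtain x0 where x0: "x0 \<in> V" by blast
    show ?thesis
    proof
      show "lin bd (lin (cone_at x0) (v' + k)) = v' + k"
        using fin_chain_add [OF finv' fink] by (subst bd_cone) (simp_all add: k(2))
      show "s \<subseteq> V \<and> finite s \<and> card s = Suc (Suc j)"
        if s: "s \<in> keys (lin (cone_at x0) (v' + k))" for s
      proof -
        obtain t where "t \<in> keys (v' + k)" "x0 \<notin> t" "s = insert x0 t"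
          using s by (elim in_keys_linE in_keys_coneE) blast
        moreover have "t \<subseteq> V \<and> finite t \<and> card t = Suc j"
          using \<open>t \<in> _\<close>
        proof (rule in_keys_addE)
          assume "t \<in> keys v'"
          then show ?thesis by (simp add: v'D)
        next
          assume "t \<in> keys k"
          then show ?thesis by (simp add: kD)
        qed
        ultimately show ?thesis
          using x0 by simp
      qed
    qed
  qed
  have finT: "fin_chain T"
    using T by (simp add: fin_chain_def)
  define f where "f s = insert (nb s, True) (?neg ` s)" for s
  define Tm where "Tm = lin (push ?neg) T"
  define u1 where "u1 = lin (\<lambda>s. basis (f s)) k"
  have neg_inj: "inj_on ?neg s" for s
    by (simp add: inj_on_def)
  have f_eq: "basis (f s) = lin (cone_at (nb s, True)) (push ?neg s)" for s
    using neg_inj by (auto simp: f_def cone_at_def push_def)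
  have Tmkeys: "s \<in> box_complex V E \<and> card s = Suc (Suc j)" if s: "s \<in> keys Tm" for s
  proof -
    obtain t where t: "t \<in> keys T" "s = ?neg ` t"
      using s unfolding Tm_def by (auto elim!: in_keys_linE in_keys_pushE)
    then show ?thesis
      using T(2) [OF t(1)] neg_inj [of t] by (auto simp: box_complex_def card_image)
  qed
  have fbox: "f s \<in> box_complex V E" "card (f s) = Suc (Suc j)" if "s \<in> keys k" for s
    using kD [OF that] neg_inj [of s] by (auto simp: f_def box_complex_def card_image card_insert_if)
  have u1keys: "s \<in> box_complex V E \<and> card s = Suc (Suc j)" if "s \<in> keys u1" for s
    using that fbox unfolding u1_def by (auto elim!: in_keys_linE)
  define S where "S = lin (\<lambda>s. lin (cone_at (nb s, True)) (bd (?neg ` s))) k"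
  have bdu1: "lin bd u1 = lin (push ?neg) k + S"
  proof -
    have "lin bd u1 = lin (\<lambda>s. push ?neg s + lin (cone_at (nb s, True)) (bd (?neg ` s))) k"
      unfolding u1_def lin_lin
    proof (rule lin_cong)
      fix s assume s: "s \<in> keys k"
      show "lin bd (basis (f s)) = push ?neg s + lin (cone_at (nb s, True)) (bd (?neg ` s))"
        unfolding f_eq using kD(2) [OF s] neg_inj [of s] by (simp add: push_def bd_cone_basis)
    qed
    then show ?thesis
      by (simp add: lin_plus S_def)
  qed
  have Skeys: "pos_part s \<noteq> {} \<and> s \<in> box_complex V E \<and> card s = Suc j" if s: "s \<in> keys S" for s
  proof -
    obtain t where t: "t \<in> keys k"
      and s: "s \<in> keys (lin (cone_at (nb t, True)) (bd (?neg ` t)))"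
      using s unfolding S_def by (rule in_keys_linE)
    obtain p where p: "p \<in> ?neg ` t" "s = insert (nb t, True) (?neg ` t - {p})"
      using s by (auto elim!: in_keys_linE in_keys_coneE in_keys_bdE)
    have "card (?neg ` t - {p}) = j"
      using p kD(2,5) [OF t] neg_inj [of t] by (simp add: card_image)
    then have "card s = Suc j"
      using p kD(2) [OF t] by (auto simp: card_insert_if)
    moreover have "s \<in> box_complex V E"
      by (rule box_complex_subset [OF fbox(1) [OF t]]) (use p in \<open>auto simp: f_def\<close>)
    ultimately show ?thesis
      using p by (auto simp: pos_part_def)
  qed
  define w' where "w' = w + lin bd (Tm + u1)"
  have "lin bd Tm = v + lin (push ?neg) k"
    unfolding Tm_def bd_push [OF finT] T(1) by (simp add: v_back)
  then have w': "w' = restr (\<lambda>s. pos_part s \<noteq> {}) w + S"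
    using restr_compl [of w "\<lambda>s. pos_part s = {}"] by (simp add: w'_def bdu1 v_def add.assoc flip: add.assoc [of w])
  have w'keys: "s \<in> box_complex V E \<and> card s = Suc j \<and> pos_part s \<noteq> {} \<and> card (neg_part s) < Suc (Suc j)"
    if "s \<in> keys w'" for s
  proof -
    have 1: "pos_part s \<noteq> {} \<and> s \<in> box_complex V E \<and> card s = Suc j"
      using that unfolding w'
    proof (rule in_keys_addE)
      assume "s \<in> keys (restr (\<lambda>s. pos_part s \<noteq> {}) w)"
      then show ?thesis
        using in_keys_restrD [of s _ w] key [of s] by blast
    qed (rule Skeys)
    have "neg_part s = fst ` {x\<in>s. \<not> snd x}"
      by (force simp: neg_part_def)
    then have "card (neg_part s) \<le> card s"
      using 1 by (metis (no_types, lifting) box_complex_def card_image_le card_mono finite_subset le_trans mem_Collect_eq subsetI)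
    then show ?thesis using 1 by simp
  qed
  have "fin_chain (Tm + u1)"
    using Tmkeys u1keys by (auto simp: fin_chain_def box_complex_def elim!: in_keys_addE)
  then have "lin bd w' = 0"
    using bd_bd [of "Tm + u1"] cyc by (simp add: w'_def)
  then obtain u' where u': "\<And>s. s \<in> keys u' \<Longrightarrow> s \<in> box_complex V E \<and> card s = Suc (Suc j)"
    "lin bd u' = w'"
    using box_cycle_bounds_pos [OF w'keys] by blast
  have "lin bd (u' + (Tm + u1)) = w"
    unfolding lin_add [of bd u'] u'(2) by (simp add: w'_def add.assoc)
  moreover have "\<forall>s\<in>keys (u' + (Tm + u1)). s \<in> box_complex V E \<and> card s = Suc (Suc j)"
    using u'(1) Tmkeys u1keys by (auto elim!: in_keys_addE)
  ultimately show ?thesis by blast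
qed

end

text \<open>
  Lovasz's lower bound for the chromatic number, in homological form. If the neighbourhood complex were
  acyclic in all these degrees, the sum of \<open>w i\<close> and its mirror image in the box complex could be
  filled by a chain \<open>w (Suc i)\<close>, up to \<open>w m\<close>. In a proper colouring, signed vertices
  of equal colour in one simplex have equal sign. The chains of signed colours thus satisfy the hypotheses of
  \<open>fan_obstruction\<close>, while an element of \<open>w m\<close> would need \<open>m + 1\<close>
  colours.
\<close>

theorem colouring_obstructs_acyclicity:
  fixes c :: "'a \<Rightarrow> nat"
  assumes sym: "\<And>x y. E x y \<Longrightarrow> E y x" and x0: "x0 \<in> V"
    and colour: "\<And>x. x \<in> V \<Longrightarrow> c x < m"
    and proper: "\<And>x y. x \<in> V \<Longrightarrow> y \<in> V \<Longrightarrow> E x y \<Longrightarrow> c x \<noteq> c y"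
  shows "\<exists>j<m. \<not> acyclic_at (nbhd_complex V E) j"
proof (rule ccontr)
  assume "\<not> ?thesis"
  then have acyc: "acyclic_at (nbhd_complex V E) j" if "j < m" for j
    using that by blast
  let ?B = "box_complex V E"
  define w where "w = rec_nat (basis {(x0, True)})
    (\<lambda>i wi. SOME u. (\<forall>s\<in>keys u. s \<in> ?B \<and> card s = Suc (Suc i)) \<and> lin bd u = wi + lin (push swap_sign) wi)"
  have w0: "w 0 = basis {(x0, True)}"
    by (simp add: w_def)
  have flip_keys: "s \<in> ?B \<and> card s = k"
    if u: "\<And>s. s \<in> keys u \<Longrightarrow> s \<in> ?B \<and> card s = k"
      and s: "s \<in> keys (lin (push swap_sign) u)" for u s k
  proof -
    obtain t where t: "t \<in> keys u" "s = swap_sign ` t"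
      using s by (auto elim!: in_keys_linE in_keys_pushE)
    have "fst ` s = fst ` t"
      unfolding t(2) by force
    moreover have "(x, b) \<in> s \<longleftrightarrow> (x, \<not> b) \<in> t" for x b
      unfolding t(2) by force
    ultimately show ?thesis
      using u [OF t(1)] sym t(2) by (auto simp: box_complex_def card_image inj_on_subset [OF inj_flip])
  qed
  have flip_flip: "lin (push swap_sign) (lin (push swap_sign) u) = u" if "fin_chain u" for u :: "('a \<times> bool) set chain"
  proof -
    have ff: "swap_sign \<circ> swap_sign = (id :: 'a \<times> bool \<Rightarrow> _)"
      by (simp add: fun_eq_iff)
    have "push (swap_sign \<circ> swap_sign) = (basis :: ('a \<times> bool) set \<Rightarrow> _)"
      by (rule ext) (simp add: push_def del: image_comp comp_apply fun.map_comp, simp add: ff)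
    then show ?thesis
      by (simp add: lin_push_push [OF that] lin_basis_id)
  qed
  have inv: "(\<forall>s\<in>keys (w i). s \<in> ?B \<and> card s = Suc i) \<and> lin bd (w i + lin (push swap_sign) (w i)) = 0
      \<and> (\<forall>k. i = Suc k \<longrightarrow> lin bd (w i) = w k + lin (push swap_sign) (w k))"
    if "i \<le> m" for i
    using that
  proof (induction i)
    case 0
    then show ?case
      using x0 by (simp add: w0 box_complex_def push_def)
  next
    case (Suc i)
    let ?y = "w i + lin (push swap_sign) (w i)"
    have IH: "\<And>s. s \<in> keys (w i) \<Longrightarrow> s \<in> ?B \<and> card s = Suc i" "lin bd ?y = 0"
      using Suc by auto
    have fin: "fin_chain (w i)"
      using IH(1) by (auto simp: fin_chain_def box_complex_def)
    have "\<And>s. s \<in> keys ?y \<Longrightarrow> s \<in> ?B \<and> card s = Suc i"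
      using IH(1) flip_keys [OF IH(1)] by (auto elim!: in_keys_addE)
    then have ex: "\<exists>u. (\<forall>s\<in>keys u. s \<in> ?B \<and> card s = Suc (Suc i)) \<and> lin bd u = ?y"
      using Suc.prems by (intro box_cycle_bounds acyc IH(2)) auto
    have eq: "w (Suc i) = (SOME u. (\<forall>s\<in>keys u. s \<in> ?B \<and> card s = Suc (Suc i)) \<and> lin bd u = ?y)"
      unfolding w_def by (simp only: nat.rec)
    have "(\<forall>s\<in>keys (w (Suc i)). s \<in> ?B \<and> card s = Suc (Suc i)) \<and> lin bd (w (Suc i)) = ?y"
      unfolding eq by (rule someI_ex [OF ex])
    then have wS: "\<forall>s\<in>keys (w (Suc i)). s \<in> ?B \<and> card s = Suc (Suc i)" "lin bd (w (Suc i)) = ?y"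
      by blast+
    have "fin_chain (w (Suc i))"
      using wS by (auto simp: fin_chain_def box_complex_def)
    then have "lin bd (w (Suc i) + lin (push swap_sign) (w (Suc i))) = ?y + lin (push swap_sign) ?y"
      by (simp add: wS bd_push)
    also have "\<dots> = 0"
      by (simp add: flip_flip [OF fin] ac_simps)
    finally show ?case
      using wS by auto
  qed
  have fin: "fin_chain (w i)" if "i \<le> m" for i
    using inv [OF that] by (auto simp: fin_chain_def box_complex_def)
  let ?f = "map_prod c (\<lambda>b. b) :: 'a \<times> bool \<Rightarrow> nat \<times> bool"
  define w' where "w' i = lin (push ?f) (w i)" for i
  have w'D: "finite t \<and> card t = Suc i \<and> inj_on fst t \<and> fst ` t \<subseteq> {..<m}"
    if im: "i \<le> m" and t: "t \<in> keys (w' i)" for i t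
  proof -
    obtain s where s: "s \<in> keys (w i)" "inj_on ?f s" "t = ?f ` s"
      using t unfolding w'_def by (auto elim!: in_keys_linE in_keys_pushE)
    then have sB: "s \<in> ?B" "card s = Suc i"
      using inv [OF im] by auto
    then have sV: "\<And>x. x \<in> s \<Longrightarrow> fst x \<in> V"
      by (auto simp: box_complex_def)
    have "inj_on fst t"
    proof (rule inj_onI)
      fix p q assume pq: "p \<in> t" "q \<in> t" "fst p = fst q"
      then obtain x a y b where xy: "(x, a) \<in> s" "(y, b) \<in> s" "p = (c x, a)" "q = (c y, b)"
        using s(3) by auto
      have "a = b"
      proof (rule ccontr)
        assume "a \<noteq> b"
        then have "E x y"
          using sB(1) xy sym unfolding box_complex_def by (cases a; cases b) auto
        then show False
          using proper [of x y] sV xy pq(3) by force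
      qed
      then show "p = q"
        using xy pq by simp
    qed
    moreover have "fst ` t \<subseteq> {..<m}"
      using sV colour s(3) by force
    ultimately show ?thesis
      using s sB by (auto simp: box_complex_def card_image)
  qed
  have "w' m \<noteq> 0"
  proof (rule fan_obstruction)
    show "w' 0 = basis {(c x0, True)}"
      by (simp add: w'_def w0 push_def)
    fix i assume "i < m"
    then have "lin bd (w' (Suc i)) = lin (push ?f) (w i) + lin (push ?f) (lin (push swap_sign) (w i))"
      using inv [of "Suc i"] fin [of "Suc i"] by (simp add: w'_def bd_push)
    moreover have "?f \<circ> swap_sign = swap_sign \<circ> ?f"
      by (auto simp: fun_eq_iff)
    ultimately show "lin bd (w' (Suc i)) = w' i + lin (push swap_sign) (w' i)"
      using \<open>i < m\<close> by (simp add: w'_def lin_push_push fin)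
  next
    fix i s assume "i \<le> m" "s \<in> keys (w' i)"
    then show "finite s \<and> s \<noteq> {} \<and> inj_on fst s"
      using w'D by fastforce
  qed
  then obtain t where t: "t \<in> keys (w' m)"
    by (metis ex_in_conv keys_eq_empty)
  have "card (fst ` t) \<le> m"
    using w'D [OF le_refl t] card_mono [of "{..<m}" "fst ` t"] by simp
  then show False
    using w'D [OF le_refl t] by (simp add: card_image)
qed


section \<open>Barycentric subdivision\<close>

definition bary :: "('a \<Rightarrow> real) set \<Rightarrow> 'a \<Rightarrow> real" where
  "bary s = (\<lambda>v. (\<Sum>p\<in>s. p v) / real (card s))"

text \<open>
  The subdivision of a simplex is the cone, with its barycentre as apex, over the subdivision of its boundary.
  The simplices are arbitrary finite sets of points, affinely independent or not.
\<close>

function sd :: "('a \<Rightarrow> real) set \<Rightarrow> ('a \<Rightarrow> real) set chain" where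
  "sd s = (if finite s \<and> s \<noteq> {} then lin (cone_at (bary s)) (\<Sum>p\<in>s. sd (s - {p})) else basis {})"
  by auto
termination
  by (relation "Wellfounded.measure card") (auto simp: card_gt_0_iff)

declare sd.simps [simp del]

lemma sd_empty [simp]: "sd {} = basis {}"
  by (simp add: sd.simps)

lemma sd_rec: "finite s \<Longrightarrow> s \<noteq> {} \<Longrightarrow> sd s = lin (cone_at (bary s)) (lin sd (bd s))"
  by (subst sd.simps) (simp add: bd_def lin_sum)

lemma in_keys_sdE:
  assumes "finite s" "s \<noteq> {}" "t \<in> keys (sd s)"
  obtains p u where "p \<in> s" "u \<in> keys (sd (s - {p}))" "bary s \<notin> u" "t = insert (bary s) u"
proof -
  from assms(3) obtain u where u: "u \<in> keys (lin sd (bd s))" "t \<in> keys (cone_at (bary s) u)"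
    unfolding sd_rec [OF assms(1,2)] by (rule in_keys_linE)
  obtain r where r: "r \<in> keys (bd s)" "u \<in> keys (sd r)"
    using u(1) by (rule in_keys_linE)
  obtain p where "p \<in> s" "r = s - {p}"
    using r(1) by (rule in_keys_bdE)
  then show ?thesis
    using that r(2) u(2) by (auto elim!: in_keys_coneE)
qed

lemma sd_card: "finite s \<Longrightarrow> t \<in> keys (sd s) \<Longrightarrow> finite t \<and> card t = card s"
proof (induction s arbitrary: t rule: finite_psubset_induct)
  case (psubset s)
  show ?case
  proof (cases "s = {}")
    case False
    obtain p u where u: "p \<in> s" "u \<in> keys (sd (s - {p}))" "bary s \<notin> u" "t = insert (bary s) u"
      using in_keys_sdE [OF psubset.hyps False psubset.prems] .
    then have "finite u \<and> card u = card (s - {p})"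
      using psubset.IH [of "s - {p}" u] by blast
    then show ?thesis
      using u psubset.hyps by (simp add: card_Suc_Diff1 del: card_Diff_insert)
  qed (use psubset.prems in simp)
qed

lemma fin_chain_sd: "fin_chain c \<Longrightarrow> fin_chain (lin sd c)"
  by (auto simp: fin_chain_def sd_card elim!: in_keys_linE)

lemma bd_sd_basis: "finite s \<Longrightarrow> lin bd (sd s) = lin sd (bd s)"
proof (induction s rule: finite_psubset_induct)
  case (psubset s)
  show ?case
  proof (cases "s = {}")
    case False
    have "lin bd (lin sd (bd s)) = lin (\<lambda>t. lin sd (bd t)) (bd s)"
      unfolding lin_lin by (rule lin_cong) (auto elim!: in_keys_bdE intro!: psubset.IH)
    also have "\<dots> = lin sd (lin bd (bd s))"
      by (simp add: lin_lin)
    finally have "lin bd (lin sd (bd s)) = 0"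
      using psubset.hyps by (simp add: bd_bd_basis)
    then show ?thesis
      using bd_cone [OF fin_chain_sd [OF fin_chain_bd_basis [OF psubset.hyps]], of "bary s"]
      by (simp add: sd_rec psubset.hyps False)
  qed simp
qed

lemma bd_sd: "fin_chain c \<Longrightarrow> lin bd (lin sd c) = lin sd (lin bd c)"
  unfolding lin_lin by (intro lin_cong) (simp add: bd_sd_basis fin_chain_def)

text \<open>
  Closure under the barycentres of finite sets: as much of convexity as subdivision involves. The sets used
  are closed simplices and boxes in the supremum distance.
\<close>

definition avg_closed :: "('a \<Rightarrow> real) set \<Rightarrow> bool" where
  "avg_closed C \<longleftrightarrow> (\<forall>s\<subseteq>C. finite s \<and> s \<noteq> {} \<longrightarrow> bary s \<in> C)"

lemma sd_subset:
  "finite s \<Longrightarrow> s \<subseteq> C \<Longrightarrow> avg_closed C \<Longrightarrow> t \<in> keys (sd s) \<Longrightarrow> t \<subseteq> C"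
proof (induction s arbitrary: t rule: finite_psubset_induct)
  case (psubset s)
  show ?case
  proof (cases "s = {}")
    case False
    obtain p u where u: "p \<in> s" "u \<in> keys (sd (s - {p}))" "t = insert (bary s) u"
      using in_keys_sdE [OF psubset.hyps False psubset.prems(3)] by metis
    then have "u \<subseteq> C"
      using psubset.IH [of "s - {p}" u] psubset.prems by blast
    then show ?thesis
      using u psubset.prems psubset.hyps False by (auto simp: avg_closed_def)
  qed (use psubset.prems in simp)
qed

lemma avg_closed_closed_simplex: "avg_closed (closed_simplex \<sigma>)"
  unfolding avg_closed_def
proof (intro allI impI)
  fix s assume s: "s \<subseteq> closed_simplex \<sigma>" "finite s \<and> s \<noteq> {}"
  have "(\<Sum>v\<in>\<sigma>. \<Sum>p\<in>s. p v) = (\<Sum>p\<in>s. 1)"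
    using s by (subst sum.swap, intro sum.cong) (auto simp: closed_simplex_def)
  then have "(\<Sum>v\<in>\<sigma>. bary s v) = 1"
    using s by (simp add: bary_def flip: sum_divide_distrib)
  moreover have "0 \<le> bary s v" for v
    using s by (auto simp: bary_def closed_simplex_def intro!: divide_nonneg_nonneg sum_nonneg)
  moreover have "bary s v = 0" if "v \<notin> \<sigma>" for v
    using s that by (auto simp: bary_def closed_simplex_def intro!: sum.neutral)
  ultimately show "bary s \<in> closed_simplex \<sigma>"
    by (simp add: closed_simplex_def)
qed

lemma bary_dist_le:
  assumes "finite s" "s \<noteq> {}" "\<And>p. p \<in> s \<Longrightarrow> \<bar>a - p v\<bar> \<le> B"
  shows "\<bar>a - bary s v\<bar> \<le> B"
proof -
  have c: "real (card s) > 0"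
    using assms by (simp add: card_gt_0_iff)
  then have "a - bary s v = (\<Sum>p\<in>s. a - p v) / card s"
    by (simp add: bary_def sum_subtractf field_simps)
  also have "\<bar>\<dots>\<bar> \<le> (\<Sum>p\<in>s. \<bar>a - p v\<bar>) / card s"
    using c by (simp add: divide_right_mono)
  also have "\<dots> \<le> (\<Sum>p\<in>s. B) / card s"
    using assms c by (intro divide_right_mono sum_mono) auto
  finally show ?thesis
    using c by simp
qed

text \<open>
  The summand of the vertex itself contributes nothing, which gains the factor by which subdivision reduces
  the mesh.
\<close>

lemma bary_vertex_dist:
  assumes "finite s" "q \<in> s" "\<And>p r v. p \<in> s \<Longrightarrow> r \<in> s \<Longrightarrow> \<bar>p v - r v\<bar> \<le> D"
  shows "\<bar>bary s v - q v\<bar> \<le> (1 - 1 / card s) * D"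
proof -
  have c: "card s \<ge> 1"
    using assms by (metis One_nat_def Suc_leI card_gt_0_iff empty_iff)
  have "bary s v - q v = (\<Sum>p\<in>s. p v - q v) / card s"
    using c by (simp add: bary_def sum_subtractf field_simps)
  also have "(\<Sum>p\<in>s. p v - q v) = (\<Sum>p\<in>s - {q}. p v - q v)"
    using assms by (simp add: sum.remove [of s q])
  also have "\<bar>(\<Sum>p\<in>s - {q}. p v - q v) / card s\<bar> \<le> (\<Sum>p\<in>s - {q}. \<bar>p v - q v\<bar>) / card s"
    using c by (simp add: divide_right_mono)
  also have "\<dots> \<le> (\<Sum>p\<in>s - {q}. D) / card s"
    using assms by (intro divide_right_mono sum_mono) auto
  also have "\<dots> = (1 - 1 / card s) * D"
  proof -
    have "real (card (s - {q})) = real (card s) - 1"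
      using c assms(1,2) by (simp add: of_nat_diff)
    then show ?thesis
      using c by (simp add: diff_divide_distrib left_diff_distrib)
  qed
  finally show ?thesis .
qed

text \<open>
  Two vertices of a simplex of the subdivision lie in the subdivision of a common facet, to which induction
  applies, unless one of them is the barycentre of \<open>s\<close>. The points within the required distance
  of the barycentre form a set that is closed under averages and contains the vertices, hence contains all
  points of the subdivision.
\<close>

lemma sd_mesh:
  assumes "finite s" "t \<in> keys (sd s)" "card s \<le> k"
    and "\<And>p r v. p \<in> s \<Longrightarrow> r \<in> s \<Longrightarrow> \<bar>p v - r v\<bar> \<le> D"
    and "p \<in> t" "r \<in> t"
  shows "\<bar>p v - r v\<bar> \<le> (1 - 1 / real k) * D"
  using assms
proof (induction s arbitrary: t p r rule: finite_psubset_induct)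
  case (psubset s)
  show ?case
  proof (cases "s = {}")
    case True
    then show ?thesis using psubset.prems by simp
  next
    case False
    obtain q u where u: "q \<in> s" "u \<in> keys (sd (s - {q}))" "t = insert (bary s) u"
      using in_keys_sdE [OF psubset.hyps False psubset.prems(1)] by metis
    have c: "0 < card s"
      using psubset.hyps False by (simp add: card_gt_0_iff)
    have D: "0 \<le> D"
      using psubset.prems(3) [OF u(1) u(1)] by simp
    let ?H = "{y. \<forall>v. \<bar>bary s v - y v\<bar> \<le> (1 - 1 / card s) * D}"
    have uH: "u \<subseteq> ?H"
    proof (rule sd_subset [OF _ _ _ u(2)])
      show "s - {q} \<subseteq> ?H"
        using bary_vertex_dist [of s _ D, OF psubset.hyps] psubset.prems(3) by auto
      show "avg_closed ?H"
        unfolding avg_closed_def by (auto intro!: bary_dist_le)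
    qed (use psubset.hyps in simp)
    have kle: "(1 - 1 / real (card s)) * D \<le> (1 - 1 / real k) * D"
      using c psubset.prems(2) D by (intro mult_right_mono diff_left_mono divide_left_mono) auto
    have b: "\<bar>bary s v - y v\<bar> \<le> (1 - 1 / real k) * D" if "y \<in> u" for y
    proof -
      have "\<bar>bary s v - y v\<bar> \<le> (1 - 1 / real (card s)) * D"
        using that uH by blast
      then show ?thesis
        using kle by (rule order_trans)
    qed
    have k0: "0 \<le> (1 - 1 / real k) * D"
      using c psubset.prems(2) D by (intro mult_nonneg_nonneg) auto
    have IH: "\<bar>x v - y v\<bar> \<le> (1 - 1 / real k) * D" if "x \<in> u" "y \<in> u" for x y
    proof (rule psubset.IH [OF _ u(2)])
      show "card (s - {q}) \<le> k"
        using psubset.prems(2) psubset.hyps by (meson card_Diff1_le order_trans)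
    qed (use u(1) psubset.prems(3) that in auto)
    show ?thesis
      using psubset.prems(4,5) u(3) b IH k0 by (auto simp: abs_minus_commute)
  qed
qed

lemma fin_chain_sdn: "fin_chain c \<Longrightarrow> fin_chain ((lin sd ^^ m) c)"
  by (induction m) (simp_all add: fin_chain_sd)

lemma bd_sdn: "fin_chain c \<Longrightarrow> lin bd ((lin sd ^^ m) c) = (lin sd ^^ m) (lin bd c)"
  by (induction m) (simp_all add: bd_sd fin_chain_sdn)

lemma sdn_lin: "(lin sd ^^ m) (lin f c) = lin (\<lambda>s. (lin sd ^^ m) (f s)) c"
  by (induction m) (simp_all add: lin_lin)

text \<open>
  What iterated subdivision does to a simplex: the number of vertices is kept, the new points stay in every
  convex set around the old ones, and the mesh shrinks geometrically.
\<close>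

lemma sdn_keys:
  assumes "fin_chain c" "t \<in> keys ((lin sd ^^ m) c)"
    and "\<And>s. s \<in> keys c \<Longrightarrow> card s \<le> k"
    and "\<And>s p r v. s \<in> keys c \<Longrightarrow> p \<in> s \<Longrightarrow> r \<in> s \<Longrightarrow> \<bar>p v - r v\<bar> \<le> D"
  shows "\<exists>s\<in>keys c. finite t \<and> card t = card s
    \<and> (\<forall>C. avg_closed C \<and> s \<subseteq> C \<longrightarrow> t \<subseteq> C)
    \<and> (\<forall>p\<in>t. \<forall>r\<in>t. \<forall>v. \<bar>p v - r v\<bar> \<le> (1 - 1 / real k) ^ m * D)"
  using assms(2)
proof (induction m arbitrary: t)
  case 0
  then show ?case
    using assms(1,4) by (auto simp: fin_chain_def)
next
  case (Suc m)
  then obtain t' where t': "t' \<in> keys ((lin sd ^^ m) c)" "t \<in> keys (sd t')"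
    by (auto elim: in_keys_linE)
  obtain s where s: "s \<in> keys c" "finite t'" "card t' = card s"
    "\<forall>C. avg_closed C \<and> s \<subseteq> C \<longrightarrow> t' \<subseteq> C"
    "\<forall>p\<in>t'. \<forall>r\<in>t'. \<forall>v. \<bar>p v - r v\<bar> \<le> (1 - 1 / real k) ^ m * D"
    using Suc.IH [OF t'(1)] by blast
  have "\<bar>p v - r v\<bar> \<le> (1 - 1 / real k) * ((1 - 1 / real k) ^ m * D)" if "p \<in> t" "r \<in> t" for p r v
    by (rule sd_mesh [OF s(2) t'(2)]) (use s assms(3) that in auto)
  moreover have "\<forall>C. avg_closed C \<and> s \<subseteq> C \<longrightarrow> t \<subseteq> C"
    using sd_subset [OF s(2) _ _ t'(2)] s(4) by blast
  moreover have "finite t \<and> card t = card s"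
    using sd_card [OF s(2) t'(2)] s(3) by simp
  ultimately show ?case
    using s(1) by (intro bexI [of _ s]) (auto simp: mult.assoc)
qed

definition vertex_pt :: "'a \<Rightarrow> 'a \<Rightarrow> real" where
  "vertex_pt v = (\<lambda>w. if w = v then 1 else 0)"

lemma inj_vertex_pt: "inj vertex_pt"
  by (rule injI) (metis vertex_pt_def zero_neq_one)

lemma vertex_pt_in: "finite \<sigma> \<Longrightarrow> v \<in> \<sigma> \<Longrightarrow> vertex_pt v \<in> closed_simplex \<sigma>"
  by (auto simp: closed_simplex_def vertex_pt_def)

lemma push_vertex_pt: "push vertex_pt s = basis (vertex_pt ` s)"
  by (simp add: push_def inj_on_subset [OF inj_vertex_pt])

text \<open>
  Sperner's lemma modulo two. Subdividing and then labelling is a chain map that sends each face to a chain on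
  the vertices of this face; there are only the two possibilities \<open>0\<close> and
  \<open>basis \<sigma>\<close> for \<open>\<sigma>\<close> itself, and by induction on the faces its boundary
  is that of \<open>\<sigma>\<close>.
\<close>

lemma sperner:
  assumes "finite \<sigma>"
    and "\<And>\<tau> p. \<tau> \<subseteq> \<sigma> \<Longrightarrow> p \<in> closed_simplex \<tau> \<Longrightarrow> \<phi> p \<in> \<tau>"
  shows "lin (push \<phi>) ((lin sd ^^ m) (push vertex_pt \<sigma>)) = basis \<sigma>"
  using assms
proof (induction \<sigma> rule: finite_psubset_induct)
  case (psubset \<sigma>)
  define T where "T = (\<lambda>\<tau>. lin (push \<phi>) ((lin sd ^^ m) (push vertex_pt \<tau>)))"
  show ?case
  proof (cases "\<sigma> = {}")
    case True
    have "(lin sd ^^ m) (basis {}) = (basis {} :: ('a \<Rightarrow> real) set chain)"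
      by (induction m) simp_all
    moreover have "push vertex_pt \<sigma> = basis {}" "push \<phi> {} = basis {}"
      using True by (simp_all add: push_def)
    ultimately show ?thesis
      using True by simp
  next
    case False
    have fin: "fin_chain (push vertex_pt \<sigma>)"
      using psubset.hyps by (simp add: push_vertex_pt)
    have "lin bd (T \<sigma>) = lin (push \<phi>) ((lin sd ^^ m) (lin (push vertex_pt) (bd \<sigma>)))"
      unfolding T_def bd_push [OF fin_chain_sdn [OF fin]] bd_sdn [OF fin] bd_push_basis [OF psubset.hyps] ..
    also have "\<dots> = lin T (bd \<sigma>)"
      by (simp add: T_def sdn_lin lin_lin)
    also have "\<dots> = lin basis (bd \<sigma>)"
    proof (rule lin_cong)
      fix \<tau> assume "\<tau> \<in> keys (bd \<sigma>)"
      then have "\<tau> \<subset> \<sigma>"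
        by (auto elim!: in_keys_bdE)
      then show "T \<tau> = basis \<tau>"
        unfolding T_def by (intro psubset.IH psubset.prems) auto
    qed
    finally have bdT: "lin bd (T \<sigma>) = bd \<sigma>"
      by (simp add: lin_basis_id)
    have "t = \<sigma>" if t: "t \<in> keys (T \<sigma>)" for t
    proof -
      obtain u where u: "u \<in> keys ((lin sd ^^ m) (push vertex_pt \<sigma>))" "inj_on \<phi> u" "t = \<phi> ` u"
        using t unfolding T_def by (auto elim!: in_keys_linE in_keys_pushE)
      have "vertex_pt ` \<sigma> \<subseteq> closed_simplex \<sigma>"
        using vertex_pt_in [OF psubset.hyps] by auto
      moreover have "\<bar>p v - r v\<bar> \<le> 1"
        if "s \<in> keys (push vertex_pt \<sigma>)" "p \<in> s" "r \<in> s" for s p r v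
        using that by (auto simp: push_vertex_pt vertex_pt_def)
      ultimately have "finite u \<and> card u = card (vertex_pt ` \<sigma>) \<and> u \<subseteq> closed_simplex \<sigma>"
        using sdn_keys [OF fin u(1), of "card (vertex_pt ` \<sigma>)" 1] avg_closed_closed_simplex [of \<sigma>]
        unfolding push_vertex_pt by (simp only: Poly_Mapping.keys_single) auto
      then have "card t = card \<sigma>" "t \<subseteq> \<sigma>"
        using u psubset.prems [of \<sigma>] by (auto simp: card_image inj_on_subset [OF inj_vertex_pt])
      then show ?thesis
        using psubset.hyps by (simp add: card_subset_eq)
    qed
    then have "keys (T \<sigma>) \<subseteq> {\<sigma>}"
      by blast
    moreover have "keys (T \<sigma>) \<noteq> {}"
      using bdT bd_nonzero [OF psubset.hyps False] by auto
    ultimately have "keys (T \<sigma>) = {\<sigma>}"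
      by blast
    then have "T \<sigma> = basis \<sigma>"
      using chain_eq_sum_basis [of "T \<sigma>"] by simp
    then show ?thesis
      by (simp add: T_def)
  qed
qed


section \<open>Continuity into geometric realizations\<close>

lemma closedin_closed_simplex: "closedin (powertop_real UNIV) (closed_simplex \<sigma>)"
proof -
  let ?P = "powertop_real (UNIV :: 'a set)"
  have coord: "continuous_map ?P euclideanreal (\<lambda>p. p v)" for v
    by (rule continuous_map_product_projection) simp
  have 1: "closedin ?P {p \<in> topspace ?P. p v \<in> {0..}}" for v
    by (rule closedin_continuous_map_preimage [OF coord]) simp
  have 2: "closedin ?P {p \<in> topspace ?P. p v \<in> {0}}" for v
    by (rule closedin_continuous_map_preimage [OF coord]) simp
  have 3: "closedin ?P {p \<in> topspace ?P. (\<Sum>v\<in>\<sigma>. p v) \<in> {1}}"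
  proof (cases "finite \<sigma>")
    case True
    then show ?thesis
      by (intro closedin_continuous_map_preimage [of _ euclideanreal] continuous_intros coord) auto
  qed simp
  have "closed_simplex \<sigma> = (\<Inter>v. {p \<in> topspace ?P. p v \<in> {0..}})
      \<inter> (topspace ?P \<inter> (\<Inter>v\<in>-\<sigma>. {p \<in> topspace ?P. p v \<in> {0}})) \<inter> {p \<in> topspace ?P. (\<Sum>v\<in>\<sigma>. p v) \<in> {1}}"
    by (auto simp: closed_simplex_def)
  moreover have "closedin ?P (\<Inter>v. {p \<in> topspace ?P. p v \<in> {0..}})"
    by (rule closedin_INT [OF UNIV_not_empty 1])
  moreover have "closedin ?P (topspace ?P \<inter> (\<Inter>v\<in>-\<sigma>. {p \<in> topspace ?P. p v \<in> {0}}))"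
  proof (cases "-\<sigma> = {}")
    case False
    then show ?thesis
      by (intro closedin_Int closedin_topspace closedin_INT 2)
  qed (use closedin_topspace [of ?P] in simp)
  ultimately show ?thesis
    using 3 by (simp add: closedin_Int)
qed

lemma closed_simplex_le_1:
  assumes "finite \<sigma>" "p \<in> closed_simplex \<sigma>"
  shows "p v \<le> 1"
proof (cases "v \<in> \<sigma>")
  case True
  then have "p v \<le> (\<Sum>v\<in>\<sigma>. p v)"
    using assms by (intro member_le_sum) (auto simp: closed_simplex_def)
  then show ?thesis using assms by (simp add: closed_simplex_def)
qed (use assms in \<open>simp add: closed_simplex_def\<close>)

lemma compactin_closed_simplex:
  assumes "finite \<sigma>"
  shows "compactin (powertop_real UNIV) (closed_simplex \<sigma>)"
proof (rule closed_compactin [OF _ _ closedin_closed_simplex])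
  show "compactin (powertop_real UNIV) (PiE UNIV (\<lambda>_. {0..1::real}))"
    by (simp add: compactin_PiE)
  show "closed_simplex \<sigma> \<subseteq> PiE UNIV (\<lambda>_. {0..1})"
    using closed_simplex_le_1 [OF assms] by (auto simp: closed_simplex_def PiE_UNIV_domain)
qed

text \<open>
  On a finite subcomplex the weak topology is the topology of coordinatewise convergence, since closed
  simplices are closed in the latter.
\<close>

lemma continuous_map_into_realization:
  assumes "finite F" "F \<subseteq> K"
    and F: "\<And>x. x \<in> topspace X \<Longrightarrow> \<exists>\<sigma>\<in>F. g x \<in> closed_simplex \<sigma>"
    and coord: "\<And>v. continuous_map X euclideanreal (\<lambda>x. g x v)"
  shows "continuous_map X (geometric_realization K) g"
  unfolding continuous_map_closedin
proof (intro conjI allI impI)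
  show "g \<in> topspace X \<rightarrow> topspace (geometric_realization K)"
    using F \<open>F \<subseteq> K\<close> by (force simp: topspace_geometric_realization)
next
  fix C assume C: "closedin (geometric_realization K) C"
  have g: "continuous_map X (powertop_real UNIV) g"
    using coord by (simp add: continuous_map_componentwise_UNIV)
  have cl: "closedin (powertop_real UNIV) (C \<inter> closed_simplex \<sigma>)" if \<sigma>: "\<sigma> \<in> F" for \<sigma>
  proof -
    let ?S = "subtopology (powertop_real UNIV) (closed_simplex \<sigma>)"
    let ?U = "topspace (geometric_realization K) - C"
    have "openin ?S (?U \<inter> closed_simplex \<sigma>)"
      using C \<sigma> \<open>F \<subseteq> K\<close> by (auto simp: closedin_def openin_geometric_realization)
    then have "closedin ?S (topspace ?S - (?U \<inter> closed_simplex \<sigma>))"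
      by blast
    moreover have "topspace ?S - (?U \<inter> closed_simplex \<sigma>) = C \<inter> closed_simplex \<sigma>"
      using \<sigma> \<open>F \<subseteq> K\<close> by (auto simp: topspace_geometric_realization)
    ultimately have "closedin ?S (C \<inter> closed_simplex \<sigma>)"
      by simp
    then show ?thesis
      using closedin_closed_simplex by (rule closedin_trans_full)
  qed
  have "{x \<in> topspace X. g x \<in> C} = (\<Union>\<sigma>\<in>F. {x \<in> topspace X. g x \<in> C \<inter> closed_simplex \<sigma>})"
    using F by blast
  moreover have "closedin X {x \<in> topspace X. g x \<in> C \<inter> closed_simplex \<sigma>}" if "\<sigma> \<in> F" for \<sigma>
    by (rule closedin_continuous_map_preimage [OF g cl [OF that]])
  then have "closedin X (\<Union>\<sigma>\<in>F. {x \<in> topspace X. g x \<in> C \<inter> closed_simplex \<sigma>})"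
    using \<open>finite F\<close> by (intro closedin_Union) blast+
  ultimately show "closedin X {x \<in> topspace X. g x \<in> C}"
    by simp
qed

lemma continuous_map_realization_coord:
  "continuous_map (geometric_realization K) euclideanreal (\<lambda>p. p v)"
proof -
  have "continuous_map (geometric_realization K) (powertop_real UNIV) (\<lambda>p. p)"
    unfolding continuous_map_def
  proof (intro conjI allI impI)
    fix U :: "('a \<Rightarrow> real) set"
    assume U: "openin (powertop_real UNIV) U"
    have "openin (subtopology (powertop_real UNIV) (closed_simplex \<sigma>))
        ({p \<in> topspace (geometric_realization K). p \<in> U} \<inter> closed_simplex \<sigma>)" if "\<sigma> \<in> K" for \<sigma>
    proof -
      have "{p \<in> topspace (geometric_realization K). p \<in> U} \<inter> closed_simplex \<sigma> = closed_simplex \<sigma> \<inter> U"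
        using that by (auto simp: topspace_geometric_realization)
      then show ?thesis
        using U by (simp add: openin_subtopology_Int2)
    qed
    then show "openin (geometric_realization K) {p \<in> topspace (geometric_realization K). p \<in> U}"
      by (auto simp: openin_geometric_realization topspace_geometric_realization)
  qed auto
  then show ?thesis
    by (simp add: continuous_map_componentwise_UNIV)
qed

lemma continuous_map_into_realization_coord:
  "continuous_map X (geometric_realization K) g \<Longrightarrow> continuous_map X euclideanreal (\<lambda>x. g x v)"
  using continuous_map_compose [OF _ continuous_map_realization_coord] by (fastforce simp: comp_def)

text \<open>
  Choose for each vertex occurring in \<open>C\<close> a point with that vertex in its support. A closed
  simplex contains only finitely many of the chosen points, hence all sets of chosen points are closed in the
  weak topology. The chosen points thus form a discrete closed subset of a compact set.
\<close>

lemma finite_vertices_of_compact: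
  assumes K: "\<And>\<sigma>. \<sigma> \<in> K \<Longrightarrow> finite \<sigma>" and C: "compactin (geometric_realization K) C"
  shows "finite {v. \<exists>p\<in>C. p v \<noteq> 0}"
proof -
  let ?R = "geometric_realization K"
  let ?N = "{v. \<exists>p\<in>C. p v \<noteq> 0}"
  define pt where "pt v = (SOME p. p \<in> C \<and> p v \<noteq> 0)" for v
  have pt: "pt v \<in> C" "pt v v \<noteq> 0" if "v \<in> ?N" for v
    using someI_ex [of "\<lambda>p. p \<in> C \<and> p v \<noteq> 0"] that by (auto simp: pt_def)
  define D where "D = pt ` ?N"
  have "D \<subseteq> C"
    using pt by (auto simp: D_def)
  have Ctop: "C \<subseteq> topspace ?R"
    using C by (rule compactin_subset_topspace)
  have fin: "finite (D \<inter> closed_simplex \<sigma>)" if "\<sigma> \<in> K" for \<sigma>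
  proof (rule finite_subset)
    show "D \<inter> closed_simplex \<sigma> \<subseteq> pt ` \<sigma>"
      using pt by (force simp: D_def closed_simplex_def)
  qed (use K that in simp)
  have closed: "closedin ?R E" if "E \<subseteq> D" for E
    unfolding closedin_def openin_geometric_realization
  proof (intro conjI ballI)
    show "E \<subseteq> topspace ?R"
      using that \<open>D \<subseteq> C\<close> Ctop by blast
    show "topspace ?R - E \<subseteq> (\<Union>\<sigma>\<in>K. closed_simplex \<sigma>)"
      by (auto simp: topspace_geometric_realization)
    fix \<sigma> assume \<sigma>: "\<sigma> \<in> K"
    have "finite (E \<inter> closed_simplex \<sigma>)"
      using fin [OF \<sigma>] that by (meson Int_mono finite_subset order_refl)
    moreover have "Hausdorff_space (powertop_real (UNIV :: 'a set))"
      by (simp add: Hausdorff_space_product_topology)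
    ultimately have "closedin (powertop_real UNIV) (E \<inter> closed_simplex \<sigma>)"
      by (simp add: compactin_imp_closedin finite_imp_compactin)
    then have "openin (powertop_real UNIV) (topspace (powertop_real UNIV) - (E \<inter> closed_simplex \<sigma>))"
      by blast
    then have "openin (subtopology (powertop_real UNIV) (closed_simplex \<sigma>))
        (closed_simplex \<sigma> \<inter> (topspace (powertop_real UNIV) - (E \<inter> closed_simplex \<sigma>)))"
      by (rule openin_subtopology_Int2)
    moreover have "(topspace ?R - E) \<inter> closed_simplex \<sigma>
        = closed_simplex \<sigma> \<inter> (topspace (powertop_real UNIV) - (E \<inter> closed_simplex \<sigma>))"
      using \<sigma> by (auto simp: topspace_geometric_realization)
    ultimately show "openin (subtopology (powertop_real UNIV) (closed_simplex \<sigma>)) ((topspace ?R - E) \<inter> closed_simplex \<sigma>)"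
      by simp
  qed
  have "?R derived_set_of D = {}"
  proof -
    have "x \<notin> ?R derived_set_of D" for x
    proof
      assume x: "x \<in> ?R derived_set_of D"
      have "openin ?R (topspace ?R - (D - {x}))"
        using closed [of "D - {x}"] by blast
      moreover have "x \<in> topspace ?R"
        using x by (simp add: in_derived_set_of)
      ultimately obtain z where "z \<noteq> x" "z \<in> D" "z \<in> topspace ?R - (D - {x})"
        using x unfolding in_derived_set_of by (metis (no_types, lifting) DiffD2 DiffI insertI1)
      then show False
        by simp
    qed
    then show ?thesis by blast
  qed
  moreover have "compactin ?R D"
    by (rule closed_compactin [OF C \<open>D \<subseteq> C\<close> closed]) simp
  ultimately have "finite D"
    using discrete_compactin_eq_finite [of D ?R] by simp
  moreover have "finite {v. p v \<noteq> 0}" if "p \<in> D" for p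
  proof -
    have "p \<in> topspace ?R"
      using that \<open>D \<subseteq> C\<close> Ctop by blast
    then obtain \<sigma> where "\<sigma> \<in> K" "p \<in> closed_simplex \<sigma>"
      by (auto simp: topspace_geometric_realization)
    then have "{v. p v \<noteq> 0} \<subseteq> \<sigma>"
      by (auto simp: closed_simplex_def)
    then show ?thesis
      using K [OF \<open>\<sigma> \<in> K\<close>] by (rule finite_subset)
  qed
  ultimately have "finite (\<Union>p\<in>D. {v. p v \<noteq> 0})"
    by simp
  then show ?thesis
    by (rule finite_subset [rotated]) (use pt(2) in \<open>unfold D_def, blast\<close>)
qed

text \<open>
  Uniform continuity measured by finitely many functions \<open>q\<close> that separate the values of
  \<open>g\<close>. On the compact set of pairs with \<open>\<bar>g x - g y\<bar> \<ge> e\<close>, the sum of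
  the distances \<open>\<bar>q x j - q y j\<bar>\<close> is positive and has a minimum.
\<close>

lemma equicontinuity:
  assumes X: "compact_space X"
    and q: "\<And>j. j \<in> J \<Longrightarrow> continuous_map X euclideanreal (\<lambda>x. q x j)" and "finite J"
    and sep: "\<And>x y. x \<in> topspace X \<Longrightarrow> y \<in> topspace X \<Longrightarrow> (\<And>j. j \<in> J \<Longrightarrow> q x j = q y j) \<Longrightarrow> g x = g y"
    and g: "continuous_map X euclideanreal g" and e: "0 < (e::real)"
  shows "\<exists>d>0. \<forall>x\<in>topspace X. \<forall>y\<in>topspace X. (\<forall>j\<in>J. \<bar>q x j - q y j\<bar> < d) \<longrightarrow> \<bar>g x - g y\<bar> < e"
proof -
  let ?XX = "prod_topology X X"
  define Q where "Q = (\<lambda>z. \<Sum>j\<in>J. \<bar>q (fst z) j - q (snd z) j\<bar>)"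
  have cfst: "continuous_map ?XX euclideanreal (\<lambda>z. h (fst z))"
    and csnd: "continuous_map ?XX euclideanreal (\<lambda>z. h (snd z))"
    if "continuous_map X euclideanreal h" for h
    using continuous_map_compose [OF continuous_map_fst that, of X]
      continuous_map_compose [OF continuous_map_snd that, of X] by (simp_all add: comp_def)
  define B where "B = {z \<in> topspace ?XX. \<bar>g (fst z) - g (snd z)\<bar> \<in> {e..}}"
  have contg: "continuous_map ?XX euclideanreal (\<lambda>z. \<bar>g (fst z) - g (snd z)\<bar>)"
    by (intro continuous_intros cfst csnd g)
  have "closedin ?XX B"
    unfolding B_def by (rule closedin_continuous_map_preimage [OF contg]) simp
  then have B: "compactin ?XX B"
    using X by (simp add: closedin_compact_space compact_space_prod_topology)
  have contQ: "continuous_map ?XX euclideanreal Q"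
    unfolding Q_def using \<open>finite J\<close> q by (intro continuous_intros cfst csnd) auto
  have "compact (Q ` B)"
    using image_compactin [OF B contQ] by simp
  have pos: "0 < Q z" if z: "z \<in> B" for z
  proof (rule ccontr)
    assume "\<not> 0 < Q z"
    moreover have "0 \<le> Q z"
      unfolding Q_def by (rule sum_nonneg) simp
    ultimately have "Q z = 0" by simp
    then have "\<forall>j\<in>J. q (fst z) j = q (snd z) j"
      using \<open>finite J\<close> by (simp add: Q_def sum_nonneg_eq_0_iff)
    then have "g (fst z) = g (snd z)"
      using z by (intro sep) (auto simp: B_def)
    then show False
      using z e by (simp add: B_def)
  qed
  obtain m where m: "0 < m" "\<And>z. z \<in> B \<Longrightarrow> m \<le> Q z"
  proof (cases "B = {}")
    case True
    then show ?thesis using that [of 1] by simp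
  next
    case False
    then obtain z where "z \<in> B" "\<forall>y\<in>B. Q z \<le> Q y"
      using compact_attains_inf [OF \<open>compact (Q ` B)\<close>] by auto
    then show ?thesis
      using pos that [of "Q z"] by blast
  qed
  define d where "d = m / (card J + 1)"
  have "0 < d"
    using m by (simp add: d_def)
  moreover have "\<bar>g x - g y\<bar> < e"
    if "x \<in> topspace X" "y \<in> topspace X" "\<forall>j\<in>J. \<bar>q x j - q y j\<bar> < d" for x y
  proof (rule ccontr)
    assume "\<not> \<bar>g x - g y\<bar> < e"
    then have "(x, y) \<in> B"
      using that by (simp add: B_def)
    then have "m \<le> Q (x, y)"
      by (rule m)
    also have "\<dots> \<le> (\<Sum>j\<in>J. d)"
      unfolding Q_def using that by (intro sum_mono) (simp add: less_imp_le)
    also have "\<dots> = card J * (m / (card J + 1))"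
      by (simp add: d_def)
    also have "\<dots> < m"
      using m by (simp add: field_simps)
    finally show False by simp
  qed
  ultimately show ?thesis by blast
qed

lemma equicontinuous_family:
  fixes X :: "'i \<Rightarrow> 'b topology"
  assumes "finite A" "finite J" and e: "0 < (e::real)"
    and X: "\<And>a. a \<in> A \<Longrightarrow> compact_space (X a)"
    and q: "\<And>a j. a \<in> A \<Longrightarrow> j \<in> J \<Longrightarrow> continuous_map (X a) euclideanreal (\<lambda>x. q x j)"
    and sep: "\<And>a x y. a \<in> A \<Longrightarrow> x \<in> topspace (X a) \<Longrightarrow> y \<in> topspace (X a) \<Longrightarrow>
      (\<And>j. j \<in> J \<Longrightarrow> q x j = q y j) \<Longrightarrow> g a x = g a y"
    and g: "\<And>a. a \<in> A \<Longrightarrow> continuous_map (X a) euclideanreal (g a)"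
  shows "\<exists>d>0. \<forall>a\<in>A. \<forall>x\<in>topspace (X a). \<forall>y\<in>topspace (X a).
    (\<forall>j\<in>J. \<bar>q x j - q y j\<bar> < d) \<longrightarrow> \<bar>g a x - g a y\<bar> < e"
proof -
  let ?P = "\<lambda>a d. \<forall>x\<in>topspace (X a). \<forall>y\<in>topspace (X a).
    (\<forall>j\<in>J. \<bar>q x j - q y j\<bar> < d) \<longrightarrow> \<bar>g a x - g a y\<bar> < e"
  have "\<exists>d>0. ?P a d" if a: "a \<in> A" for a
    by (rule equicontinuity [OF X [OF a] q [OF a] \<open>finite J\<close> sep [OF a] g [OF a] e])
  then obtain d where d: "\<And>a. a \<in> A \<Longrightarrow> 0 < d a \<and> ?P a (d a)"
    by metis
  define d0 where "d0 = Min (insert 1 (d ` A))"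
  have "0 < d0"
    unfolding d0_def using \<open>finite A\<close> d by (subst Min_gr_iff) auto
  moreover have "?P a d0" if a: "a \<in> A" for a
  proof (intro ballI impI)
    fix x y
    assume xy: "x \<in> topspace (X a)" "y \<in> topspace (X a)" and close: "\<forall>j\<in>J. \<bar>q x j - q y j\<bar> < d0"
    have "d0 \<le> d a"
      unfolding d0_def using \<open>finite A\<close> a by (intro Min_le) auto
    then have "\<forall>j\<in>J. \<bar>q x j - q y j\<bar> < d a"
      using close by (meson order_less_le_trans)
    then show "\<bar>g a x - g a y\<bar> < e"
      using d [OF a] xy by blast
  qed
  ultimately show ?thesis by blast
qed


section \<open>Null-homotopic maps\<close>

text \<open>
  A null-homotopy \<open>H\<close> is a map on the cone over \<open>S\<close>, with its apex at
  \<open>t = 1\<close>. The functions \<open>t\<close> and \<open>b\<close> are cone coordinates on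
  \<open>X\<close>, of which \<open>b\<close> has no meaning at the apex. There continuity follows from the
  tube lemma and compactness of \<open>S\<close>.
\<close>

lemma continuous_map_cone:
  assumes H: "continuous_map (prod_topology (top_of_set {0..1::real}) S) Y H"
    and Hc: "\<And>y. y \<in> topspace S \<Longrightarrow> H (1, y) = c"
    and S: "compact_space S" and c: "c \<in> topspace Y"
    and t: "continuous_map X euclideanreal t" "\<And>x. x \<in> topspace X \<Longrightarrow> 0 \<le> t x"
      "\<And>x. x \<in> topspace X \<Longrightarrow> t x \<le> 1"
    and b: "continuous_map (subtopology X {x \<in> topspace X. t x < 1}) S b"
  shows "continuous_map X Y (\<lambda>x. if t x < 1 then H (t x, b x) else c)"
    (is "continuous_map X Y ?F")
proof -
  let ?X1 = "{x \<in> topspace X. t x < 1}"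
  let ?P = "prod_topology (top_of_set {0..1::real}) S"
  have "?X1 = {x \<in> topspace X. t x \<in> {..<1}}"
    by simp
  then have X1: "openin X ?X1"
    using openin_continuous_map_preimage [OF t(1), of "{..<1}"] by simp
  have t1: "continuous_map (subtopology X ?X1) (top_of_set {0..1}) t"
    unfolding continuous_map_in_subtopology using t by (auto intro: continuous_map_from_subtopology)
  have tb: "continuous_map (subtopology X ?X1) ?P (\<lambda>x. (t x, b x))"
    using t1 b by (simp add: continuous_map_pairwise comp_def)
  have g: "continuous_map (subtopology X ?X1) Y (\<lambda>x. H (t x, b x))"
    using continuous_map_compose [OF tb H] by (simp add: comp_def)
  have bS: "b x \<in> topspace S" if "x \<in> ?X1" for x
    using b that by (auto simp: continuous_map_def)
  show ?thesis
    unfolding continuous_map_def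
  proof (intro conjI allI impI)
    show "?F \<in> topspace X \<rightarrow> topspace Y"
      using g c by (auto simp: continuous_map_def)
  next
    fix U assume U: "openin Y U"
    define A where "A = {x \<in> ?X1. H (t x, b x) \<in> U}"
    have "openin (subtopology X ?X1) A"
      using openin_continuous_map_preimage [OF g U] by (simp add: A_def Int_def conj_ac)
    then have A: "openin X A"
      using X1 by (rule openin_trans_full)
    show "openin X {x \<in> topspace X. ?F x \<in> U}"
    proof (cases "c \<in> U")
      case False
      then have "{x \<in> topspace X. ?F x \<in> U} = A"
        by (auto simp: A_def split: if_splits)
      then show ?thesis using A by simp
    next
      case True
      define W where "W = {z \<in> topspace ?P. H z \<in> U}"
      have "openin ?P W"
        unfolding W_def by (rule openin_continuous_map_preimage [OF H U])
      moreover have "{1} \<times> topspace S \<subseteq> W"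
        using True Hc by (auto simp: W_def)
      ultimately obtain U' V where UV: "openin (top_of_set {0..1}) U'" "1 \<in> U'" "topspace S \<subseteq> V" "U' \<times> V \<subseteq> W"
        using tube_lemma_right [of "top_of_set {0..1::real}" S W "topspace S" 1] S
        by (auto simp: compact_space_def)
      obtain V0 where V0: "open V0" "U' = {0..1} \<inter> V0"
        using UV(1) by (auto simp: openin_open)
      have "{x \<in> topspace X. ?F x \<in> U} = A \<union> {x \<in> topspace X. t x \<in> V0}"
      proof (intro equalityI subsetI)
        fix x assume "x \<in> {x \<in> topspace X. ?F x \<in> U}"
        then show "x \<in> A \<union> {x \<in> topspace X. t x \<in> V0}"
          using t(3) [of x] UV(2) V0(2) by (cases "t x < 1") (auto simp: A_def)
      next
        fix x assume "x \<in> A \<union> {x \<in> topspace X. t x \<in> V0}"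
        then consider "x \<in> A" | "x \<in> topspace X" "t x \<in> V0" by blast
        then show "x \<in> {x \<in> topspace X. ?F x \<in> U}"
        proof cases
          case 2
          show ?thesis
          proof (cases "t x < 1")
            case True
            have "(t x, b x) \<in> U' \<times> V"
              using 2 True t(2,3) V0(2) UV(3) bS by auto
            then show ?thesis
              using UV(4) 2 True by (auto simp: W_def)
          qed (use 2 True in simp)
        qed (auto simp: A_def)
      qed
      moreover have "openin X {x \<in> topspace X. t x \<in> V0}"
        using openin_continuous_map_preimage [OF t(1), of V0] V0(1) by simp
      ultimately show ?thesis
        using A by (simp add: openin_Un)
    qed
  qed
qed

lemma compact_space_nsphere: "compact_space (nsphere n)"
proof -
  let ?P = "powertop_real (UNIV :: nat set)"
  let ?S = "{x :: nat \<Rightarrow> real. (\<Sum>i\<le>n. x i ^ 2) = 1 \<and> (\<forall>i>n. x i = 0)}"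
  have coord: "continuous_map ?P euclideanreal (\<lambda>p. p v)" for v
    by (rule continuous_map_product_projection) simp
  have "closedin ?P {p \<in> topspace ?P. (\<Sum>i\<le>n. p i ^ 2) \<in> {1}}"
    by (intro closedin_continuous_map_preimage [of _ euclideanreal] continuous_intros coord) auto
  moreover have "closedin ?P (\<Inter>i\<in>{n<..}. {p \<in> topspace ?P. p i \<in> {0}})"
    by (intro closedin_INT closedin_continuous_map_preimage [OF coord]) auto
  ultimately have "closedin ?P ({p \<in> topspace ?P. (\<Sum>i\<le>n. p i ^ 2) \<in> {1}} \<inter> (\<Inter>i\<in>{n<..}. {p \<in> topspace ?P. p i \<in> {0}}))"
    by (rule closedin_Int)
  moreover have "{p \<in> topspace ?P. (\<Sum>i\<le>n. p i ^ 2) \<in> {1}} \<inter> (\<Inter>i\<in>{n<..}. {p \<in> topspace ?P. p i \<in> {0}}) = ?S"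
    by auto
  ultimately have cl: "closedin ?P ?S"
    by simp
  have "compactin ?P ?S"
  proof (rule closed_compactin [OF _ _ cl])
    show "compactin ?P (PiE UNIV (\<lambda>_. {-1..1::real}))"
      by (simp add: compactin_PiE)
    show "?S \<subseteq> PiE UNIV (\<lambda>_. {-1..1})"
    proof
      fix x assume x: "x \<in> ?S"
      have "x i \<in> {-1..1}" for i
      proof (cases "i \<le> n")
        case True
        then have "(x i)\<^sup>2 \<le> (\<Sum>i\<le>n. (x i)\<^sup>2)"
          by (intro member_le_sum) auto
        then have "\<bar>x i\<bar> \<le> 1"
          using x by (simp add: abs_square_le_1)
        then show ?thesis by auto
      qed (use x in simp)
      then show "x \<in> PiE UNIV (\<lambda>_. {-1..1})"
        by (simp add: PiE_UNIV_domain)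
    qed
  qed
  then show ?thesis
    by (simp add: nsphere compact_space_subtopology)
qed

definition normalize2 :: "nat \<Rightarrow> (nat \<Rightarrow> real) \<Rightarrow> nat \<Rightarrow> real" where
  "normalize2 n x = (\<lambda>j. if j \<le> n then x j / sqrt (\<Sum>i\<le>n. (x i)\<^sup>2) else 0)"

lemma normalize2_in_sphere:
  assumes "(\<Sum>i\<le>n. (x i)\<^sup>2) > 0"
  shows "normalize2 n x \<in> topspace (nsphere n)"
proof -
  have "(\<Sum>i\<le>n. (normalize2 n x i)\<^sup>2) = (\<Sum>i\<le>n. (x i)\<^sup>2 / (\<Sum>i\<le>n. (x i)\<^sup>2))"
    using assms by (intro sum.cong) (auto simp: normalize2_def power_divide)
  then show ?thesis
    using assms by (simp add: nsphere flip: sum_divide_distrib) (simp add: normalize2_def)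
qed

lemma continuous_map_normalize2:
  assumes f: "\<And>j. j \<le> n \<Longrightarrow> continuous_map X euclideanreal (\<lambda>x. f x j)"
    and pos: "\<And>x. x \<in> topspace X \<Longrightarrow> (\<Sum>i\<le>n. (f x i)\<^sup>2) > 0"
  shows "continuous_map X (nsphere n) (\<lambda>x. normalize2 n (f x))"
proof -
  have s: "continuous_map X euclideanreal (\<lambda>x. sqrt (\<Sum>i\<le>n. (f x i)\<^sup>2))"
  proof -
    have "continuous_map X euclideanreal (\<lambda>x. \<Sum>i\<le>n. (f x i)\<^sup>2)"
      by (intro continuous_intros f) auto
    from continuous_map_compose [OF this, of euclideanreal sqrt] show ?thesis
      by (simp add: comp_def continuous_on_real_sqrt)
  qed
  have "continuous_map X euclideanreal (\<lambda>x. normalize2 n (f x) j)" for j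
  proof (cases "j \<le> n")
    case True
    have nz: "sqrt (\<Sum>i\<le>n. (f x i)\<^sup>2) \<noteq> 0" if "x \<in> topspace X" for x
      using pos [OF that] by simp
    have "continuous_map X euclideanreal (\<lambda>x. f x j / sqrt (\<Sum>i\<le>n. (f x i)\<^sup>2))"
      using True by (intro continuous_map_real_divide f s nz)
    then show ?thesis
      using True by (simp add: normalize2_def)
  qed (simp add: normalize2_def)
  then have "continuous_map X (powertop_real UNIV) (\<lambda>x. normalize2 n (f x))"
    by (simp add: continuous_map_componentwise_UNIV)
  moreover have "normalize2 n (f x) \<in> {x. (\<Sum>i\<le>n. x i ^ 2) = 1 \<and> (\<forall>i>n. x i = 0)}" if "x \<in> topspace X" for x
    using normalize2_in_sphere [OF pos [OF that]] by (simp add: nsphere)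
  ultimately show ?thesis
    unfolding nsphere continuous_map_in_subtopology by auto
qed

lemma normalize2_id: "x \<in> topspace (nsphere n) \<Longrightarrow> normalize2 n x = x"
  by (auto simp: nsphere normalize2_def fun_eq_iff not_le)

lemma nsphere_base_in: "nsphere_base \<in> topspace (nsphere n)"
  using in_topspace_nsphere by (simp add: nsphere_base_def)

lemma nullhomotopic_if_trivial:
  assumes triv: "trivial_homotopy_group i Y" and f: "continuous_map (nsphere i) Y f"
  shows "\<exists>c\<in>topspace Y. homotopic_with (\<lambda>_. True) (nsphere i) Y f (\<lambda>_. c)"
proof -
  define y where "y = f nsphere_base"
  have y: "y \<in> topspace Y"
    using f nsphere_base_in [of i] by (auto simp: y_def continuous_map_def)
  define S where "S = {f. continuous_map (nsphere i) Y f \<and> f nsphere_base = y}"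
  define R where "R = {(f, g). homotopic_with (\<lambda>h. h nsphere_base = y) (nsphere i) Y f g}"
  have "is_singleton (S // R)"
    using triv y by (simp add: trivial_homotopy_group_def homotopy_group_set_def S_def R_def)
  moreover have "f \<in> S" "(\<lambda>_. y) \<in> S"
    using f y by (simp_all add: S_def y_def)
  then have "R `` {f} \<in> S // R" "R `` {\<lambda>_. y} \<in> S // R"
    by (simp_all add: quotientI)
  ultimately have "R `` {f} = R `` {\<lambda>_. y}"
    by (auto simp: is_singleton_def)
  moreover have "(\<lambda>_. y) \<in> R `` {\<lambda>_. y}"
    using y by (simp add: R_def)
  ultimately have "homotopic_with (\<lambda>h. h nsphere_base = y) (nsphere i) Y f (\<lambda>_. y)"
    by (auto simp: R_def)
  then have "homotopic_with (\<lambda>_. True) (nsphere i) Y f (\<lambda>_. y)"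
    by (rule homotopic_with_mono) simp
  then show ?thesis
    using y by (rule bexI)
qed

text \<open>
  Free null-homotopies are enough: one of them extends \<open>f\<close> to the ball, by the cone coordinates
  \<open>1 - norm\<close> and direction. Composing with the contraction of the sphere to the base point along
  chords of the ball gives a homotopy that fixes the base point.
\<close>

lemma trivial_if_nullhomotopic:
  assumes null: "\<And>f. continuous_map (nsphere i) Y f \<Longrightarrow> \<exists>c. homotopic_with (\<lambda>_. True) (nsphere i) Y f (\<lambda>_. c)"
  shows "trivial_homotopy_group i Y"
proof -
  have based: "homotopic_with (\<lambda>h. h nsphere_base = y) (nsphere i) Y f (\<lambda>_. y)"
    if f: "continuous_map (nsphere i) Y f" "f nsphere_base = y" for f y
  proof -
    let ?I = "top_of_set {0..1::real}"
    obtain c H where H: "continuous_map (prod_topology ?I (nsphere i)) Y H"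
      "\<And>x. H (0, x) = f x" "\<And>x. H (1, x) = c"
      using null [OF f(1)] by (auto simp: homotopic_with_def)
    have c: "c \<in> topspace Y"
    proof -
      have "(1, nsphere_base) \<in> topspace (prod_topology ?I (nsphere i))"
        using nsphere_base_in by simp
      then show ?thesis
        using H(1,3) by (metis PiE continuous_map_funspace)
    qed
    let ?X = "prod_topology ?I (nsphere i)"
    \<comment> \<open>The point on the chord from \<open>snd z\<close> to the base point at time
      \<open>fst z\<close>, and its Euclidean norm.\<close>
    define q where "q z j = (1 - fst z) * snd z j + fst z * nsphere_base j" for z :: "real \<times> (nat \<Rightarrow> real)" and j
    define N where "N z = sqrt (\<Sum>j\<le>i. (q z j)\<^sup>2)" for z
    have cq: "continuous_map ?X euclideanreal (\<lambda>z. q z j)" for j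
    proof -
      have "continuous_map ?X euclideanreal fst"
        using continuous_map_fst [of ?I "nsphere i"] continuous_map_in_subtopology by blast
      moreover have "continuous_map ?X euclideanreal (\<lambda>z. snd z j)"
        using continuous_map_compose [OF continuous_map_snd continuous_map_nsphere_projection, of ?I i j]
        by (simp add: comp_def)
      ultimately show ?thesis
        unfolding q_def by (intro continuous_intros)
    qed
    have cN: "continuous_map ?X euclideanreal N"
    proof -
      have "continuous_map ?X euclideanreal (\<lambda>z. \<Sum>j\<le>i. (q z j)\<^sup>2)"
        by (intro continuous_intros cq) auto
      from continuous_map_compose [OF this, of euclideanreal sqrt] show ?thesis
        by (simp add: comp_def continuous_on_real_sqrt N_def [abs_def])
    qed
    have N_le: "N z \<le> 1" if z: "z \<in> topspace ?X" for z
    proof -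
      have "N z = L2_set (\<lambda>j. (1 - fst z) * snd z j + fst z * nsphere_base j) {..i}"
        by (simp add: N_def q_def L2_set_def)
      also have "\<dots> \<le> L2_set (\<lambda>j. (1 - fst z) * snd z j) {..i} + L2_set (\<lambda>j. fst z * nsphere_base j) {..i}"
        by (rule L2_set_triangle_ineq)
      also have "\<dots> = (1 - fst z) * L2_set (snd z) {..i} + fst z * L2_set nsphere_base {..i}"
        using z by (simp add: L2_set_right_distrib mem_Times_iff)
      also have "\<dots> = 1"
        using z nsphere_base_in [of i] by (auto simp: L2_set_def nsphere)
      finally show ?thesis .
    qed
    define G where "G = (\<lambda>z. if 1 - N z < 1 then H (1 - N z, normalize2 i (q z)) else c)"
    have "continuous_map ?X Y G"
      unfolding G_def
    proof (rule continuous_map_cone [OF H(1) H(3) compact_space_nsphere c])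
      show "continuous_map ?X euclideanreal (\<lambda>z. 1 - N z)"
        by (intro continuous_intros cN)
      show "0 \<le> 1 - N z" if "z \<in> topspace ?X" for z
        using N_le [OF that] by simp
      show "1 - N z \<le> 1" for z
        by (simp add: N_def sum_nonneg)
      show "continuous_map (subtopology ?X {z \<in> topspace ?X. 1 - N z < 1}) (nsphere i) (\<lambda>z. normalize2 i (q z))"
        by (rule continuous_map_normalize2) (auto intro: continuous_map_from_subtopology cq simp: N_def)
    qed
    moreover have unit: "G z = f (q z)" if "q z \<in> topspace (nsphere i)" for z
    proof -
      have "N z = 1"
        using that by (simp add: N_def nsphere)
      then show ?thesis
        using that by (simp add: G_def H normalize2_id)
    qed
    have "G (0, x) = f x" if "x \<in> topspace (nsphere i)" for x
    proof -
      have "q (0, x) = x"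
        by (simp add: q_def fun_eq_iff)
      then show ?thesis
        using unit [of "(0, x)"] that by simp
    qed
    moreover have "G (1, x) = y" for x
    proof -
      have "q (1, x) = nsphere_base"
        by (simp add: q_def fun_eq_iff)
      then show ?thesis
        using unit [of "(1, x)"] nsphere_base_in f(2) by simp
    qed
    moreover have "G (t, nsphere_base) = y" for t
    proof -
      have "q (t, nsphere_base) = nsphere_base"
        by (simp add: q_def fun_eq_iff algebra_simps)
      then show ?thesis
        using unit [of "(t, nsphere_base)"] nsphere_base_in f(2) by simp
    qed
    ultimately show ?thesis
      using nsphere_base_in by (subst homotopic_with) (auto intro!: exI [of _ G])
  qed
  show ?thesis
    unfolding trivial_homotopy_group_def
  proof
    fix y assume y: "y \<in> topspace Y"
    define S where "S = {f. continuous_map (nsphere i) Y f \<and> f nsphere_base = y}"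
    define R where "R = {(f, g). homotopic_with (\<lambda>h. h nsphere_base = y) (nsphere i) Y f g}"
    have "R `` {f} = R `` {\<lambda>_. y}" if "f \<in> S" for f
    proof -
      have f: "homotopic_with (\<lambda>h. h nsphere_base = y) (nsphere i) Y f (\<lambda>_. y)"
        using based [of f y] that by (simp add: S_def)
      have "homotopic_with (\<lambda>h. h nsphere_base = y) (nsphere i) Y f g
          \<longleftrightarrow> homotopic_with (\<lambda>h. h nsphere_base = y) (nsphere i) Y (\<lambda>_. y) g" for g
        by (rule iffI, rule homotopic_with_trans [OF homotopic_with_symD [OF f]], assumption,
            rule homotopic_with_trans [OF f])
      then show ?thesis
        by (simp add: R_def)
    qed
    moreover have "(\<lambda>_. y) \<in> S"
      using y by (simp add: S_def)
    ultimately have "S // R = {R `` {\<lambda>_. y}}"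
      unfolding quotient_def by blast
    then show "is_singleton (homotopy_group_set i Y y)"
      by (simp add: homotopy_group_set_def S_def R_def)
  qed
qed


lemma continuous_map_Min:
  assumes "finite S" "S \<noteq> {}" "\<And>k. k \<in> S \<Longrightarrow> continuous_map X euclideanreal (\<lambda>x. f x k)"
  shows "continuous_map X euclideanreal (\<lambda>x. Min (f x ` S))"
  using assms
proof (induction S rule: finite_ne_induct)
  case (insert k S)
  then show ?case
    by (auto simp: Min_insert intro!: continuous_map_real_min)
qed simp

text \<open>
  The boundary of a simplex with \<open>d + 2\<close> vertices is a \<open>d\<close>-sphere. Differences
  \<open>q\<close> of barycentric coordinates identify the simplex with a convex body around the origin, the
  image of the barycentre. The map \<open>a\<close> sends a direction \<open>y\<close> to the boundary point
  in this direction, and \<open>d + 2\<close> times the smallest barycentric coordinate is \<open>1\<close> at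
  the barycentre and \<open>0\<close> on the boundary. A null-homotopy of \<open>f \<circ> a\<close>, in these
  cone coordinates, is the extension.
\<close>

lemma extend_over_simplex:
  fixes \<tau> :: "'a set"
  assumes "finite \<tau>" and card: "card \<tau> = d + 2" and triv: "trivial_homotopy_group d Y"
    and f: "\<And>v. v \<in> \<tau> \<Longrightarrow> continuous_map (subtopology (powertop_real UNIV) (closed_simplex (\<tau> - {v}))) Y f"
  shows "\<exists>F. continuous_map (subtopology (powertop_real UNIV) (closed_simplex \<tau>)) Y F \<and>
      (\<forall>v\<in>\<tau>. \<forall>p\<in>closed_simplex (\<tau> - {v}). F p = f p)"
proof -
  note [simp del] = sum.atMost_Suc
  let ?I = "{..Suc d}"
  define n where "n = real (d + 2)"
  have n: "n > 0" and cardI: "real (card ?I) = n"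
    by (simp_all add: n_def)
  obtain h where h: "bij_betw h ?I \<tau>"
    using ex_bij_betw_nat_finite [OF \<open>finite \<tau>\<close>] card by (auto simp: atLeast0LessThan lessThan_Suc_atMost)
  define idx where "idx = the_inv_into ?I h"
  have idx: "idx v \<in> ?I" "h (idx v) = v" if "v \<in> \<tau>" for v
    using h that the_inv_into_into [of h ?I v ?I] f_the_inv_into_f [of h ?I v]
    by (simp_all add: idx_def bij_betw_def)
  have idx_h: "idx (h k) = k" if "k \<in> ?I" for k
    using h that by (auto simp: idx_def bij_betw_def the_inv_into_f_f)
  have hin: "h k \<in> \<tau>" if "k \<in> ?I" for k
    using h that by (auto simp: bij_betw_def)
  have sum_h: "(\<Sum>v\<in>\<tau>. g v) = (\<Sum>k\<in>?I. g (h k))" for g :: "'a \<Rightarrow> real"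
    by (rule sum.reindex_bij_betw [OF h, symmetric])
  define D where "D y k = y k - (\<Sum>j\<in>?I. y j) / n" for y :: "nat \<Rightarrow> real" and k
  define mD where "mD y = Min (D y ` ?I)" for y
  define a where "a y v = (if v \<in> \<tau> then 1 / n + D y (idx v) / (n * (- mD y)) else 0)" for y v
  have sumD: "(\<Sum>k\<in>?I. D y k) = 0" for y
    using n cardI by (simp add: D_def sum_subtractf)
  have mD_le: "mD y \<le> D y k" if "k \<in> ?I" for y k
    using that by (simp add: mD_def)
  have mD_attained: "\<exists>k\<in>?I. mD y = D y k" for y
  proof -
    have "mD y \<in> D y ` ?I"
      unfolding mD_def by (rule Min_in) auto
    then show ?thesis by blast
  qed
  have mD_neg: "mD y < 0" if y: "y \<in> topspace (nsphere d)" for y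
  proof (rule ccontr)
    assume "\<not> mD y < 0"
    then have "0 \<le> D y k" if "k \<in> ?I" for k
      using mD_le [OF that, of y] by simp
    then have D0: "D y k = 0" if "k \<in> ?I" for k
      using sumD [of y] that sum_nonneg_eq_0_iff [of ?I "D y", OF finite_atMost] by blast
    have yk: "y k = y (Suc d)" if "k \<in> ?I" for k
    proof -
      have "D y k = D y (Suc d)"
        using D0 [OF that] D0 [of "Suc d"] by simp
      then show ?thesis
        by (simp add: D_def)
    qed
    have "y i = 0" if "i \<le> d" for i
      using y yk [of i] that by (simp add: nsphere)
    then have "(\<Sum>i\<le>d. (y i)\<^sup>2) = 0"
      by simp
    then show False
      using y by (simp add: nsphere)
  qed
  have a_simplex: "\<exists>v\<in>\<tau>. a y \<in> closed_simplex (\<tau> - {v})" if y: "y \<in> topspace (nsphere d)" for y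
  proof -
    note neg = mD_neg [OF y]
    obtain k where k: "k \<in> ?I" "mD y = D y k"
      using mD_attained by blast
    have nonneg: "0 \<le> a y v" for v
    proof (cases "v \<in> \<tau>")
      case True
      have "- 1 \<le> D y (idx v) / (- mD y)"
        using neg mD_le [OF idx(1) [OF True], of y] by (simp add: field_simps)
      then have "- 1 / n \<le> D y (idx v) / (- mD y) / n"
        using n by (intro divide_right_mono) auto
      then show ?thesis
        using True by (simp add: a_def mult.commute)
    qed (simp add: a_def)
    have "(\<Sum>v\<in>\<tau>. a y v) = (\<Sum>j\<in>?I. 1 / n + D y j / (n * (- mD y)))"
      unfolding sum_h using hin idx_h by (intro sum.cong) (simp_all add: a_def)
    also have "\<dots> = (\<Sum>j\<in>?I. 1 / n) + (\<Sum>j\<in>?I. D y j) / (n * (- mD y))"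
      by (simp only: sum.distrib sum_divide_distrib)
    also have "\<dots> = 1"
      using n cardI by (simp add: sumD)
    finally have sum1: "(\<Sum>v\<in>\<tau>. a y v) = 1" .
    have zero: "a y (h k) = 0"
      using k neg n hin idx_h by (simp add: a_def field_simps)
    have "(\<Sum>v\<in>\<tau> - {h k}. a y v) = 1"
      using sum1 zero hin [OF k(1)] \<open>finite \<tau>\<close> by (simp add: sum_diff1)
    then have "a y \<in> closed_simplex (\<tau> - {h k})"
      using nonneg zero by (auto simp: closed_simplex_def a_def)
    then show ?thesis
      using hin k by blast
  qed
  have cD: "continuous_map (nsphere d) euclideanreal (\<lambda>y. D y k)" for k
    unfolding D_def using n
    by (intro continuous_intros continuous_map_nsphere_projection) auto
  have cmD: "continuous_map (nsphere d) euclideanreal mD"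
    unfolding mD_def [abs_def] by (rule continuous_map_Min) (auto intro: cD)
  have ca: "continuous_map (nsphere d) (powertop_real UNIV) a"
  proof -
    have "continuous_map (nsphere d) euclideanreal (\<lambda>y. a y v)" for v
    proof (cases "v \<in> \<tau>")
      case True
      have "n * (- mD y) \<noteq> 0" if "y \<in> topspace (nsphere d)" for y
        using mD_neg [OF that] n by simp
      then have "continuous_map (nsphere d) euclideanreal (\<lambda>y. 1 / n + D y (idx v) / (n * (- mD y)))"
        by (intro continuous_intros cD cmD)
      then show ?thesis
        using True by (simp add: a_def)
    qed (simp add: a_def)
    then show ?thesis
      by (simp add: continuous_map_componentwise_UNIV)
  qed
  \<comment> \<open>The preimages of the facets form a finite closed cover of the sphere, and \<open>f\<close>
    is continuous on each facet.\<close>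
  define T where "T v = {y \<in> topspace (nsphere d). a y \<in> closed_simplex (\<tau> - {v})}" for v
  have "continuous_map (nsphere d) Y (f \<circ> a)"
  proof (rule pasting_lemma_closed [where I = \<tau> and T = T and f = "\<lambda>_. f \<circ> a"])
    show "closedin (nsphere d) (T v)" for v
      unfolding T_def by (rule closedin_continuous_map_preimage [OF ca closedin_closed_simplex])
    show "continuous_map (subtopology (nsphere d) (T v)) Y (f \<circ> a)" if "v \<in> \<tau>" for v
    proof (rule continuous_map_compose [OF _ f [OF that]])
      show "continuous_map (subtopology (nsphere d) (T v))
          (subtopology (powertop_real UNIV) (closed_simplex (\<tau> - {v}))) a"
        unfolding continuous_map_in_subtopology
        by (auto intro: continuous_map_from_subtopology [OF ca] simp: T_def)
    qed
    show "\<exists>v. v \<in> \<tau> \<and> y \<in> T v \<and> (f \<circ> a) y = (f \<circ> a) y" if "y \<in> topspace (nsphere d)" for y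
      using a_simplex [OF that] that by (auto simp: T_def)
  qed (use \<open>finite \<tau>\<close> in auto)
  from nullhomotopic_if_trivial [OF triv this] obtain c H where c: "c \<in> topspace Y"
    and H: "continuous_map (prod_topology (top_of_set {0..1::real}) (nsphere d)) Y H"
      "\<And>y. H (0, y) = f (a y)" "\<And>y. H (1, y) = c"
    by (auto simp: homotopic_with_def)
  define X where "X = subtopology (powertop_real UNIV) (closed_simplex \<tau>)"
  define q where "q p j = p (h j) - p (h (Suc d))" for p :: "'a \<Rightarrow> real" and j
  define t where "t p = n * Min ((\<lambda>k. p (h k)) ` ?I)" for p :: "'a \<Rightarrow> real"
  define F where "F p = (if t p < 1 then H (t p, normalize2 d (q p)) else c)" for p
  have coordX: "continuous_map X euclideanreal (\<lambda>p. p v)" for v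
    unfolding X_def by (intro continuous_map_from_subtopology continuous_map_product_projection) simp
  have topX: "topspace X = closed_simplex \<tau>"
    by (simp add: X_def)
  have sum1: "(\<Sum>k\<in>?I. p (h k)) = 1" if "p \<in> closed_simplex \<tau>" for p
    using that by (simp add: closed_simplex_def sum_h)
  have t0: "0 \<le> t p" if "p \<in> closed_simplex \<tau>" for p
    using that n by (simp add: t_def closed_simplex_def)
  have t1: "t p \<le> 1" if p: "p \<in> closed_simplex \<tau>" for p
  proof -
    have "t p = (\<Sum>k\<in>?I. Min ((\<lambda>k. p (h k)) ` ?I))"
      using cardI by (simp add: t_def)
    also have "\<dots> \<le> (\<Sum>k\<in>?I. p (h k))"
      by (rule sum_mono) simp
    finally show ?thesis
      using sum1 [OF p] by simp
  qed
  have qpos: "(\<Sum>i\<le>d. (q p i)\<^sup>2) > 0" if p: "p \<in> closed_simplex \<tau>" and "t p < 1" for p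
  proof (rule ccontr)
    assume "\<not> ?thesis"
    moreover have "0 \<le> (\<Sum>i\<le>d. (q p i)\<^sup>2)"
      by (rule sum_nonneg) simp
    ultimately have "(\<Sum>i\<le>d. (q p i)\<^sup>2) = 0"
      by simp
    then have "\<forall>i\<le>d. p (h i) = p (h (Suc d))"
      by (simp add: sum_nonneg_eq_0_iff q_def)
    then have eq: "p (h k) = p (h (Suc d))" if "k \<in> ?I" for k
      using that by (cases "k = Suc d") auto
    have "(\<Sum>k\<in>?I. p (h k)) = (\<Sum>k\<in>?I. p (h (Suc d)))"
      by (rule sum.cong [OF refl eq])
    then have "n * p (h (Suc d)) = 1"
      using sum1 [OF p] cardI by simp
    moreover have "(\<lambda>k. p (h k)) ` ?I = (\<lambda>k. p (h (Suc d))) ` ?I"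
      by (rule image_cong [OF refl eq])
    ultimately show False
      using \<open>t p < 1\<close> by (simp add: t_def)
  qed
  have "continuous_map X Y F"
    unfolding F_def [abs_def]
  proof (rule continuous_map_cone [OF H(1) H(3) compact_space_nsphere c])
    show "continuous_map X euclideanreal t"
      unfolding t_def by (intro continuous_intros continuous_map_Min coordX) auto
    show "continuous_map (subtopology X {p \<in> topspace X. t p < 1}) (nsphere d) (\<lambda>p. normalize2 d (q p))"
    proof (rule continuous_map_normalize2)
      show "continuous_map (subtopology X {p \<in> topspace X. t p < 1}) euclideanreal (\<lambda>p. q p j)" for j
        unfolding q_def by (intro continuous_intros continuous_map_from_subtopology coordX)
    qed (use qpos topX in auto)
  qed (use t0 t1 topX in auto)
  moreover have "F p = f p" if v: "v \<in> \<tau>" and pv: "p \<in> closed_simplex (\<tau> - {v})" for v p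
  proof -
    have "(\<Sum>w\<in>\<tau>. p w) = 1"
      using pv v \<open>finite \<tau>\<close> by (simp add: closed_simplex_def sum.remove [of \<tau> v])
    then have p: "p \<in> closed_simplex \<tau>"
      using pv by (auto simp: closed_simplex_def)
    have p0: "0 \<le> p w" for w
      using p by (simp add: closed_simplex_def)
    have pv0: "p (h (idx v)) = 0"
      using pv idx(2) [OF v] by (simp add: closed_simplex_def)
    have "Min ((\<lambda>k. p (h k)) ` ?I) = 0"
      using p0 pv0 idx(1) [OF v] by (intro Min_eqI) (auto intro: rev_image_eqI)
    then have tp: "t p = 0"
      by (simp add: t_def)
    define r where "r = sqrt (\<Sum>i\<le>d. (q p i)\<^sup>2)"
    have r: "r > 0"
      using qpos [OF p] tp by (simp add: r_def)
    \<comment> \<open>For \<open>p\<close> on the boundary, \<open>a\<close> recovers \<open>p\<close> from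
      its direction.\<close>
    define y where "y = normalize2 d (q p)"
    have y: "y k = q p k / r" if "k \<in> ?I" for k
      using that by (cases "k = Suc d") (auto simp: y_def normalize2_def r_def q_def)
    have sumq: "(\<Sum>k\<in>?I. q p k) = 1 - n * p (h (Suc d))"
      using sum1 [OF p] cardI by (simp add: q_def sum_subtractf)
    have Dy: "D y k = (p (h k) - 1 / n) / r" if "k \<in> ?I" for k
    proof -
      have "(\<Sum>j\<in>?I. y j) = (1 - n * p (h (Suc d))) / r"
        using y by (simp add: sumq [symmetric] sum_divide_distrib)
      then have "D y k = (p (h k) - p (h (Suc d))) / r - (1 - n * p (h (Suc d))) / r / n"
        using y [OF that] by (simp add: D_def q_def)
      also have "\<dots> = (p (h k) - 1 / n) / r"
        using n r by (simp add: field_simps)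
      finally show ?thesis .
    qed
    have mDy: "mD y = - 1 / (n * r)"
      unfolding mD_def
    proof (rule Min_eqI)
      show "finite (D y ` ?I)" by simp
      show "- 1 / (n * r) \<le> x" if x: "x \<in> D y ` ?I" for x
      proof -
        obtain k where k: "k \<in> ?I" "x = D y k"
          using x by blast
        have "x - - 1 / (n * r) = p (h k) / r"
          using r n by (simp add: k Dy [OF k(1)] field_simps)
        also have "\<dots> \<ge> 0"
          using p0 r by simp
        finally show ?thesis by simp
      qed
      have "- 1 / (n * r) = D y (idx v)"
        using Dy [OF idx(1) [OF v]] pv0 by simp
      then show "- 1 / (n * r) \<in> D y ` ?I"
        using idx(1) [OF v] by blast
    qed
    have "a y = p"
    proof
      fix w
      show "a y w = p w"
      proof (cases "w \<in> \<tau>")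
        case True
        have "D y (idx w) = (p w - 1 / n) / r"
          using Dy [OF idx(1) [OF True]] idx(2) [OF True] by simp
        then show ?thesis
          using True n r by (simp add: a_def mDy field_simps)
      qed (use p in \<open>simp add: a_def closed_simplex_def\<close>)
    qed
    then show ?thesis
      using tp by (simp add: F_def H(2) y_def)
  qed
  ultimately show ?thesis
    unfolding X_def by blast
qed


section \<open>From homotopy to homology\<close>

definition simplicial_complex :: "'a set set \<Rightarrow> bool" where
  "simplicial_complex K \<longleftrightarrow>
     (\<forall>\<sigma>\<in>K. finite \<sigma> \<and> \<sigma> \<noteq> {} \<and> (\<forall>\<tau>. \<tau> \<subseteq> \<sigma> \<and> \<tau> \<noteq> {} \<longrightarrow> \<tau> \<in> K))"

lemma simplicial_complex_face:
  "simplicial_complex K \<Longrightarrow> \<sigma> \<in> K \<Longrightarrow> \<tau> \<subseteq> \<sigma> \<Longrightarrow> \<tau> \<noteq> {} \<Longrightarrow> \<tau> \<in> K"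
  unfolding simplicial_complex_def by blast

lemma simplicial_complex_finite: "simplicial_complex K \<Longrightarrow> \<sigma> \<in> K \<Longrightarrow> finite \<sigma>"
  unfolding simplicial_complex_def by blast

definition supp :: "('a \<Rightarrow> real) \<Rightarrow> 'a set" where
  "supp p = {v. p v \<noteq> 0}"

lemma closed_simplex_empty [simp]: "closed_simplex {} = {}"
  by (simp add: closed_simplex_def)

lemma supp_subset: "p \<in> closed_simplex \<sigma> \<Longrightarrow> supp p \<subseteq> \<sigma>"
  by (auto simp: closed_simplex_def supp_def)

lemma closed_simplex_iff_supp:
  assumes "p \<in> closed_simplex \<sigma>" "finite \<sigma>" "finite \<tau>"
  shows "p \<in> closed_simplex \<tau> \<longleftrightarrow> supp p \<subseteq> \<tau>"
proof
  assume sub: "supp p \<subseteq> \<tau>"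
  have "(\<Sum>v\<in>\<tau>. p v) = (\<Sum>v\<in>supp p. p v)"
    using sub assms by (intro sum.mono_neutral_right) (auto simp: supp_def)
  also have "\<dots> = (\<Sum>v\<in>\<sigma>. p v)"
    using supp_subset [OF assms(1)] assms by (intro sum.mono_neutral_left) (auto simp: supp_def)
  finally show "p \<in> closed_simplex \<tau>"
    using assms sub by (auto simp: closed_simplex_def supp_def)
qed (rule supp_subset)

lemma supp_nonempty: "p \<in> closed_simplex \<sigma> \<Longrightarrow> supp p \<noteq> {}"
proof
  assume "p \<in> closed_simplex \<sigma>" "supp p = {}"
  then have "(\<Sum>v\<in>\<sigma>. p v) = 1" "\<And>v. p v = 0"
    by (auto simp: closed_simplex_def supp_def)
  then show False by simp
qed

lemma supp_in_complex:
  assumes "simplicial_complex K" "p \<in> topspace (geometric_realization K)"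
  shows "supp p \<in> K" "p \<in> closed_simplex (supp p)" "finite (supp p)"
proof -
  obtain \<sigma> where \<sigma>: "\<sigma> \<in> K" "p \<in> closed_simplex \<sigma>"
    using assms(2) by (auto simp: topspace_geometric_realization)
  then show 1: "supp p \<in> K"
    by (intro simplicial_complex_face [OF assms(1) \<sigma>(1)] supp_subset supp_nonempty)
  then show fin: "finite (supp p)"
    by (rule simplicial_complex_finite [OF assms(1)])
  show "p \<in> closed_simplex (supp p)"
    using closed_simplex_iff_supp [OF \<sigma>(2) simplicial_complex_finite [OF assms(1) \<sigma>(1)] fin] by simp
qed

text \<open>
  A vertex with the largest barycentric coordinate. This coordinate is bounded below in terms of the number of
  vertices, so the vertex remains in the support of all points that are close enough.
\<close>

definition top_vertex :: "('a \<Rightarrow> real) \<Rightarrow> 'a" where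
  "top_vertex p = (SOME v. \<forall>w. p w \<le> p v)"

lemma top_vertex:
  assumes p: "p \<in> closed_simplex \<sigma>" and "finite \<sigma>"
  shows "p w \<le> p (top_vertex p)" "top_vertex p \<in> supp p" "top_vertex p \<in> \<sigma>" "1 / card \<sigma> \<le> p (top_vertex p)"
proof -
  have ne: "\<sigma> \<noteq> {}"
    using p by auto
  have "\<exists>v. \<forall>w. p w \<le> p v"
  proof -
    have "Max (p ` \<sigma>) \<in> p ` \<sigma>"
      using ne \<open>finite \<sigma>\<close> by simp
    then obtain v where v: "v \<in> \<sigma>" "Max (p ` \<sigma>) = p v"
      by (rule imageE)
    have "p w \<le> p v" for w
    proof (cases "w \<in> \<sigma>")
      case True
      then have "p w \<le> Max (p ` \<sigma>)"
        using \<open>finite \<sigma>\<close> by simp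
      then show ?thesis by (simp only: v(2))
    qed (use p in \<open>simp add: closed_simplex_def\<close>)
    then show ?thesis by blast
  qed
  then have max: "p w \<le> p (top_vertex p)" for w
    unfolding top_vertex_def using someI_ex [of "\<lambda>v. \<forall>w. p w \<le> p v"] by blast
  then show "p w \<le> p (top_vertex p)" .
  have "1 = (\<Sum>v\<in>\<sigma>. p v)"
    using p by (simp add: closed_simplex_def)
  also have "\<dots> \<le> card \<sigma> * p (top_vertex p)"
    using sum_bounded_above [of \<sigma> p] max by simp
  finally show le: "1 / card \<sigma> \<le> p (top_vertex p)"
    using ne \<open>finite \<sigma>\<close> by (simp add: field_simps card_gt_0_iff)
  moreover have "0 < 1 / real (card \<sigma>)"
    using ne \<open>finite \<sigma>\<close> by (simp add: card_gt_0_iff)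
  ultimately have "0 < p (top_vertex p)"
    by linarith
  then show "top_vertex p \<in> supp p"
    by (simp add: supp_def)
  then show "top_vertex p \<in> \<sigma>"
    using supp_subset [OF p] by blast
qed

text \<open>
  The identity on the simplices of \<open>K\<close> with vertices in \<open>N\<close> extends over the other
  simplices with vertices in \<open>N\<close>, in order of dimension. A point in the relative interior of a
  simplex is recognized by its support.
\<close>

lemma extend_to_skeleton:
  assumes K: "simplicial_complex K" and "finite N" and N: "\<And>v. v \<in> N \<Longrightarrow> {v} \<in> K"
    and triv: "\<And>i. i < j \<Longrightarrow> trivial_homotopy_group i (geometric_realization K)"
    and "k \<le> Suc j"
  shows "\<exists>r. \<forall>\<sigma>\<subseteq>N. card \<sigma> \<le> k \<longrightarrow>
      continuous_map (subtopology (powertop_real UNIV) (closed_simplex \<sigma>)) (geometric_realization K) r \<and>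
      (\<sigma> \<in> K \<longrightarrow> (\<forall>p\<in>closed_simplex \<sigma>. r p = p))"
  using \<open>k \<le> Suc j\<close>
proof (induction k)
  case 0
  show ?case
  proof (intro exI [of _ id] allI impI)
    fix \<sigma> assume "\<sigma> \<subseteq> N" "card \<sigma> \<le> 0"
    then have "\<sigma> = {}"
      using \<open>finite N\<close> finite_subset by fastforce
    then show "continuous_map (subtopology (powertop_real UNIV) (closed_simplex \<sigma>)) (geometric_realization K) id
        \<and> (\<sigma> \<in> K \<longrightarrow> (\<forall>p\<in>closed_simplex \<sigma>. id p = p))"
      by (simp add: continuous_map_def)
  qed
next
  case (Suc k)
  let ?S = "\<lambda>\<sigma>. subtopology (powertop_real UNIV) (closed_simplex \<sigma> :: ('a \<Rightarrow> real) set)"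
  let ?R = "geometric_realization K"
  obtain r where r: "\<And>\<sigma>. \<sigma> \<subseteq> N \<Longrightarrow> card \<sigma> \<le> k \<Longrightarrow> continuous_map (?S \<sigma>) ?R r"
    "\<And>\<sigma> p. \<sigma> \<subseteq> N \<Longrightarrow> card \<sigma> \<le> k \<Longrightarrow> \<sigma> \<in> K \<Longrightarrow> p \<in> closed_simplex \<sigma> \<Longrightarrow> r p = p"
    using Suc by (metis Suc_leD)
  have "\<exists>F. continuous_map (?S \<tau>) ?R F \<and> (\<tau> \<in> K \<longrightarrow> (\<forall>p\<in>closed_simplex \<tau>. F p = p)) \<and>
      (\<forall>v\<in>\<tau>. \<forall>p\<in>closed_simplex (\<tau> - {v}). F p = r p)"
    if \<tau>: "\<tau> \<subseteq> N" "card \<tau> = Suc k" for \<tau>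
  proof -
    have fin: "finite \<tau>"
      using \<tau> by (simp add: card_ge_0_finite)
    have facet: "\<tau> - {v} \<subseteq> N" "card (\<tau> - {v}) \<le> k" if "v \<in> \<tau>" for v
      using \<tau> fin that by auto
    show ?thesis
    proof (cases "\<tau> \<in> K")
      case True
      have coord: "continuous_map (?S \<tau>) euclideanreal (\<lambda>p. p v)" for v
        by (intro continuous_map_from_subtopology continuous_map_product_projection) simp
      have "continuous_map (?S \<tau>) ?R (\<lambda>p. p)"
        by (rule continuous_map_into_realization [of "{\<tau>}"]) (use True coord in auto)
      moreover have "r p = p" if v: "v \<in> \<tau>" and p: "p \<in> closed_simplex (\<tau> - {v})" for v p
      proof -
        have "\<tau> - {v} \<noteq> {}"
          using p by (metis closed_simplex_empty empty_iff)
        then have "\<tau> - {v} \<in> K"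
          by (intro simplicial_complex_face [OF K True]) auto
        then show ?thesis
          using r(2) [OF facet [OF v]] p by simp
      qed
      ultimately show ?thesis
        by (intro exI [of _ "\<lambda>p. p"]) auto
    next
      case False
      have "k \<noteq> 0"
      proof
        assume "k = 0"
        then obtain v where "\<tau> = {v}"
          using \<tau>(2) by (auto simp: card_1_singleton_iff)
        then show False
          using False \<tau> N by simp
      qed
      then obtain d where d: "k = Suc d"
        by (auto simp: gr0_conv_Suc)
      have "\<exists>F. continuous_map (?S \<tau>) ?R F \<and> (\<forall>v\<in>\<tau>. \<forall>p\<in>closed_simplex (\<tau> - {v}). F p = r p)"
      proof (rule extend_over_simplex [OF fin])
        show "card \<tau> = d + 2"
          using \<tau> d by simp
        show "trivial_homotopy_group d ?R"
          using d Suc.prems by (intro triv) simp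
        show "continuous_map (?S (\<tau> - {v})) ?R r" if "v \<in> \<tau>" for v
          by (rule r(1) [OF facet [OF that]])
      qed
      then show ?thesis
        using False by blast
    qed
  qed
  then have "\<exists>F. \<forall>\<tau>\<in>{\<tau>. \<tau> \<subseteq> N \<and> card \<tau> = Suc k}.
      continuous_map (?S \<tau>) ?R (F \<tau>) \<and> (\<tau> \<in> K \<longrightarrow> (\<forall>p\<in>closed_simplex \<tau>. F \<tau> p = p)) \<and>
      (\<forall>v\<in>\<tau>. \<forall>p\<in>closed_simplex (\<tau> - {v}). F \<tau> p = r p)"
    by (intro bchoice) simp
  then obtain F where F': "\<forall>\<tau>\<in>{\<tau>. \<tau> \<subseteq> N \<and> card \<tau> = Suc k}.
      continuous_map (?S \<tau>) ?R (F \<tau>) \<and> (\<tau> \<in> K \<longrightarrow> (\<forall>p\<in>closed_simplex \<tau>. F \<tau> p = p)) \<and>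
      (\<forall>v\<in>\<tau>. \<forall>p\<in>closed_simplex (\<tau> - {v}). F \<tau> p = r p)" ..
  have F: "continuous_map (?S \<tau>) ?R (F \<tau>)"
      "\<And>p. \<tau> \<in> K \<Longrightarrow> p \<in> closed_simplex \<tau> \<Longrightarrow> F \<tau> p = p"
      "\<And>v p. v \<in> \<tau> \<Longrightarrow> p \<in> closed_simplex (\<tau> - {v}) \<Longrightarrow> F \<tau> p = r p"
    if "\<tau> \<subseteq> N" "card \<tau> = Suc k" for \<tau>
    using bspec [OF F', of \<tau>] that by simp_all
  define r' where "r' p = (if card (supp p) \<le> k then r p else F (supp p) p)" for p
  have low: "r' p = r p" if "\<sigma> \<subseteq> N" "card \<sigma> \<le> k" "p \<in> closed_simplex \<sigma>" for \<sigma> p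
  proof -
    have "card (supp p) \<le> card \<sigma>"
      using supp_subset [OF that(3)] that(1) \<open>finite N\<close> by (meson card_mono finite_subset)
    then show ?thesis
      using that(2) by (simp add: r'_def)
  qed
  have high: "r' p = F \<tau> p" if \<tau>: "\<tau> \<subseteq> N" "card \<tau> = Suc k" and p: "p \<in> closed_simplex \<tau>" for \<tau> p
  proof (cases "supp p = \<tau>")
    case True
    then show ?thesis
      using \<tau>(2) by (simp add: r'_def)
  next
    case False
    have fin: "finite \<tau>"
      using \<tau> by (simp add: card_ge_0_finite)
    obtain v where v: "v \<in> \<tau>" "supp p \<subseteq> \<tau> - {v}"
      using False supp_subset [OF p] by blast
    then have pv: "p \<in> closed_simplex (\<tau> - {v})"
      using closed_simplex_iff_supp [OF p fin] fin by simp
    have "r' p = r p"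
      using \<tau> v fin by (intro low [OF _ _ pv]) auto
    then show ?thesis
      using F(3) [OF \<tau> v(1) pv] by simp
  qed
  have "continuous_map (?S \<sigma>) ?R r' \<and> (\<sigma> \<in> K \<longrightarrow> (\<forall>p\<in>closed_simplex \<sigma>. r' p = p))"
    if \<sigma>: "\<sigma> \<subseteq> N" "card \<sigma> \<le> Suc k" for \<sigma>
  proof (cases "card \<sigma> = Suc k")
    case True
    have "continuous_map (?S \<sigma>) ?R r'"
      by (rule continuous_map_eq [OF F(1) [OF \<sigma>(1) True]]) (use high [OF \<sigma>(1) True] in simp)
    moreover have "r' p = p" if "\<sigma> \<in> K" "p \<in> closed_simplex \<sigma>" for p
      using high [OF \<sigma>(1) True that(2)] F(2) [OF \<sigma>(1) True that] by simp
    ultimately show ?thesis by auto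
  next
    case False
    then have k: "card \<sigma> \<le> k"
      using \<sigma> by simp
    have "continuous_map (?S \<sigma>) ?R r'"
      by (rule continuous_map_eq [OF r(1) [OF \<sigma>(1) k]]) (use low [OF \<sigma>(1) k] in simp)
    moreover have "r' p = p" if "\<sigma> \<in> K" "p \<in> closed_simplex \<sigma>" for p
      using low [OF \<sigma>(1) k that(2)] r(2) [OF \<sigma>(1) k that] by simp
    ultimately show ?thesis by auto
  qed
  then show ?case
    by (intro exI [of _ r'] allI impI)
qed


text \<open>
  The passage from homotopy to homology, by simplicial approximation. A cycle \<open>z\<close> of
  \<open>K\<close> is the boundary of a cone \<open>u0\<close> in the full simplex on its vertices, and the
  simplices of this cone are mapped into the realization of \<open>K\<close> by an extension \<open>r\<close>
  of the identity. If \<open>u0\<close> is subdivided finely enough and each point \<open>p\<close> is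
  labelled by the top vertex of \<open>r p\<close>, the labels of a small simplex lie in the support of a
  single point, so the labelled chain is a chain of \<open>K\<close>. On \<open>z\<close> itself the labelling
  is Sperner's, hence the boundary of that chain is \<open>z\<close>.
\<close>

theorem acyclic_if_homotopy_trivial:
  fixes K :: "'a set set"
  assumes K: "simplicial_complex K" and ne: "K \<noteq> {}"
    and triv: "\<And>i. i < j \<Longrightarrow> trivial_homotopy_group i (geometric_realization K)"
  shows "acyclic_at K j"
  unfolding acyclic_at_def
proof (intro allI impI, elim conjE)
  fix z :: "'a set chain"
  assume keyz: "\<forall>s\<in>keys z. s \<in> insert {} K \<and> card s = j" and cyc: "lin bd z = 0"
  show "\<exists>u. (\<forall>s\<in>keys u. s \<in> K \<and> card s = Suc j) \<and> lin bd u = z"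
  proof (cases "z = 0")
    case True
    then show ?thesis by (intro exI [of _ 0]) simp
  next
    case False
    then have nez: "keys z \<noteq> {}"
      by simp
    show ?thesis
    proof (cases "j = 0")
      case True
      have "s = {}" if s: "s \<in> keys z" for s
      proof -
        have "finite s" "card s = 0"
          using keyz s True simplicial_complex_finite [OF K] by auto
        then show ?thesis by simp
      qed
      then have "keys z \<subseteq> {{}}"
        by (intro subsetI singletonI) (simp only: singleton_iff)
      with nez have "keys z = {{}}"
        by (simp only: subset_singleton_iff) simp
      then have z: "z = basis {}"
        using chain_eq_sum_basis [of z] by simp
      obtain \<sigma> where \<sigma>: "\<sigma> \<in> K"
        using ne by blast
      then have "\<sigma> \<noteq> {}"
        using bspec [OF K [unfolded simplicial_complex_def]] by simp
      then obtain v where "v \<in> \<sigma>"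
        by blast
      then have "{v} \<in> K"
        by (intro simplicial_complex_face [OF K \<sigma>]) auto
      then show ?thesis
        using z True by (intro exI [of _ "basis {v}"]) simp
    next
      case False
      have keyz': "s \<in> K" "card s = j" "finite s" if s: "s \<in> keys z" for s
      proof -
        show c: "card s = j"
          using keyz s by blast
        show "s \<in> K"
          using keyz s c False by (metis card.empty insertE)
        then show "finite s"
          by (rule simplicial_complex_finite [OF K])
      qed
      define N where "N = \<Union>(keys z)"
      have finN: "finite N"
        unfolding N_def using keyz'(3) by (intro finite_Union) auto
      have NK: "{v} \<in> K" if v: "v \<in> N" for v
      proof -
        obtain s where "s \<in> keys z" "v \<in> s"
          using v unfolding N_def by blast
        then show ?thesis
          by (intro simplicial_complex_face [OF K keyz'(1)]) auto
      qed
      have zN: "s \<subseteq> N" if "s \<in> keys z" for s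
        using that by (auto simp: N_def)
      obtain s0 where s0: "s0 \<in> keys z"
        using nez by blast
      then have "s0 \<noteq> {}"
        using keyz'(2) [OF s0] False by auto
      then obtain v0 where v0: "v0 \<in> N"
        using zN [OF s0] by blast
      have finz: "fin_chain z"
        using keyz'(3) by (simp add: fin_chain_def)
      define u0 where "u0 = lin (cone_at v0) z"
      have bdu0: "lin bd u0 = z"
        using cyc by (simp add: u0_def bd_cone [OF finz])
      have keyu0: "s \<subseteq> N" "card s = Suc j" if s: "s \<in> keys u0" for s
      proof -
        obtain t where t: "t \<in> keys z" "s \<in> keys (cone_at v0 t)"
          using s unfolding u0_def by (rule in_keys_linE)
        from t(2) have "v0 \<notin> t" "s = insert v0 t"
          by (auto elim: in_keys_coneE)
        then show "s \<subseteq> N" "card s = Suc j"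
          using v0 zN [OF t(1)] keyz'(2,3) [OF t(1)] by auto
      qed
      have finu0: "fin_chain u0"
        unfolding u0_def using finz by (rule fin_chain_cone)
      let ?R = "geometric_realization K"
      let ?S = "\<lambda>\<sigma>. subtopology (powertop_real UNIV) (closed_simplex \<sigma> :: ('a \<Rightarrow> real) set)"
      obtain r where r: "\<And>\<sigma>. \<sigma> \<subseteq> N \<Longrightarrow> card \<sigma> \<le> Suc j \<Longrightarrow> continuous_map (?S \<sigma>) ?R r"
        and rid: "\<And>\<sigma> p. \<sigma> \<subseteq> N \<Longrightarrow> card \<sigma> \<le> Suc j \<Longrightarrow> \<sigma> \<in> K \<Longrightarrow> p \<in> closed_simplex \<sigma> \<Longrightarrow> r p = p"
        using extend_to_skeleton [OF K finN NK triv order_refl, of j] by auto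
      define SS where "SS = {\<sigma>. \<sigma> \<subseteq> N \<and> card \<sigma> \<le> Suc j}"
      have finSS: "finite SS"
        unfolding SS_def using finN by simp
      have SSfin: "finite \<sigma>" if "\<sigma> \<in> SS" for \<sigma>
        using that finN by (auto simp: SS_def intro: finite_subset)
      define C where "C = (\<Union>\<sigma>\<in>SS. r ` closed_simplex \<sigma>)"
      have "compactin ?R C"
        unfolding C_def
      proof (rule compactin_Union)
        show "finite ((\<lambda>\<sigma>. r ` closed_simplex \<sigma>) ` SS)"
          using finSS by simp
        show "compactin ?R S" if S: "S \<in> (\<lambda>\<sigma>. r ` closed_simplex \<sigma>) ` SS" for S
        proof -
          obtain \<sigma> where \<sigma>: "\<sigma> \<in> SS" "S = r ` closed_simplex \<sigma>"
            using S by blast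
          have "compactin (?S \<sigma>) (closed_simplex \<sigma>)"
            using compactin_closed_simplex [OF SSfin [OF \<sigma>(1)]] by (simp add: compactin_subtopology)
          then show ?thesis
            unfolding \<sigma>(2) using \<sigma>(1) by (intro image_compactin [OF _ r [of \<sigma>]]) (auto simp: SS_def)
        qed
      qed
      then have Ctop: "C \<subseteq> topspace ?R"
        by (rule compactin_subset_topspace)
      define N' where "N' = {v. \<exists>p\<in>C. p v \<noteq> 0}"
      have finN': "finite N'"
        unfolding N'_def using simplicial_complex_finite [OF K] \<open>compactin ?R C\<close>
        by (rule finite_vertices_of_compact)
      have rC: "r p \<in> C" if "\<sigma> \<in> SS" "p \<in> closed_simplex \<sigma>" for \<sigma> p
        using that by (auto simp: C_def)
      have suppC: "supp p \<subseteq> N'" if "p \<in> C" for p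
        using that by (auto simp: N'_def supp_def)
      have CN': "p \<in> closed_simplex N'" if p: "p \<in> C" for p
        using supp_in_complex [OF K subsetD [OF Ctop p]] suppC [OF p]
          closed_simplex_iff_supp [of p "supp p" N'] finN' by simp
      have "N' \<noteq> {}"
      proof -
        have "{v0} \<in> SS"
          using v0 by (simp add: SS_def)
        moreover have "vertex_pt v0 \<in> closed_simplex {v0}"
          by (simp add: vertex_pt_in)
        ultimately show ?thesis
          using CN' [OF rC] closed_simplex_empty by (metis empty_iff)
      qed
      \<comment> \<open>A top vertex has at least this coordinate at any point of \<open>C\<close>, so a
        smaller change cannot remove it from the support.\<close>
      let ?e = "1 / real (card N')"
      have "\<exists>d>0. \<forall>a\<in>SS \<times> N'. \<forall>x\<in>topspace (?S (fst a)). \<forall>y\<in>topspace (?S (fst a)).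
          (\<forall>w\<in>N. \<bar>x w - y w\<bar> < d) \<longrightarrow> \<bar>r x (snd a) - r y (snd a)\<bar> < ?e"
      proof (rule equicontinuous_family)
        show "finite (SS \<times> N')" "finite N"
          using finSS finN' finN by simp_all
        show "0 < ?e"
          using \<open>N' \<noteq> {}\<close> finN' by (simp add: card_gt_0_iff)
      next
        fix a assume "a \<in> SS \<times> N'"
        then have \<sigma>: "fst a \<in> SS" by auto
        show "compact_space (?S (fst a))"
          using compactin_closed_simplex [OF SSfin [OF \<sigma>]] by (rule compact_space_subtopology)
        show "continuous_map (?S (fst a)) euclideanreal (\<lambda>x. x w)" for w
          by (intro continuous_map_from_subtopology continuous_map_product_projection) simp
        show "continuous_map (?S (fst a)) euclideanreal (\<lambda>x. r x (snd a))"
          using \<sigma> by (intro continuous_map_into_realization_coord [OF r]) (auto simp: SS_def)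
        show "r x (snd a) = r y (snd a)"
          if "x \<in> topspace (?S (fst a))" "y \<in> topspace (?S (fst a))" "\<And>w. w \<in> N \<Longrightarrow> x w = y w" for x y
        proof -
          have "x w = y w" for w
          proof (cases "w \<in> N")
            case False
            then have "w \<notin> fst a"
              using \<sigma> by (auto simp: SS_def)
            then show ?thesis
              using that(1,2) by (simp add: closed_simplex_def)
          qed (use that(3) in simp)
          then have "x = y" by (rule ext)
          then show ?thesis by simp
        qed
      qed
      then obtain \<epsilon> where "\<epsilon> > 0" and \<epsilon>: "\<And>\<sigma> v x y. \<sigma> \<in> SS \<Longrightarrow> v \<in> N' \<Longrightarrow> x \<in> closed_simplex \<sigma> \<Longrightarrow>
          y \<in> closed_simplex \<sigma> \<Longrightarrow> (\<And>w. \<bar>x w - y w\<bar> < \<epsilon>) \<Longrightarrow> \<bar>r x v - r y v\<bar> < ?e"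
        by force
      define \<psi> where "\<psi> p = top_vertex (r p)" for p
      have "\<exists>m. (1 - 1 / real (Suc j)) ^ m < \<epsilon>"
        using \<open>\<epsilon> > 0\<close> by (intro real_arch_pow_inv) simp_all
      then obtain m where m: "(1 - 1 / real (Suc j)) ^ m < \<epsilon>" ..
      define u1 where "u1 = lin (push vertex_pt) u0"
      define U where "U = (lin sd ^^ m) u1"
      define u where "u = lin (push \<psi>) U"
      have finu1: "fin_chain u1"
        unfolding u1_def using finu0 by (rule fin_chain_push)
      have keyu1: "\<exists>\<sigma>\<in>keys u0. s = vertex_pt ` \<sigma>" if s: "s \<in> keys u1" for s
        using s unfolding u1_def by (auto elim!: in_keys_linE in_keys_pushE)
      have keyU: "card t = Suc j \<and> (\<exists>\<sigma>\<in>SS. t \<subseteq> closed_simplex \<sigma>) \<and> (\<forall>p\<in>t. \<forall>q\<in>t. \<forall>v. \<bar>p v - q v\<bar> < \<epsilon>)"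
        if t: "t \<in> keys U" for t
      proof -
        have "card s \<le> Suc j" if s: "s \<in> keys u1" for s
          using keyu1 [OF s] keyu0(2) by (auto simp: card_image inj_on_subset [OF inj_vertex_pt])
        moreover have "\<bar>p v - q v\<bar> \<le> 1" if s: "s \<in> keys u1" "p \<in> s" "q \<in> s" for s p q v
          using keyu1 [OF s(1)] s(2,3) by (auto simp: vertex_pt_def)
        ultimately obtain s where s: "s \<in> keys u1" "card t = card s"
          "\<forall>C. avg_closed C \<and> s \<subseteq> C \<longrightarrow> t \<subseteq> C"
          "\<forall>p\<in>t. \<forall>q\<in>t. \<forall>v. \<bar>p v - q v\<bar> \<le> (1 - 1 / real (Suc j)) ^ m * 1"
          using sdn_keys [OF finu1 t [unfolded U_def], of "Suc j" 1] by blast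
        obtain \<sigma> where \<sigma>: "\<sigma> \<in> keys u0" "s = vertex_pt ` \<sigma>"
          using keyu1 [OF s(1)] by blast
        have "card t = Suc j"
          using s(2) \<sigma> keyu0(2) [OF \<sigma>(1)] by (simp add: card_image inj_on_subset [OF inj_vertex_pt])
        moreover have \<sigma>SS: "\<sigma> \<in> SS"
          using keyu0 [OF \<sigma>(1)] by (simp add: SS_def)
        moreover have "s \<subseteq> closed_simplex \<sigma>"
          using vertex_pt_in [OF SSfin [OF \<sigma>SS]] \<sigma>(2) by auto
        then have "t \<subseteq> closed_simplex \<sigma>"
          using s(3) avg_closed_closed_simplex by blast
        moreover have "\<forall>p\<in>t. \<forall>q\<in>t. \<forall>v. \<bar>p v - q v\<bar> < \<epsilon>"
          using s(4) m unfolding mult_1_right by (meson order_le_less_trans)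
        ultimately show ?thesis by blast
      qed
      have "s \<in> K \<and> card s = Suc j" if s: "s \<in> keys u" for s
      proof -
        obtain t where t: "t \<in> keys U" "s \<in> keys (push \<psi> t)"
          using s unfolding u_def by (rule in_keys_linE)
        from t(2) have inj: "inj_on \<psi> t" and st: "s = \<psi> ` t"
          by (auto elim: in_keys_pushE)
        obtain \<sigma> where \<sigma>: "\<sigma> \<in> SS" "t \<subseteq> closed_simplex \<sigma>"
          and close: "\<And>p q v. p \<in> t \<Longrightarrow> q \<in> t \<Longrightarrow> \<bar>p v - q v\<bar> < \<epsilon>" and cardt: "card t = Suc j"
          using keyU [OF t(1)] by blast
        obtain x where x: "x \<in> t"
          using cardt by (metis card.empty ex_in_conv nat.distinct(1))
        have "\<psi> y \<in> supp (r x)" if y: "y \<in> t" for y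
        proof -
          have ry: "r y \<in> C"
            by (rule rC [OF \<sigma>(1)]) (use y \<sigma>(2) in blast)
          note tv = top_vertex [OF CN' [OF ry] finN']
          have "\<psi> y \<in> N'"
            using tv(3) by (simp add: \<psi>_def)
          have "\<bar>r x (\<psi> y) - r y (\<psi> y)\<bar> < ?e"
            by (rule \<epsilon> [OF \<sigma>(1) \<open>\<psi> y \<in> N'\<close>]) (use x y \<sigma>(2) close in auto)
          moreover have "?e \<le> r y (\<psi> y)"
            using tv(4) by (simp add: \<psi>_def)
          ultimately show ?thesis
            by (auto simp: supp_def)
        qed
        then have "s \<subseteq> supp (r x)"
          unfolding st by blast
        moreover have "supp (r x) \<in> K"
        proof (rule supp_in_complex(1) [OF K])
          have "r x \<in> C"
            by (rule rC [OF \<sigma>(1)]) (use x \<sigma>(2) in blast)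
          then show "r x \<in> topspace ?R"
            using Ctop by blast
        qed
        moreover have "s \<noteq> {}"
          using x st by blast
        ultimately have "s \<in> K"
          using simplicial_complex_face [OF K] by blast
        then show ?thesis
          using st inj cardt by (simp add: card_image)
      qed
      moreover have "lin bd u = z"
      proof -
        have "lin bd u = lin (push \<psi>) ((lin sd ^^ m) (lin (push vertex_pt) z))"
          unfolding u_def U_def u1_def
          by (simp only: bd_push bd_sdn bdu0 fin_chain_sdn fin_chain_push finu0)
        also have "\<dots> = lin (\<lambda>s. lin (push \<psi>) ((lin sd ^^ m) (push vertex_pt s))) z"
          by (simp add: sdn_lin lin_lin)
        also have "\<dots> = lin basis z"
        proof (rule lin_cong)
          fix s assume s: "s \<in> keys z"
          show "lin (push \<psi>) ((lin sd ^^ m) (push vertex_pt s)) = basis s"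
          proof (rule sperner [OF keyz'(3) [OF s]])
            fix \<tau> p assume \<tau>: "\<tau> \<subseteq> s" and p: "p \<in> closed_simplex \<tau>"
            have fin\<tau>: "finite \<tau>"
              using \<tau> keyz'(3) [OF s] by (rule finite_subset)
            have "\<tau> \<in> K"
              using p by (intro simplicial_complex_face [OF K keyz'(1) [OF s] \<tau>]) auto
            moreover have "card \<tau> \<le> Suc j"
              using card_mono [OF keyz'(3) [OF s] \<tau>] keyz'(2) [OF s] by simp
            ultimately have "r p = p"
              using \<tau> zN [OF s] p by (intro rid [of \<tau>]) auto
            then show "\<psi> p \<in> \<tau>"
              using top_vertex(3) [OF p fin\<tau>] by (simp add: \<psi>_def)
          qed
        qed
        also have "\<dots> = z"
          by (rule lin_basis_id)
        finally show ?thesis .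
      qed
      ultimately show ?thesis by blast
    qed
  qed
qed


section \<open>Complexes with a full skeleton\<close>

lemma continuous_map_Max:
  assumes "finite S" "S \<noteq> {}" "\<And>k. k \<in> S \<Longrightarrow> continuous_map X euclideanreal (\<lambda>x. f x k)"
  shows "continuous_map X euclideanreal (\<lambda>x. Max (f x ` S))"
  using assms
proof (induction S rule: finite_ne_induct)
  case (insert k S)
  then show ?case
    by (auto simp: Max_insert intro!: continuous_map_real_max)
qed simp

lemma closed_simplex_mono:
  assumes "p \<in> closed_simplex \<sigma>" "\<sigma> \<subseteq> \<tau>" "finite \<tau>"
  shows "p \<in> closed_simplex \<tau>"
  using closed_simplex_iff_supp [OF assms(1) finite_subset [OF assms(2,3)] assms(3)]
    supp_subset [OF assms(1)] assms(2) by blast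

lemma closed_simplex_convex:
  assumes "p \<in> closed_simplex \<sigma>" "q \<in> closed_simplex \<sigma>" "0 \<le> t" "t \<le> 1"
  shows "(\<lambda>v. (1 - t) * p v + t * q v) \<in> closed_simplex \<sigma>"
  using assms by (auto simp: closed_simplex_def sum.distrib simp flip: sum_distrib_left)

lemma straight_line_homotopy:
  assumes "finite F" "F \<subseteq> K"
    and F: "\<And>x. x \<in> topspace X \<Longrightarrow> \<exists>\<sigma>\<in>F. g x \<in> closed_simplex \<sigma> \<and> h x \<in> closed_simplex \<sigma>"
    and g: "\<And>v. continuous_map X euclideanreal (\<lambda>x. g x v)"
    and h: "\<And>v. continuous_map X euclideanreal (\<lambda>x. h x v)"
  shows "homotopic_with (\<lambda>_. True) X (geometric_realization K) g h"
proof -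
  let ?P = "prod_topology (top_of_set {0..1::real}) X"
  define H where "H z v = (1 - fst z) * g (snd z) v + fst z * h (snd z) v" for z :: "real \<times> _" and v
  have "continuous_map ?P (geometric_realization K) H"
  proof (rule continuous_map_into_realization [OF assms(1,2)])
    fix z assume z: "z \<in> topspace ?P"
    then obtain \<sigma> where "\<sigma> \<in> F" "g (snd z) \<in> closed_simplex \<sigma>" "h (snd z) \<in> closed_simplex \<sigma>"
      using F [of "snd z"] by auto
    then show "\<exists>\<sigma>\<in>F. H z \<in> closed_simplex \<sigma>"
      using closed_simplex_convex [of "g (snd z)" \<sigma> "h (snd z)" "fst z"] z
      by (auto simp: H_def [abs_def])
  next
    fix v
    have "continuous_map ?P euclideanreal fst"
      using continuous_map_fst [of "top_of_set {0..1::real}" X] continuous_map_in_subtopology by blast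
    moreover have "continuous_map ?P euclideanreal (\<lambda>z. g (snd z) v)" "continuous_map ?P euclideanreal (\<lambda>z. h (snd z) v)"
      using continuous_map_compose [OF continuous_map_snd g] continuous_map_compose [OF continuous_map_snd h]
      by (simp_all add: comp_def)
    ultimately show "continuous_map ?P euclideanreal (\<lambda>z. H z v)"
      unfolding H_def by (intro continuous_intros)
  qed
  moreover have "H (0, x) = g x" "H (1, x) = h x" for x
    by (simp_all add: H_def [abs_def])
  ultimately show ?thesis
    unfolding homotopic_with_def by (intro exI [of _ H]) simp
qed

text \<open>
  The grid points \<open>p\<close> in question are among the vertices of the simplex of the Freudenthal
  triangulation that contains \<open>y\<close>, the additional coordinate \<open>Suc i\<close> being
  constantly \<open>0\<close>. Each coordinate of \<open>p\<close> is that of \<open>y\<close> rounded down or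
  up. The coordinates \<open>T p\<close> that are rounded up form an upper set with respect to the fractional
  parts, so these sets are nested and \<open>p\<close> is determined by the size of \<open>T p\<close>. An
  integral coordinate is never rounded up, which leaves \<open>Suc i\<close> possible sizes.
\<close>

lemma grid_star_card:
  fixes y :: "nat \<Rightarrow> real" and A :: "(nat \<Rightarrow> int) set"
  assumes y0: "y (Suc i) = 0" and j0: "j0 \<le> i" "y j0 \<in> \<int>"
    and zero: "\<And>p j. p \<in> A \<Longrightarrow> i < j \<Longrightarrow> p j = 0"
    and close: "\<And>p j k. p \<in> A \<Longrightarrow> j \<le> Suc i \<Longrightarrow> k \<le> Suc i \<Longrightarrow> (y j - p j) - (y k - p k) < 1"
  shows "finite A \<and> card A \<le> Suc i"
proof -
  define T where "T p = {j \<in> {..i}. y j - real_of_int (p j) < 0}" for p :: "nat \<Rightarrow> int"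
  have finT: "finite (T p)" for p
    by (simp add: T_def)
  have bound: "y j - p j < 1" "- 1 < y j - p j" if "p \<in> A" "j \<le> i" for p j
    using close [OF that(1), of j "Suc i"] close [OF that(1), of "Suc i" j] that(2) zero [OF that(1), of "Suc i"] y0
    by simp_all
  have pj: "p j = \<lfloor>y j\<rfloor> + (if j \<in> T p then 1 else 0)" if "p \<in> A" "j \<le> i" for p j
  proof (cases "j \<in> T p")
    case True
    then have "\<lfloor>y j\<rfloor> = p j - 1"
      using bound [OF that] by (intro floor_unique) (auto simp: T_def)
    then show ?thesis using True by simp
  next
    case False
    then have "\<lfloor>y j\<rfloor> = p j"
      using bound [OF that] that(2) by (intro floor_unique) (auto simp: T_def)
    then show ?thesis using False by simp
  qed
  have sep: "frac (y k) < frac (y j)" if "p \<in> A" "j \<in> T p" "k \<le> i" "k \<notin> T p" for p j k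
  proof -
    have ji: "j \<le> i" using that(2) by (simp add: T_def)
    have "(y k - p k) - (y j - p j) < 1"
      using close [OF that(1), of k j] ji that(3) by simp
    then show ?thesis
      using pj [OF that(1) ji] pj [OF that(1,3)] that(2,4) by (simp add: frac_def)
  qed
  have chain: "T p \<subseteq> T p' \<or> T p' \<subseteq> T p" if "p \<in> A" "p' \<in> A" for p p'
  proof (rule ccontr)
    assume "\<not> ?thesis"
    then obtain j k where jk: "j \<in> T p" "j \<notin> T p'" "k \<in> T p'" "k \<notin> T p"
      by blast
    then have "j \<le> i" "k \<le> i"
      by (simp_all add: T_def)
    then show False
      using sep [OF that(1) jk(1) _ jk(4)] sep [OF that(2) jk(3) _ jk(2)] by simp
  qed
  have inj: "inj_on (\<lambda>p. card (T p)) A"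
  proof (rule inj_onI)
    fix p p' assume pp: "p \<in> A" "p' \<in> A" and card: "card (T p) = card (T p')"
    have "T p = T p'"
      using chain [OF pp] card card_subset_eq [OF finT, of "T p" p'] card_subset_eq [OF finT, of "T p'" p]
      by auto
    show "p = p'"
    proof
      fix j
      show "p j = p' j"
      proof (cases "j \<le> i")
        case True
        then show ?thesis
          using pj [OF pp(1) True] pj [OF pp(2) True] \<open>T p = T p'\<close> by simp
      qed (use zero [OF pp(1), of j] zero [OF pp(2), of j] in \<open>simp add: not_le\<close>)
    qed
  qed
  have sub: "(\<lambda>p. card (T p)) ` A \<subseteq> {..i}"
  proof -
    have "card (T p) \<le> i" if "p \<in> A" for p
    proof -
      have "j0 \<notin> T p"
      proof
        assume T: "j0 \<in> T p"
        obtain n where n: "y j0 = of_int n"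
          using j0(2) by (rule Ints_cases)
        have "real_of_int n < real_of_int (p j0)" "real_of_int (p j0) < real_of_int (n + 1)"
          using T bound(2) [OF that j0(1)] n by (simp_all add: T_def)
        then show False
          by (simp only: of_int_less_iff)
      qed
      then have "T p \<subseteq> {..i} - {j0}"
        by (auto simp: T_def)
      then have "card (T p) \<le> card ({..i} - {j0})"
        by (intro card_mono) auto
      also have "\<dots> = i"
        using j0(1) by simp
      finally show ?thesis .
    qed
    then show ?thesis by auto
  qed
  have "finite A"
    using inj sub by (meson finite_atMost finite_imageD finite_subset)
  moreover have "card A \<le> card {..i}"
    by (rule card_inj_on_le [OF inj sub]) simp
  ultimately show ?thesis by simp
qed

text \<open>
  A map \<open>f\<close> from the \<open>i\<close>-sphere is first moved into the \<open>i\<close>-skeleton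
  and then to a vertex. The sphere is projected to the surface of a cube, on which the open stars of a fine
  grid form a cover such that no point lies in more than \<open>i + 1\<close> of its sets. Each of these stars
  chooses a top vertex of some value of \<open>f\<close> on it. A partition of unity then gives a map
  \<open>g\<close> that stays in the closed simplices carrying the values of \<open>f\<close> and uses at most
  \<open>i + 1\<close> vertices at a time. Together with one more fixed vertex these still form a simplex, so
  straight lines contract \<open>g\<close>.
\<close>

theorem homotopy_trivial_if_full_skeleton:
  assumes K: "simplicial_complex K"
    and full: "\<And>\<sigma>. finite \<sigma> \<Longrightarrow> \<sigma> \<noteq> {} \<Longrightarrow> \<sigma> \<subseteq> \<Union>K \<Longrightarrow> card \<sigma> \<le> i + 2 \<Longrightarrow> \<sigma> \<in> K"
  shows "trivial_homotopy_group i (geometric_realization K)"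
proof (rule trivial_if_nullhomotopic)
  let ?R = "geometric_realization K"
  let ?S = "topspace (nsphere i)"
  fix f assume f: "continuous_map (nsphere i) ?R f"
  have fcoord: "continuous_map (nsphere i) euclideanreal (\<lambda>x. f x v)" for v
    using f by (rule continuous_map_into_realization_coord)
  define C where "C = f ` ?S"
  have C: "compactin ?R C"
    unfolding C_def using compact_space_nsphere [of i]
    by (intro image_compactin [OF _ f]) (simp add: compact_space_def)
  define N where "N = {v. \<exists>p\<in>C. p v \<noteq> 0}"
  have finN: "finite N"
    unfolding N_def using simplicial_complex_finite [OF K] C by (rule finite_vertices_of_compact)
  have fR: "f x \<in> topspace ?R" if "x \<in> ?S" for x
    using f that by (auto simp: continuous_map_def)
  note suppK = supp_in_complex [OF K fR]
  have suppN: "supp (f x) \<subseteq> N" if "x \<in> ?S" for x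
    using that by (auto simp: N_def C_def supp_def)
  have fN: "f x \<in> closed_simplex N" if "x \<in> ?S" for x
    by (rule closed_simplex_mono [OF suppK(2) [OF that] suppN [OF that] finN])
  note tv = top_vertex [OF fN finN]
  have NK: "N \<subseteq> \<Union>K"
  proof
    fix v assume "v \<in> N"
    then obtain x where "x \<in> ?S" "v \<in> supp (f x)"
      by (auto simp: N_def C_def supp_def)
    then show "v \<in> \<Union>K"
      using suppK(1) by blast
  qed
  define v0 where "v0 = top_vertex (f nsphere_base)"
  have v0: "v0 \<in> N"
    unfolding v0_def by (rule tv(3) [OF nsphere_base_in])
  define e where "e = 1 / real (card N)"
  have e: "0 < e"
    using v0 finN by (auto simp: e_def card_gt_0_iff)
  \<comment> \<open>The factor \<open>1 / mx x\<close> projects the sphere radially to the surface of the cube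
    \<open>[-1, 1]\<close> to the power \<open>i + 1\<close>, where some coordinate is \<open>1\<close> or
    \<open>-1\<close>. Grid coordinates being multiples of \<open>1 / L\<close>, this coordinate is then
    integral after scaling by \<open>L\<close>.\<close>
  define mx where "mx x = Max ((\<lambda>j. \<bar>x j\<bar>) ` {..i})" for x :: "nat \<Rightarrow> real"
  define q where "q x j = x j / mx x" for x :: "nat \<Rightarrow> real" and j
  have mx_le: "\<bar>x j\<bar> \<le> mx x" if "j \<le> i" for x j
    using that by (simp add: mx_def)
  have mx_attained: "\<exists>j\<le>i. mx x = \<bar>x j\<bar>" for x
  proof -
    have "mx x \<in> (\<lambda>j. \<bar>x j\<bar>) ` {..i}"
      unfolding mx_def by (rule Max_in) auto
    then show ?thesis by auto
  qed
  have mx_pos: "0 < mx x" if x: "x \<in> ?S" for x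
  proof (rule ccontr)
    assume "\<not> 0 < mx x"
    then have "x j = 0" if "j \<le> i" for j
      using mx_le [OF that, of x] by simp
    then have "(\<Sum>j\<le>i. (x j)\<^sup>2) = 0"
      by simp
    then show False
      using x by (simp add: nsphere)
  qed
  have cmx: "continuous_map (nsphere i) euclideanreal mx"
    unfolding mx_def [abs_def]
    by (rule continuous_map_Max) (auto intro!: continuous_intros continuous_map_nsphere_projection)
  have mx_nz: "mx x \<noteq> 0" if "x \<in> ?S" for x
    using mx_pos [OF that] by simp
  have cq: "continuous_map (nsphere i) euclideanreal (\<lambda>x. q x j)" for j
    unfolding q_def by (intro continuous_map_real_divide continuous_map_nsphere_projection cmx mx_nz)
  have q_le: "\<bar>q x j\<bar> \<le> 1" if "x \<in> ?S" "j \<le> i" for x j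
    using mx_pos [OF that(1)] mx_le [OF that(2), of x] by (simp add: q_def)
  have q_zero: "q x j = 0" if "x \<in> ?S" "i < j" for x j
    using that by (simp add: q_def nsphere)
  have q_inj: "x = y" if x: "x \<in> ?S" and y: "y \<in> ?S" and eq: "\<And>j. j \<in> {..i} \<Longrightarrow> q x j = q y j" for x y
  proof -
    have sq: "(mx x)\<^sup>2 * (\<Sum>j\<le>i. (q x j)\<^sup>2) = 1" if "x \<in> ?S" for x
    proof -
      have "(mx x)\<^sup>2 * (\<Sum>j\<le>i. (q x j)\<^sup>2) = (\<Sum>j\<le>i. (x j)\<^sup>2)"
        using mx_nz [OF that] by (simp add: sum_distrib_left q_def power_divide)
      then show ?thesis
        using that by (simp add: nsphere)
    qed
    have sumeq: "(\<Sum>j\<le>i. (q x j)\<^sup>2) = (\<Sum>j\<le>i. (q y j)\<^sup>2)"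
      by (rule sum.cong) (use eq in auto)
    then have "(mx x)\<^sup>2 = (mx y)\<^sup>2"
      using sq [OF x] sq [OF y] by (metis mult_cancel_right mult_zero_right zero_neq_one)
    then have mxeq: "mx x = mx y"
      using mx_pos [OF x] mx_pos [OF y] by (simp add: power2_eq_iff)
    show "x = y"
    proof
      fix j
      show "x j = y j"
      proof (cases "j \<le> i")
        case True
        then have "x j / mx x = y j / mx x"
          using eq [of j] mxeq by (simp add: q_def)
        then show ?thesis
          using mx_nz [OF x] by simp
      qed (use x y in \<open>simp add: nsphere\<close>)
    qed
  qed
  have "\<exists>d>0. \<forall>v\<in>N. \<forall>x\<in>?S. \<forall>y\<in>?S. (\<forall>j\<in>{..i}. \<bar>q x j - q y j\<bar> < d) \<longrightarrow> \<bar>f x v - f y v\<bar> < e"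
  proof (rule equicontinuous_family [OF finN _ e compact_space_nsphere cq _ fcoord])
    show "f x v = f y v" if "x \<in> ?S" "y \<in> ?S" "\<And>j. j \<in> {..i} \<Longrightarrow> q x j = q y j" for x y v
      using q_inj [OF that] by simp
  qed simp
  then obtain \<eta> where "\<eta> > 0"
    and \<eta>: "\<And>v x y. v \<in> N \<Longrightarrow> x \<in> ?S \<Longrightarrow> y \<in> ?S \<Longrightarrow> (\<And>j. j \<le> i \<Longrightarrow> \<bar>q x j - q y j\<bar> < \<eta>) \<Longrightarrow> \<bar>f x v - f y v\<bar> < e"
    by (metis atMost_iff)
  obtain L :: nat where L: "2 / \<eta> < real L"
    using reals_Archimedean2 by blast
  then have L0: "0 < real L"
    using \<open>\<eta> > 0\<close> by (meson divide_pos_pos order_less_trans zero_less_numeral)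
  have L\<eta>: "2 / real L < \<eta>"
    using L L0 \<open>\<eta> > 0\<close> by (simp add: field_simps)
  define P where "P = {p :: nat \<Rightarrow> int. (\<forall>j\<le>i. p j \<in> {- int L..int L}) \<and> (\<forall>j>i. p j = 0)}"
  have finP: "finite P"
  proof -
    have "P \<subseteq> {p. \<forall>j. (j \<in> {..i} \<longrightarrow> p j \<in> {- int L..int L}) \<and> (j \<notin> {..i} \<longrightarrow> p j = 0)}"
      by (auto simp: P_def)
    then show ?thesis
      by (rule finite_subset) (rule finite_set_of_finite_funs; simp)
  qed
  define u where "u x p j = real L * q x j - real_of_int (p j)" for x p j
  \<comment> \<open>Positive exactly on the open star of \<open>p\<close> in the Freudenthal triangulation of
    the grid. The values need not be barycentric coordinates, since \<open>g\<close> divides by their sum. The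
    indices run up to \<open>Suc i\<close>, where \<open>u x p\<close> vanishes on the sphere.\<close>
  define lam where "lam x p = (\<Prod>j\<le>Suc i. \<Prod>k\<le>Suc i. max 0 (1 - (u x p j - u x p k)))" for x p
  have lam_nonneg: "0 \<le> lam x p" for x p
    unfolding lam_def by (intro prod_nonneg) simp
  have lam_pos: "0 < lam x p \<longleftrightarrow> (\<forall>j\<le>Suc i. \<forall>k\<le>Suc i. u x p j - u x p k < 1)" for x p
  proof
    assume pos: "0 < lam x p"
    show "\<forall>j\<le>Suc i. \<forall>k\<le>Suc i. u x p j - u x p k < 1"
    proof (intro allI impI, rule ccontr)
      fix j k assume jk: "j \<le> Suc i" "k \<le> Suc i" "\<not> u x p j - u x p k < 1"
      then have zero: "(\<Prod>k\<le>Suc i. max 0 (1 - (u x p j - u x p k))) = 0"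
        by (intro prod_zero bexI [of _ k]) auto
      have "lam x p = 0"
        unfolding lam_def using jk(1) by (intro prod_zero bexI [of _ j] zero) simp_all
      then show False
        using pos by simp
    qed
  next
    assume less: "\<forall>j\<le>Suc i. \<forall>k\<le>Suc i. u x p j - u x p k < 1"
    show "0 < lam x p"
      unfolding lam_def
    proof (intro prod_pos)
      fix j k assume "j \<in> {..Suc i}" "k \<in> {..Suc i}"
      then have "u x p j - u x p k < 1"
        using less by blast
      then show "0 < max 0 (1 - (u x p j - u x p k))"
        by simp
    qed
  qed
  have clam: "continuous_map (nsphere i) euclideanreal (\<lambda>x. lam x p)" for p
    unfolding lam_def u_def by (intro continuous_intros cq) auto
  have u_bound: "\<bar>u x p j\<bar> < 1" if "x \<in> ?S" "p \<in> P" "0 < lam x p" "j \<le> i" for x p j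
  proof -
    have "u x p (Suc i) = 0"
      using that(1,2) by (simp add: u_def q_zero P_def)
    moreover have "u x p j - u x p (Suc i) < 1" "u x p (Suc i) - u x p j < 1"
      using that(3,4) unfolding lam_pos by auto
    ultimately show ?thesis by simp
  qed
  define Act where "Act x = {p \<in> P. 0 < lam x p}" for x
  have card_Act: "card (Act x) \<le> Suc i" if x: "x \<in> ?S" for x
  proof -
    obtain j0 where j0: "j0 \<le> i" "mx x = \<bar>x j0\<bar>"
      using mx_attained by blast
    then have "q x j0 = 1 \<or> q x j0 = - 1"
      using mx_pos [OF x] by (auto simp: q_def abs_if split: if_splits)
    then have "real L * q x j0 \<in> \<int>"
      by auto
    then have "finite (Act x) \<and> card (Act x) \<le> Suc i"
      using j0(1) q_zero [OF x]
      by (intro grid_star_card [of "\<lambda>j. real L * q x j" i j0]) (auto simp: Act_def P_def lam_pos u_def)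
    then show ?thesis by simp
  qed
  have Act_nonempty: "Act x \<noteq> {}" if x: "x \<in> ?S" for x
  proof -
    define p where "p j = \<lfloor>real L * q x j\<rfloor>" for j
    have p0: "p j = 0" if "i < j" for j
      using q_zero [OF x that] by (simp add: p_def)
    have "p j \<in> {- int L..int L}" if "j \<le> i" for j
    proof -
      have "\<bar>real L * q x j\<bar> \<le> real L * 1"
        unfolding abs_mult using q_le [OF x that] L0 by (intro mult_mono) auto
      then show ?thesis
        unfolding p_def by (auto simp: le_floor_iff abs_le_iff) linarith
    qed
    then have "p \<in> P"
      using p0 by (simp add: P_def)
    moreover have u01: "0 \<le> u x p j" "u x p j < 1" for j
      unfolding u_def p_def by linarith+
    have "u x p j - u x p k < 1" for j k
      using u01 [of j] u01 [of k] by linarith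
    then have "0 < lam x p"
      by (simp add: lam_pos)
    ultimately show ?thesis
      by (auto simp: Act_def)
  qed
  \<comment> \<open>Grid points near the cube need not lie on it, so a point of the sphere in the star of
    \<open>p\<close> represents \<open>p\<close>.\<close>
  define xs where "xs p = (SOME x. x \<in> ?S \<and> 0 < lam x p)" for p
  define \<phi> where "\<phi> p = top_vertex (f (xs p))" for p
  have \<phi>: "\<phi> p \<in> supp (f x)" if x: "x \<in> ?S" and p: "p \<in> Act x" for x p
  proof -
    have pP: "p \<in> P" "0 < lam x p"
      using p by (simp_all add: Act_def)
    have xs: "xs p \<in> ?S" "0 < lam (xs p) p"
      using someI [of "\<lambda>x. x \<in> ?S \<and> 0 < lam x p" x] x pP(2) by (auto simp: xs_def)
    have "\<bar>q x j - q (xs p) j\<bar> < \<eta>" if j: "j \<le> i" for j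
    proof -
      have "real L * (q x j - q (xs p) j) = u x p j - u (xs p) p j"
        by (simp add: u_def algebra_simps)
      moreover have "\<bar>u x p j - u (xs p) p j\<bar> < 2"
        using u_bound [OF x pP j] u_bound [OF xs(1) pP(1) xs(2) j] by linarith
      ultimately have "\<bar>real L * (q x j - q (xs p) j)\<bar> < 2"
        by simp
      then have "real L * \<bar>q x j - q (xs p) j\<bar> < 2"
        using L0 by (simp only: abs_mult abs_of_pos)
      then have "\<bar>q x j - q (xs p) j\<bar> < 2 / real L"
        using L0 by (simp add: field_simps)
      then show ?thesis
        using L\<eta> by linarith
    qed
    then have "\<bar>f x (\<phi> p) - f (xs p) (\<phi> p)\<bar> < e"
      using tv(3) [OF xs(1)] by (intro \<eta> x xs(1)) (simp_all add: \<phi>_def)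
    moreover have "e \<le> f (xs p) (\<phi> p)"
      using tv(4) [OF xs(1)] by (simp add: e_def \<phi>_def)
    ultimately show ?thesis
      by (auto simp: supp_def)
  qed
  define w where "w x = (\<Sum>p\<in>P. lam x p)" for x
  have w: "0 < w x" if x: "x \<in> ?S" for x
  proof -
    obtain p where "p \<in> P" "0 < lam x p"
      using Act_nonempty [OF x] by (auto simp: Act_def)
    then show ?thesis
      unfolding w_def using finP lam_nonneg by (intro sum_pos2 [of _ p]) auto
  qed
  define g where "g x v = (\<Sum>p\<in>P. lam x p * vertex_pt (\<phi> p) v) / w x" for x v
  have cg: "continuous_map (nsphere i) euclideanreal (\<lambda>x. g x v)" for v
  proof -
    have "w x \<noteq> 0" if "x \<in> ?S" for x
      using w [OF that] by simp
    then show ?thesis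
      unfolding g_def using finP
      by (intro continuous_map_real_divide continuous_intros clam) (simp_all add: w_def continuous_map_sum clam)
  qed
  define B where "B x = \<phi> ` Act x" for x
  have finB: "finite (B x)" for x
    using finP by (simp add: B_def Act_def)
  have gB: "g x \<in> closed_simplex (B x)" if x: "x \<in> ?S" for x
  proof -
    have "0 \<le> g x v" for v
      unfolding g_def using w [OF x] lam_nonneg
      by (intro divide_nonneg_pos sum_nonneg mult_nonneg_nonneg) (auto simp: vertex_pt_def)
    moreover have "g x v = 0" if "v \<notin> B x" for v
    proof -
      have "lam x p * vertex_pt (\<phi> p) v = 0" if "p \<in> P" for p
      proof (cases "0 < lam x p")
        case True
        then have "\<phi> p \<noteq> v"
          using \<open>v \<notin> B x\<close> \<open>p \<in> P\<close> by (auto simp: B_def Act_def)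
        then show ?thesis by (simp add: vertex_pt_def)
      next
        case False
        then have "lam x p = 0"
          using lam_nonneg [of x p] by simp
        then show ?thesis by simp
      qed
      then have "(\<Sum>p\<in>P. lam x p * vertex_pt (\<phi> p) v) = 0"
        by (rule sum.neutral [rule_format])
      then show ?thesis by (simp add: g_def)
    qed
    moreover have "(\<Sum>v\<in>B x. g x v) = 1"
    proof -
      have "(\<Sum>v\<in>B x. \<Sum>p\<in>P. lam x p * vertex_pt (\<phi> p) v) = (\<Sum>p\<in>P. lam x p * (\<Sum>v\<in>B x. vertex_pt (\<phi> p) v))"
        by (subst sum.swap) (simp add: sum_distrib_left)
      also have "\<dots> = (\<Sum>p\<in>P. lam x p)"
      proof (rule sum.cong)
        fix p assume p: "p \<in> P"
        show "lam x p * (\<Sum>v\<in>B x. vertex_pt (\<phi> p) v) = lam x p"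
        proof (cases "0 < lam x p")
          case True
          then have "\<phi> p \<in> B x"
            using p by (auto simp: B_def Act_def)
          then show ?thesis
            using finB by (simp add: vertex_pt_def)
        next
          case False
          then have "lam x p = 0"
            using lam_nonneg [of x p] by simp
          then show ?thesis by simp
        qed
      qed simp
      finally show ?thesis
        unfolding g_def using w [OF x] by (simp add: w_def flip: sum_divide_distrib)
    qed
    ultimately show ?thesis
      by (simp add: closed_simplex_def)
  qed
  have Bsupp: "B x \<subseteq> supp (f x)" if "x \<in> ?S" for x
    using \<phi> [OF that] by (auto simp: B_def)
  have BN: "B x \<subseteq> N" if "x \<in> ?S" for x
    using Bsupp [OF that] suppN [OF that] by blast
  have cardB: "card (B x) \<le> Suc i" if "x \<in> ?S" for x
  proof -
    have "card (B x) \<le> card (Act x)"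
      unfolding B_def using finP by (intro card_image_le) (simp add: Act_def)
    then show ?thesis
      using card_Act [OF that] by simp
  qed
  define F where "F = {\<sigma> \<in> K. \<sigma> \<subseteq> N}"
  have F: "finite F" "F \<subseteq> K"
    using finN by (auto simp: F_def)
  have "homotopic_with (\<lambda>_. True) (nsphere i) ?R f g"
  proof (rule straight_line_homotopy [OF F _ fcoord cg])
    fix x assume x: "x \<in> ?S"
    have "supp (f x) \<in> F"
      using suppK(1) [OF x] suppN [OF x] by (simp add: F_def)
    moreover have "g x \<in> closed_simplex (supp (f x))"
      by (rule closed_simplex_mono [OF gB [OF x] Bsupp [OF x] suppK(3) [OF x]])
    ultimately show "\<exists>\<sigma>\<in>F. f x \<in> closed_simplex \<sigma> \<and> g x \<in> closed_simplex \<sigma>"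
      using suppK(2) [OF x] by blast
  qed
  moreover have "homotopic_with (\<lambda>_. True) (nsphere i) ?R g (\<lambda>_. vertex_pt v0)"
  proof (rule straight_line_homotopy [OF F _ cg])
    fix x assume x: "x \<in> ?S"
    let ?\<sigma> = "insert v0 (B x)"
    have "card ?\<sigma> \<le> i + 2"
      using cardB [OF x] finB [of x] by (simp add: card_insert_if)
    then have "?\<sigma> \<in> K"
      using finB [of x] BN [OF x] v0 NK by (intro full) auto
    then have "?\<sigma> \<in> F"
      using BN [OF x] v0 by (simp add: F_def)
    moreover have "g x \<in> closed_simplex ?\<sigma>"
      by (rule closed_simplex_mono [OF gB [OF x]]) (use finB [of x] in auto)
    moreover have "vertex_pt v0 \<in> closed_simplex ?\<sigma>"
      using finB [of x] by (intro vertex_pt_in) auto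
    ultimately show "\<exists>\<sigma>\<in>F. g x \<in> closed_simplex \<sigma> \<and> vertex_pt v0 \<in> closed_simplex \<sigma>"
      by blast
  qed simp
  ultimately have "homotopic_with (\<lambda>_. True) (nsphere i) ?R f (\<lambda>_. vertex_pt v0)"
    by (rule homotopic_with_trans)
  then show "\<exists>c. homotopic_with (\<lambda>_. True) (nsphere i) ?R f (\<lambda>_. c)"
    by (intro exI [of _ "vertex_pt v0"])
qed


section \<open>The Cech complex of the sphere\<close>

lemma simplicial_complex_nbhd_complex: "simplicial_complex (nbhd_complex V E)"
  unfolding simplicial_complex_def
proof (intro ballI conjI allI impI)
  fix \<sigma> assume \<sigma>: "\<sigma> \<in> nbhd_complex V E"
  then show fin: "finite \<sigma>" and "\<sigma> \<noteq> {}"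
    by (simp_all add: nbhd_complex_def)
  fix \<tau> assume \<tau>: "\<tau> \<subseteq> \<sigma> \<and> \<tau> \<noteq> {}"
  then have "finite \<tau>"
    using fin finite_subset by blast
  moreover have "\<exists>z\<in>V. \<forall>x\<in>\<tau>. E z x" "\<tau> \<subseteq> V"
    using \<sigma> \<tau> unfolding nbhd_complex_def by blast+
  ultimately show "\<tau> \<in> nbhd_complex V E"
    using \<tau> by (simp add: nbhd_complex_def)
qed

lemma uminus_in_sphere: "x \<in> sphere_pts n \<Longrightarrow> - x \<in> sphere_pts n"
  by (simp add: sphere_pts_eq)

lemma geodesic_dist_uminus:
  assumes "x \<in> sphere_pts n" "y \<in> sphere_pts n"
  shows "geodesic_dist n x (- y) = pi - geodesic_dist n x y"
proof -
  have "geodesic_dist n x (- y) = arccos (- (\<Sum>i\<le>n. x i * y i))"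
    using assms uminus_in_sphere [OF assms(2)] by (simp add: geodesic_dist_def sum_negf)
  then show ?thesis
    using assms sphere_inner_le_1 [OF assms] by (simp add: geodesic_dist_def arccos_minus abs_le_iff)
qed

context
  fixes n :: nat and \<delta> :: real
  assumes \<delta>: "0 < \<delta>" "\<delta> < pi"
begin

interpretation S: Metric_space "sphere_pts n" "geodesic_dist n"
  by (rule Metric_space_sphere)

abbreviation cech :: "(nat \<Rightarrow> real) set set" where
  "cech \<equiv> S.cech_complex (pi - \<delta>)"

lemma sphere_pts_nonempty: "sphere_pts n \<noteq> {}"
  using nsphere_base_in by blast

text \<open>
  The balls of radius \<open>pi - \<delta>\<close> around a set of points have \<open>z\<close> in common iff
  all these points are further than \<open>\<delta>\<close> from the antipode \<open>- z\<close>.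
\<close>

lemma cech_eq_nbhd_complex:
  "cech = nbhd_complex (sphere_pts n) (\<lambda>x y. \<delta> < geodesic_dist n x y)"
proof -
  have "(\<Inter>x\<in>\<sigma>. S.mball x (pi - \<delta>)) \<noteq> {} \<longleftrightarrow> (\<exists>z\<in>sphere_pts n. \<forall>x\<in>\<sigma>. \<delta> < geodesic_dist n z x)"
    if \<sigma>: "\<sigma> \<noteq> {}" "\<sigma> \<subseteq> sphere_pts n" for \<sigma>
  proof
    assume "(\<Inter>x\<in>\<sigma>. S.mball x (pi - \<delta>)) \<noteq> {}"
    then obtain z where z: "\<And>x. x \<in> \<sigma> \<Longrightarrow> z \<in> S.mball x (pi - \<delta>)"
      by blast
    then have zS: "z \<in> sphere_pts n"
      using \<sigma> by (metis S.in_mball ex_in_conv)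
    have "\<delta> < geodesic_dist n (- z) x" if "x \<in> \<sigma>" for x
      using z [OF that] geodesic_dist_uminus [of x n z] \<sigma>(2) that zS
      by (auto simp: S.commute [of "- z" x])
    then show "\<exists>z\<in>sphere_pts n. \<forall>x\<in>\<sigma>. \<delta> < geodesic_dist n z x"
      using uminus_in_sphere [OF zS] by blast
  next
    assume "\<exists>z\<in>sphere_pts n. \<forall>x\<in>\<sigma>. \<delta> < geodesic_dist n z x"
    then obtain z where z: "z \<in> sphere_pts n" "\<And>x. x \<in> \<sigma> \<Longrightarrow> \<delta> < geodesic_dist n z x"
      by blast
    have "- z \<in> S.mball x (pi - \<delta>)" if "x \<in> \<sigma>" for x
      using z(2) [OF that] z(1) geodesic_dist_uminus [of x n z] \<sigma>(2) that uminus_in_sphere [OF z(1)]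
      by (auto simp: S.commute [of z x])
    then show "(\<Inter>x\<in>\<sigma>. S.mball x (pi - \<delta>)) \<noteq> {}"
      by blast
  qed
  then show ?thesis
    unfolding S.cech_complex_def nbhd_complex_def by (intro Collect_cong conj_cong refl)
qed

lemma singleton_in_cech: "x \<in> sphere_pts n \<Longrightarrow> {x} \<in> cech"
proof -
  assume x: "x \<in> sphere_pts n"
  then have "x \<in> S.mball x (pi - \<delta>)"
    using \<delta> by simp
  then have "S.mball x (pi - \<delta>) \<noteq> {}"
    by blast
  then show ?thesis
    using x by (simp add: S.cech_complex_def)
qed

lemma simplicial_complex_cech: "simplicial_complex cech"
  unfolding cech_eq_nbhd_complex by (rule simplicial_complex_nbhd_complex)

definition covers_with :: "real \<Rightarrow> nat \<Rightarrow> bool" where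
  "covers_with r m \<longleftrightarrow> m \<ge> 1 \<and> (\<exists>x. (\<forall>i\<in>{1..m}. x i \<in> sphere_pts n) \<and> (\<Union>i\<in>{1..m}. S.mcball (x i) r) = sphere_pts n)"

lemma num_cover_eq: "S.num_cover r = (LEAST m. covers_with r m)"
  by (simp add: S.num_cover_def covers_with_def)

lemma finite_set_covers:
  assumes T: "finite T" "T \<subseteq> sphere_pts n" "sphere_pts n \<subseteq> (\<Union>x\<in>T. S.mcball x r)"
  shows "covers_with r (card T)"
proof -
  have "T \<noteq> {}"
  proof
    assume "T = {}"
    then show False
      using T(3) sphere_pts_nonempty by simp
  qed
  obtain h where h: "bij_betw h {1..card T} T"
    using ex_bij_betw_nat_finite_1 [OF T(1)] by blast
  then have hT: "h ` {1..card T} = T"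
    by (simp add: bij_betw_def)
  have "(\<Union>i\<in>{1..card T}. S.mcball (h i) r) = (\<Union>x\<in>h ` {1..card T}. S.mcball x r)"
    by (simp only: image_image)
  also have "\<dots> = (\<Union>x\<in>T. S.mcball x r)"
    by (simp only: hT)
  also have "\<dots> = sphere_pts n"
  proof (rule subset_antisym [OF _ T(3)])
    show "(\<Union>x\<in>T. S.mcball x r) \<subseteq> sphere_pts n"
      by (rule UN_least) (rule S.mcball_subset_mspace)
  qed
  finally have cover: "(\<Union>i\<in>{1..card T}. S.mcball (h i) r) = sphere_pts n" .
  have "card T \<ge> 1"
    using T(1) \<open>T \<noteq> {}\<close> by (simp add: Suc_le_eq card_gt_0_iff)
  moreover have "\<forall>i\<in>{1..card T}. h i \<in> sphere_pts n"
    using hT T(2) by blast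
  ultimately show ?thesis
    unfolding covers_with_def using cover by (intro conjI exI [of _ h])
qed

text \<open>
  Without finite covers the covering number would be the least element of an empty set. They exist because the
  sphere is compact.
\<close>

lemma ex_cover:
  assumes "0 < r"
  shows "\<exists>m. covers_with r m"
proof (cases "r \<ge> pi")
  case True
  have "sphere_pts n \<subseteq> S.mcball nsphere_base r"
  proof
    fix y assume y: "y \<in> sphere_pts n"
    have "geodesic_dist n nsphere_base y \<le> pi"
      using y nsphere_base_in [of n] sphere_inner_le_1 [OF nsphere_base_in y]
      by (simp add: geodesic_dist_def arccos_ubound abs_le_iff)
    then show "y \<in> S.mcball nsphere_base r"
      using True y nsphere_base_in [of n] by simp
  qed
  then have "covers_with r (card {nsphere_base :: nat \<Rightarrow> real})"
    using nsphere_base_in [of n] by (intro finite_set_covers) simp_all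
  then show ?thesis ..
next
  case False
  define U where "U x = {y \<in> sphere_pts n. (\<Sum>i\<le>n. x i * y i) \<in> {cos r<..}}" for x
  have "openin (nsphere n) (U x)" for x
    unfolding U_def
    by (intro openin_continuous_map_preimage [of _ euclideanreal] continuous_intros continuous_map_nsphere_projection) auto
  moreover have "x \<in> U x" if "x \<in> sphere_pts n" for x
  proof -
    have "(\<Sum>i\<le>n. x i * x i) = 1"
      using that by (simp add: sphere_pts_eq power2_eq_square)
    moreover have "cos r < cos 0"
      using assms False by (intro cos_monotone_0_pi) auto
    ultimately show ?thesis
      using that by (simp add: U_def)
  qed
  ultimately obtain T where T: "finite T" "T \<subseteq> U ` sphere_pts n" "sphere_pts n \<subseteq> \<Union>T"
    using compactinD [OF compact_space_nsphere [of n, unfolded compact_space_def], of "U ` sphere_pts n"] by blast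
  obtain T' where T': "finite T'" "T' \<subseteq> sphere_pts n" "T = U ` T'"
    using T(1,2) by (meson finite_subset_image)
  have "U x \<subseteq> S.mcball x r" if x: "x \<in> T'" for x
  proof
    fix y assume y: "y \<in> U x"
    have xy: "x \<in> sphere_pts n" "y \<in> sphere_pts n"
      using x y T' by (auto simp: U_def)
    have "arccos (\<Sum>i\<le>n. x i * y i) \<le> arccos (cos r)"
      using y sphere_inner_le_1 [OF xy] by (intro arccos_le_arccos) (auto simp: U_def abs_le_iff)
    also have "\<dots> = r"
      using assms False by (intro arccos_cos) auto
    finally show "y \<in> S.mcball x r"
      using xy by (simp add: geodesic_dist_def)
  qed
  then have "sphere_pts n \<subseteq> (\<Union>x\<in>T'. S.mcball x r)"
    using T(3) T'(3) by blast
  then show ?thesis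
    using finite_set_covers [OF T'(1,2)] by blast
qed

lemma covers_with_num_cover: "0 < r \<Longrightarrow> covers_with r (S.num_cover r)"
  unfolding num_cover_eq using ex_cover by (rule LeastI_ex)

lemma num_cover_le: "covers_with r m \<Longrightarrow> S.num_cover r \<le> m"
  unfolding num_cover_eq by (rule Least_le)

lemma two_le_num_cover: "2 \<le> S.num_cover \<delta>"
proof (rule ccontr)
  assume "\<not> ?thesis"
  then have "covers_with \<delta> 1"
    using covers_with_num_cover [OF \<delta>(1)] by (cases "S.num_cover \<delta> = 1") (auto simp: covers_with_def)
  then obtain x where x: "x \<in> sphere_pts n" "S.mcball x \<delta> = sphere_pts n"
    by (auto simp: covers_with_def)
  then have "- x \<in> S.mcball x \<delta>"
    using uminus_in_sphere by blast
  moreover have "geodesic_dist n x (- x) = pi"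
    using geodesic_dist_uminus [OF x(1) x(1)] x(1) by simp
  ultimately show False
    using \<delta> by simp
qed

text \<open>
  Fewer points than the covering number leave some \<open>z\<close> outside the balls of radius
  \<open>\<delta>\<close> around them, and \<open>z\<close> is a common neighbour.
\<close>

lemma small_sets_in_cech:
  assumes "finite \<sigma>" "\<sigma> \<noteq> {}" "\<sigma> \<subseteq> sphere_pts n" "card \<sigma> < S.num_cover \<delta>"
  shows "\<sigma> \<in> cech"
proof -
  have "\<not> covers_with \<delta> (card \<sigma>)"
    using num_cover_le [of \<delta> "card \<sigma>"] assms(4) by auto
  then obtain z where z: "z \<in> sphere_pts n" "z \<notin> (\<Union>x\<in>\<sigma>. S.mcball x \<delta>)"
    using finite_set_covers [OF assms(1,3)] by blast
  then have "\<forall>x\<in>\<sigma>. \<delta> < geodesic_dist n z x"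
    using assms(3) by (auto simp: S.commute [of z] subset_iff not_le)
  then show ?thesis
    unfolding cech_eq_nbhd_complex nbhd_complex_def using assms z(1) by blast
qed

lemma cech_homotopy_trivial:
  assumes "i + 3 \<le> S.num_cover \<delta>"
  shows "trivial_homotopy_group i (geometric_realization cech)"
proof (rule homotopy_trivial_if_full_skeleton [OF simplicial_complex_cech])
  fix \<sigma> assume \<sigma>: "finite \<sigma>" "\<sigma> \<noteq> {}" "\<sigma> \<subseteq> \<Union>cech" "card \<sigma> \<le> i + 2"
  have "\<Union>cech \<subseteq> sphere_pts n"
    by (auto simp: S.cech_complex_def)
  then show "\<sigma> \<in> cech"
    using \<sigma> assms by (intro small_sets_in_cech) auto
qed

text \<open>
  Colour each point by a ball of radius \<open>\<delta> / 2\<close> that contains it. Points of equal colour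
  have distance at most \<open>\<delta>\<close>, so the colouring is proper.
\<close>

lemma cech_homotopy_nontrivial:
  "\<exists>i. i + 2 \<le> S.num_cover (\<delta> / 2) \<and> \<not> trivial_homotopy_group i (geometric_realization cech)"
proof -
  define m where "m = S.num_cover (\<delta> / 2)"
  obtain x where x: "\<forall>i\<in>{1..m}. x i \<in> sphere_pts n"
    and cover: "(\<Union>i\<in>{1..m}. S.mcball (x i) (\<delta> / 2)) = sphere_pts n"
    using covers_with_num_cover [of "\<delta> / 2"] \<delta>(1) unfolding covers_with_def m_def by auto
  \<comment> \<open>Balls are numbered from \<open>1\<close>, colours from \<open>0\<close>.\<close>
  define c where "c y = (SOME i. i \<in> {1..m} \<and> y \<in> S.mcball (x i) (\<delta> / 2)) - 1" for y
  have c: "c y < m \<and> y \<in> S.mcball (x (Suc (c y))) (\<delta> / 2)" if "y \<in> sphere_pts n" for y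
  proof -
    have "\<exists>i. i \<in> {1..m} \<and> y \<in> S.mcball (x i) (\<delta> / 2)"
      using that cover by blast
    from someI_ex [OF this] show ?thesis
      by (auto simp: c_def)
  qed
  have "\<exists>j<m. \<not> acyclic_at cech j"
    unfolding cech_eq_nbhd_complex
  proof (rule colouring_obstructs_acyclicity)
    show "nsphere_base \<in> sphere_pts n"
      by (rule nsphere_base_in)
    show "c y < m" if "y \<in> sphere_pts n" for y
      using c [OF that] by blast
    show "\<delta> < geodesic_dist n z y" if "\<delta> < geodesic_dist n y z" for y z
      using that by (simp add: S.commute)
    show "c y \<noteq> c z" if yz: "y \<in> sphere_pts n" "z \<in> sphere_pts n" "\<delta> < geodesic_dist n y z" for y z
    proof
      assume "c y = c z"
      then have "y \<in> S.mcball (x (Suc (c y))) (\<delta> / 2)" "z \<in> S.mcball (x (Suc (c y))) (\<delta> / 2)"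
        using c [OF yz(1)] c [OF yz(2)] by simp_all
      then have "geodesic_dist n y z \<le> \<delta> / 2 + \<delta> / 2"
        using S.triangle [of y "x (Suc (c y))" z] by (auto simp: S.commute [of y])
      then show False
        using yz(3) by simp
    qed
  qed
  then obtain j where j: "j < m" "\<not> acyclic_at cech j"
    by blast
  have "cech \<noteq> {}"
    using singleton_in_cech [OF nsphere_base_in] by blast
  then obtain i where "i < j" "\<not> trivial_homotopy_group i (geometric_realization cech)"
    using acyclic_if_homotopy_trivial [OF simplicial_complex_cech, of j] j(2) by blast
  then show ?thesis
    using j(1) by (intro exI [of _ i]) (simp add: m_def)
qed

end

theorem corollary1p2:
  fixes n :: nat and \<delta> :: real
  assumes "n \<ge> 1" and "0 < \<delta>" and "\<delta> < pi"
  shows "ereal (1 / 2 * real (Metric_space.num_cover (sphere_pts n) (geodesic_dist n) \<delta>) - 2)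
           \<le> conn (geometric_realization
                (Metric_space.cech_complex (sphere_pts n) (geodesic_dist n) (pi - \<delta>)))
       \<and> conn (geometric_realization
                (Metric_space.cech_complex (sphere_pts n) (geodesic_dist n) (pi - \<delta>)))
           \<le> ereal (real (Metric_space.num_cover (sphere_pts n) (geodesic_dist n) (\<delta> / 2)) - 2)"
proof -
  let ?Y = "geometric_realization (Metric_space.cech_complex (sphere_pts n) (geodesic_dist n) (pi - \<delta>))"
  define N where "N = Metric_space.num_cover (sphere_pts n) (geodesic_dist n) \<delta>"
  define M where "M = Metric_space.num_cover (sphere_pts n) (geodesic_dist n) (\<delta> / 2)"
  have N2: "2 \<le> N"
    unfolding N_def by (rule two_le_num_cover [OF assms(2,3)])
  have "trivial_homotopy_group i ?Y" if "int i \<le> int N - 3" for i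
    by (rule cech_homotopy_trivial [OF assms(2,3)]) (use that in \<open>simp add: N_def\<close>)
  then have "ereal (real_of_int (int N - 3)) \<le> conn ?Y"
    unfolding conn_def by (intro Sup_upper) blast
  moreover have "ereal (1 / 2 * real N - 2) \<le> ereal (real_of_int (int N - 3))"
    using N2 by simp
  ultimately have "ereal (1 / 2 * real N - 2) \<le> conn ?Y"
    by (rule order_trans [rotated])
  moreover have "conn ?Y \<le> ereal (real M - 2)"
    unfolding conn_def
  proof (rule Sup_least)
    fix e assume "e \<in> {ereal (real_of_int k) |k. \<forall>i. int i \<le> k \<longrightarrow> trivial_homotopy_group i ?Y}"
    then obtain k where k: "e = ereal (real_of_int k)" "\<And>i. int i \<le> k \<Longrightarrow> trivial_homotopy_group i ?Y"
      by blast
    obtain i where i: "i + 2 \<le> M" "\<not> trivial_homotopy_group i ?Y"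
      using cech_homotopy_nontrivial [OF assms(2,3)] unfolding M_def by blast
    then have "k < int i"
      using k(2) [of i] by force
    then show "e \<le> ereal (real M - 2)"
      using i(1) k(1) by simp
  qed
  ultimately show ?thesis
    unfolding N_def M_def by blast
qed

end
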